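(* The subset sum problem with weak digraph constraint (SSGW), restricted to instances whose digraph $G$ is a minimal series-parallel digraph with $n$ vertices and $m$ arcs, can be solved in $\mathcal{O}(n\cdot c^4+m)$ time and $\mathcal{O}(n\cdot c^2)$ space, where $c$ is the capacity.
   Context: An instance consists of a set $A=\{a_1,\ldots,a_n\}$ of items, each $a_j$ with a positive integer size $s_j$, a positive integer capacity $c$, and a digraph $G=(A,E)$ without loops on the items. For $A'\subseteq A$ let $s(A')=\sum_{a_j\in A'}s_j$, and for $y\in A$ let $N^-(y)=\{u\in A : (u,y)\in E\}$. The capacity constraint is $s(A')\le c$. The weak digraph constraint is: for every $y\in A$, if $N^-(y)\neq\emptyset$ and $N^-(y)\subseteq A'$ then $y\in A'$. SSGW asks for $A'\subseteq A$ maximizing $s(A')$ subject to the capacity constraint and the weak digraph constraint. Minimal series-parallel digraphs: for vertex-disjoint digraphs $G_1=(V_1,E_1)$, $G_2=(V_2,E_2)$, let $O_1$ be the set of sinks of $G_1$ and $I_2$ the set of sources of $G_2$; the parallel composition has vertex set $V_1\cup V_2$ and arc set $E_1\cup E_2$; the series composition has vertex set $V_1\cup V_2$ and arc set $E_1\cup E_2\cup(O_1\times I_2)$. Minimal series-parallel digraphs form the smallest class containing every single-vertex digraph and closed under these two compositions of vertex-disjoint members. *)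

theory Defs
  imports "Graph_Theory.Pair_Digraph"
begin

section \<open>Minimal series-parallel digraphs\<close>

definition sources :: "'a pair_pre_digraph \<Rightarrow> 'a set" where
  "sources G = {v \<in> pverts G. \<forall>u. (u, v) \<notin> parcs G}"

definition sinks :: "'a pair_pre_digraph \<Rightarrow> 'a set" where
  "sinks G = {v \<in> pverts G. \<forall>w. (v, w) \<notin> parcs G}"

definition single_vertex :: "'a \<Rightarrow> 'a pair_pre_digraph" where
  "single_vertex v = \<lparr>pverts = {v}, parcs = {}\<rparr>"

definition parallel_comp ::
    "'a pair_pre_digraph \<Rightarrow> 'a pair_pre_digraph \<Rightarrow> 'a pair_pre_digraph" where
  "parallel_comp G1 G2 =
     \<lparr>pverts = pverts G1 \<union> pverts G2, parcs = parcs G1 \<union> parcs G2\<rparr>"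

definition series_comp ::
    "'a pair_pre_digraph \<Rightarrow> 'a pair_pre_digraph \<Rightarrow> 'a pair_pre_digraph" where
  "series_comp G1 G2 =
     \<lparr>pverts = pverts G1 \<union> pverts G2,
      parcs = parcs G1 \<union> parcs G2 \<union> sinks G1 \<times> sources G2\<rparr>"

inductive minimal_series_parallel :: "'a pair_pre_digraph \<Rightarrow> bool" where
  single: "minimal_series_parallel (single_vertex v)"
| parallel: "\<lbrakk>minimal_series_parallel G1; minimal_series_parallel G2;
    pverts G1 \<inter> pverts G2 = {}\<rbrakk> \<Longrightarrow> minimal_series_parallel (parallel_comp G1 G2)"
| series: "\<lbrakk>minimal_series_parallel G1; minimal_series_parallel G2;
    pverts G1 \<inter> pverts G2 = {}\<rbrakk> \<Longrightarrow> minimal_series_parallel (series_comp G1 G2)"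


section \<open>Subset sum with weak digraph constraint\<close>

text \<open>The items of an instance are the vertices of its digraph.\<close>

definition ssgw_instance :: "'a pair_pre_digraph \<Rightarrow> ('a \<Rightarrow> nat) \<Rightarrow> nat \<Rightarrow> bool" where
  "ssgw_instance G s c \<longleftrightarrow> pair_digraph G \<and> (\<forall>a \<in> pverts G. 0 < s a) \<and> 0 < c"

definition in_nbrs :: "'a pair_pre_digraph \<Rightarrow> 'a \<Rightarrow> 'a set" where
  "in_nbrs G y = {u \<in> pverts G. (u, y) \<in> parcs G}"

definition weak_digraph_constraint :: "'a pair_pre_digraph \<Rightarrow> 'a set \<Rightarrow> bool" where
  "weak_digraph_constraint G A' \<longleftrightarrow>
     (\<forall>y \<in> pverts G. in_nbrs G y \<noteq> {} \<and> in_nbrs G y \<subseteq> A' \<longrightarrow> y \<in> A')"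

definition ssgw_feasible ::
    "'a pair_pre_digraph \<Rightarrow> ('a \<Rightarrow> nat) \<Rightarrow> nat \<Rightarrow> 'a set \<Rightarrow> bool" where
  "ssgw_feasible G s c A' \<longleftrightarrow>
     A' \<subseteq> pverts G \<and> sum s A' \<le> c \<and> weak_digraph_constraint G A'"

definition ssgw_solution ::
    "'a pair_pre_digraph \<Rightarrow> ('a \<Rightarrow> nat) \<Rightarrow> nat \<Rightarrow> 'a set \<Rightarrow> bool" where
  "ssgw_solution G s c A' \<longleftrightarrow> is_arg_max (sum s) (ssgw_feasible G s c) A'"


section \<open>Random access machine\<close>

text \<open>
  Time and space are measured on a random access machine with a read-only input array,
  one array of read-write memory cells indexed by natural numbers, and finitely many
  registers, those named in the program (so their number does not depend on the input).
  Programs are structured; there is no operation beyond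
  addition, truncated subtraction, multiplication, comparison and indexed access.

  Three quantities are controlled.  Each operation, access, assignment and test costs
  one time unit.  Only memory cells with address below \<open>S\<close> may be accessed, so
  \<open>S\<close> is the number of working cells, not counting the read-only input
  and the registers.  Every
  value that occurs, intermediate results included, is at most \<open>W\<close>; without this
  restriction one cell could hold a whole table.  A program that violates the
  limits \<open>S\<close> or \<open>W\<close>, or reads beyond the end of the input, gets stuck and
  has no execution.
\<close>

datatype expr =
    Const nat
  | Reg string
  | Input expr
  | Mem expr
  | Plus expr expr
  | Minus expr expr
  | Times expr expr

datatype test =
    Less expr expr
  | Equal expr expr
  | Not test
  | And test test

datatype program =
    Skip
  | Assign string expr
  | Store expr expr  \<comment> \<open>address, value\<close>
  | Seq program program
  | If test program program
  | While test program

record state =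
  reg :: "string \<Rightarrow> nat"
  mem :: "nat \<Rightarrow> nat"

definition initial_state :: state where
  "initial_state = \<lparr>reg = (\<lambda>_. 0), mem = (\<lambda>_. 0)\<rparr>"

fun eval :: "nat list \<Rightarrow> state \<Rightarrow> expr \<Rightarrow> nat" where
  "eval inp \<sigma> (Const k) = k"
| "eval inp \<sigma> (Reg x) = reg \<sigma> x"
| "eval inp \<sigma> (Input e) = inp ! eval inp \<sigma> e"
| "eval inp \<sigma> (Mem e) = mem \<sigma> (eval inp \<sigma> e)"
| "eval inp \<sigma> (Plus e1 e2) = eval inp \<sigma> e1 + eval inp \<sigma> e2"
| "eval inp \<sigma> (Minus e1 e2) = eval inp \<sigma> e1 - eval inp \<sigma> e2"
| "eval inp \<sigma> (Times e1 e2) = eval inp \<sigma> e1 * eval inp \<sigma> e2"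

fun holds :: "nat list \<Rightarrow> state \<Rightarrow> test \<Rightarrow> bool" where
  "holds inp \<sigma> (Less e1 e2) \<longleftrightarrow> eval inp \<sigma> e1 < eval inp \<sigma> e2"
| "holds inp \<sigma> (Equal e1 e2) \<longleftrightarrow> eval inp \<sigma> e1 = eval inp \<sigma> e2"
| "holds inp \<sigma> (Not b) \<longleftrightarrow> \<not> holds inp \<sigma> b"
| "holds inp \<sigma> (And b1 b2) \<longleftrightarrow> holds inp \<sigma> b1 \<and> holds inp \<sigma> b2"

fun expr_ok :: "nat \<Rightarrow> nat \<Rightarrow> nat list \<Rightarrow> state \<Rightarrow> expr \<Rightarrow> bool" where
  "expr_ok W S inp \<sigma> (Const k) \<longleftrightarrow> k \<le> W"
| "expr_ok W S inp \<sigma> (Reg x) \<longleftrightarrow> reg \<sigma> x \<le> W"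
| "expr_ok W S inp \<sigma> (Input e) \<longleftrightarrow> expr_ok W S inp \<sigma> e \<and>
     eval inp \<sigma> e < length inp \<and> eval inp \<sigma> (Input e) \<le> W"
| "expr_ok W S inp \<sigma> (Mem e) \<longleftrightarrow> expr_ok W S inp \<sigma> e \<and>
     eval inp \<sigma> e < S \<and> eval inp \<sigma> (Mem e) \<le> W"
| "expr_ok W S inp \<sigma> (Plus e1 e2) \<longleftrightarrow> expr_ok W S inp \<sigma> e1 \<and> expr_ok W S inp \<sigma> e2 \<and>
     eval inp \<sigma> (Plus e1 e2) \<le> W"
| "expr_ok W S inp \<sigma> (Minus e1 e2) \<longleftrightarrow> expr_ok W S inp \<sigma> e1 \<and> expr_ok W S inp \<sigma> e2"
| "expr_ok W S inp \<sigma> (Times e1 e2) \<longleftrightarrow> expr_ok W S inp \<sigma> e1 \<and> expr_ok W S inp \<sigma> e2 \<and>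
     eval inp \<sigma> (Times e1 e2) \<le> W"

text \<open>Conjunction is not short-circuited: both operands are evaluated and charged.\<close>

fun test_ok :: "nat \<Rightarrow> nat \<Rightarrow> nat list \<Rightarrow> state \<Rightarrow> test \<Rightarrow> bool" where
  "test_ok W S inp \<sigma> (Less e1 e2) \<longleftrightarrow> expr_ok W S inp \<sigma> e1 \<and> expr_ok W S inp \<sigma> e2"
| "test_ok W S inp \<sigma> (Equal e1 e2) \<longleftrightarrow> expr_ok W S inp \<sigma> e1 \<and> expr_ok W S inp \<sigma> e2"
| "test_ok W S inp \<sigma> (Not b) \<longleftrightarrow> test_ok W S inp \<sigma> b"
| "test_ok W S inp \<sigma> (And b1 b2) \<longleftrightarrow> test_ok W S inp \<sigma> b1 \<and> test_ok W S inp \<sigma> b2"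

fun expr_cost :: "expr \<Rightarrow> nat" where
  "expr_cost (Const k) = 1"
| "expr_cost (Reg x) = 1"
| "expr_cost (Input e) = 1 + expr_cost e"
| "expr_cost (Mem e) = 1 + expr_cost e"
| "expr_cost (Plus e1 e2) = 1 + expr_cost e1 + expr_cost e2"
| "expr_cost (Minus e1 e2) = 1 + expr_cost e1 + expr_cost e2"
| "expr_cost (Times e1 e2) = 1 + expr_cost e1 + expr_cost e2"

fun test_cost :: "test \<Rightarrow> nat" where
  "test_cost (Less e1 e2) = 1 + expr_cost e1 + expr_cost e2"
| "test_cost (Equal e1 e2) = 1 + expr_cost e1 + expr_cost e2"
| "test_cost (Not b) = 1 + test_cost b"
| "test_cost (And b1 b2) = 1 + test_cost b1 + test_cost b2"

text \<open>\<open>exec W S inp P \<sigma> t \<tau>\<close>: started in \<open>\<sigma>\<close>, program \<open>P\<close> halts in state \<open>\<tau>\<close> after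
  \<open>t\<close> time units without violating the limits.\<close>

inductive exec ::
    "nat \<Rightarrow> nat \<Rightarrow> nat list \<Rightarrow> program \<Rightarrow> state \<Rightarrow> nat \<Rightarrow> state \<Rightarrow> bool"
  for W S :: nat and inp :: "nat list" where
  Skip: "exec W S inp Skip \<sigma> 1 \<sigma>"
| Assign: "expr_ok W S inp \<sigma> e \<Longrightarrow>
    exec W S inp (Assign x e) \<sigma> (1 + expr_cost e)
      (\<sigma>\<lparr>reg := (reg \<sigma>)(x := eval inp \<sigma> e)\<rparr>)"
| Store: "\<lbrakk>expr_ok W S inp \<sigma> a; expr_ok W S inp \<sigma> e; eval inp \<sigma> a < S\<rbrakk> \<Longrightarrow>
    exec W S inp (Store a e) \<sigma> (1 + expr_cost a + expr_cost e)
      (\<sigma>\<lparr>mem := (mem \<sigma>)(eval inp \<sigma> a := eval inp \<sigma> e)\<rparr>)"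
| Seq: "\<lbrakk>exec W S inp P \<sigma> t \<tau>; exec W S inp Q \<tau> u \<rho>\<rbrakk> \<Longrightarrow>
    exec W S inp (Seq P Q) \<sigma> (t + u) \<rho>"
| IfTrue: "\<lbrakk>test_ok W S inp \<sigma> b; holds inp \<sigma> b; exec W S inp P \<sigma> t \<tau>\<rbrakk> \<Longrightarrow>
    exec W S inp (If b P Q) \<sigma> (1 + test_cost b + t) \<tau>"
| IfFalse: "\<lbrakk>test_ok W S inp \<sigma> b; \<not> holds inp \<sigma> b; exec W S inp Q \<sigma> t \<tau>\<rbrakk> \<Longrightarrow>
    exec W S inp (If b P Q) \<sigma> (1 + test_cost b + t) \<tau>"
| WhileFalse: "\<lbrakk>test_ok W S inp \<sigma> b; \<not> holds inp \<sigma> b\<rbrakk> \<Longrightarrow>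
    exec W S inp (While b P) \<sigma> (1 + test_cost b) \<sigma>"
| WhileTrue: "\<lbrakk>test_ok W S inp \<sigma> b; holds inp \<sigma> b; exec W S inp P \<sigma> t \<tau>;
    exec W S inp (While b P) \<tau> u \<rho>\<rbrakk> \<Longrightarrow>
    exec W S inp (While b P) \<sigma> (1 + test_cost b + t + u) \<rho>"

inductive_cases exec_SkipE: "exec W S inp Skip \<sigma> t \<tau>"
inductive_cases exec_AssignE: "exec W S inp (Assign x e) \<sigma> t \<tau>"
inductive_cases exec_StoreE: "exec W S inp (Store a e) \<sigma> t \<tau>"
inductive_cases exec_SeqE: "exec W S inp (Seq P Q) \<sigma> t \<tau>"
inductive_cases exec_IfE: "exec W S inp (If b P Q) \<sigma> t \<tau>"
inductive_cases exec_WhileE: "exec W S inp (While b P) \<sigma> t \<tau>"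

lemma exec_deterministic:
  "exec W S inp P \<sigma> t \<tau> \<Longrightarrow> exec W S inp P \<sigma> t' \<tau>' \<Longrightarrow> t' = t \<and> \<tau>' = \<tau>"
proof (induction arbitrary: t' \<tau>' rule: exec.induct)
  case (Skip \<sigma>)
  from Skip.prems show ?case by (rule exec_SkipE) simp
next
  case (Assign \<sigma> e x)
  from Assign.prems show ?case by (rule exec_AssignE) simp
next
  case (Store \<sigma> a e)
  from Store.prems show ?case by (rule exec_StoreE) simp
next
  case (Seq P \<sigma> t \<tau> Q u \<rho>)
  from Seq.prems show ?case by (rule exec_SeqE) (use Seq.IH in force)
next
  case (IfTrue \<sigma> b P t \<tau> Q)
  from IfTrue.prems show ?case by (rule exec_IfE) (use IfTrue.hyps IfTrue.IH in force)+
next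
  case (IfFalse \<sigma> b Q t \<tau> P)
  from IfFalse.prems show ?case by (rule exec_IfE) (use IfFalse.hyps IfFalse.IH in force)+
next
  case (WhileFalse \<sigma> b P)
  from WhileFalse.prems show ?case by (rule exec_WhileE) (use WhileFalse.hyps in force)+
next
  case (WhileTrue \<sigma> b P t \<tau> u \<rho>)
  from WhileTrue.prems show ?case
    by (rule exec_WhileE) (use WhileTrue.hyps WhileTrue.IH in force)+
qed


section \<open>Solving SSGW\<close>

text \<open>
  The items are numbered \<open>0, \<dots>, n - 1\<close>; the arcs are given as a list in arbitrary order.
\<close>

definition encode :: "nat \<Rightarrow> (nat \<Rightarrow> nat) \<Rightarrow> nat \<Rightarrow> (nat \<times> nat) list \<Rightarrow> nat list" where
  "encode n s c es =
     [n, length es, c] @ map s [0..<n] @ concat (map (\<lambda>(u, v). [u, v]) es)"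

text \<open>Words of \<open>O(log N)\<close> bits for \<open>N\<close> the largest number in the input: a constant power
  of \<open>N\<close>.  The summand 2 only serves to keep the base above 1.\<close>

definition word_limit :: "nat \<Rightarrow> nat list \<Rightarrow> nat" where
  "word_limit k inp = (Max (set inp) + 2) ^ k"

text \<open>The answer is the subset whose characteristic vector is left in cells
  \<open>0, \<dots>, n - 1\<close>.\<close>

definition output_set :: "nat \<Rightarrow> state \<Rightarrow> nat set" where
  "output_set n \<tau> = {j. j < n \<and> mem \<tau> j = 1}"

text \<open>
  \<open>solves_ssgw_within k P G s c T S\<close>: for the instance \<open>(G, s, c)\<close> on the items
  \<open>0, \<dots>, n - 1\<close>, and for every ordering of its arcs, \<open>P\<close> halts with
  an optimal subset after at most \<open>T\<close> time units, using only \<open>S\<close> memory cells.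
\<close>

definition solves_ssgw_within ::
    "nat \<Rightarrow> program \<Rightarrow> nat pair_pre_digraph \<Rightarrow> (nat \<Rightarrow> nat) \<Rightarrow> nat \<Rightarrow> nat \<Rightarrow> nat \<Rightarrow> bool" where
  "solves_ssgw_within k P G s c T S \<longleftrightarrow>
     (\<forall>es. distinct es \<and> set es = parcs G \<longrightarrow>
       (let n = card (pverts G); inp = encode n s c es in
         \<exists>t \<tau>. exec (word_limit k inp) S inp P initial_state t \<tau> \<and> t \<le> T \<and>
           ssgw_solution G s c (output_set n \<tau>)))"

end

theory Submission
  imports Defs
begin

text \<open>
  A minimal series-parallel digraph is the line digraph of a two-terminal series-parallel
  multigraph with the items as edges; naming the head of an item after its largest successor, and
  its tail after that of any of its predecessors, this multigraph is found in one pass over the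
  arcs with \<open>O(n)\<close> cells. The weak constraint says that at every inner node, if all entering
  items are chosen, then so are all leaving ones.

  The multigraph is reduced to one edge by series and parallel reductions. Its nodes are visited
  in topological order; at a node, an entering edge is merged with an already known
  parallel one, or with the unique edge into its tail if it is the only one leaving that tail. If
  neither is possible any more, the node has in-degree one, so that all nodes visited form a tree.
  As every reduction removes an edge, \<open>O(n)\<close> steps suffice.

  For every edge a table says which pairs of a total size at most \<open>c\<close> and of two bits (all sources
  chosen, all sinks chosen) are attained by the valid subsets of its items. This suffices, because
  a series composition only adds the condition that, if all sinks of the first part
  are chosen, so are all sources of the second. A table is combined from two others in
  \<open>O(c\<^sup>2)\<close> steps, and the entries remember where they come from.
\<close>

section \<open>Two-terminal series-parallel multigraphs\<close>

text \<open>The input offers no decomposition, and its arcs may be quadratically many, too many to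
  be stored when \<open>c\<close> is small. The line digraph view removes both obstacles: items with
  a common successor share all successors, so successor sets are equal or disjoint and one member
  identifies each.

  Topological order keeps the search for reductions cheap. A series reduction looks back to a node
  with just one in-edge, so a counter of out-edges decides it; a parallel partner is found through
  one array indexed by tails. Neither requires searching a list.

  Edge numbers are never reused: \<open>n\<close> items and one new number per reduction stay below
  \<open>2 * n\<close>, and the tables of consumed edges survive for the extraction of a solution.
  This fixes the memory to \<open>2 * n\<close> tables of \<open>c + 1\<close> records. A record has
  22 cells, eight for a table entry of each flag with its choices and fourteen for nodes, edges and
  the result.

  The time obtained in this way is of order \<open>n * c ^ 2 + m\<close>, which lies within the
  claimed bound.\<close>

definition ends :: "('e \<Rightarrow> 'n) \<Rightarrow> ('e \<Rightarrow> 'n) \<Rightarrow> 'e set \<Rightarrow> 'n set" where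
  "ends org dst E = org ` E \<union> dst ` E"

lemma ends_simps [simp]:
  "ends org dst {} = {}"
  "ends org dst (insert e E) = {org e, dst e} \<union> ends org dst E"
  "ends org dst (A \<union> B) = ends org dst A \<union> ends org dst B"
  by (auto simp: ends_def)

lemma ends_mono: "A \<subseteq> B \<Longrightarrow> ends org dst A \<subseteq> ends org dst B"
  by (auto simp: ends_def)

lemma in_ends: "e \<in> E \<Longrightarrow> org e \<in> ends org dst E" "e \<in> E \<Longrightarrow> dst e \<in> ends org dst E"
  by (auto simp: ends_def)

lemma ends_cong:
  "(\<And>e. e \<in> E \<Longrightarrow> org e = org' e \<and> dst e = dst' e) \<Longrightarrow> ends org dst E = ends org' dst' E"
  by (force simp: ends_def)

text \<open>As \<open>org\<close> and \<open>dst\<close> are fixed, a composition does not identify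
  nodes: the parts must already agree on the shared terminals, and the conditions on
  \<open>ends\<close> exclude any further common node.\<close>

inductive ttsp :: "('e \<Rightarrow> 'n) \<Rightarrow> ('e \<Rightarrow> 'n) \<Rightarrow> 'e set \<Rightarrow> 'n \<Rightarrow> 'n \<Rightarrow> bool"
  for org dst where
  edge: "org e \<noteq> dst e \<Longrightarrow> ttsp org dst {e} (org e) (dst e)"
| ser: "\<lbrakk>ttsp org dst E1 s x; ttsp org dst E2 x t; E1 \<inter> E2 = {};
    ends org dst E1 \<inter> ends org dst E2 \<subseteq> {x}\<rbrakk> \<Longrightarrow> ttsp org dst (E1 \<union> E2) s t"
| par: "\<lbrakk>ttsp org dst E1 s t; ttsp org dst E2 s t; E1 \<inter> E2 = {};
    ends org dst E1 \<inter> ends org dst E2 \<subseteq> {s, t}\<rbrakk> \<Longrightarrow> ttsp org dst (E1 \<union> E2) s t"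

text \<open>In a series composition \<open>s\<close>, an end of the first part other than
  \<open>x\<close>, is no end of the second, and dually for \<open>t\<close>. That nothing enters
  the source or leaves the sink later excludes most ways in which a node could be shared between
  parts.\<close>

lemma ttsp_terminals:
  "ttsp org dst E s t \<Longrightarrow> (\<exists>e\<in>E. org e = s) \<and> (\<exists>e\<in>E. dst e = t) \<and> s \<noteq> t \<and>
     (\<forall>e\<in>E. dst e \<noteq> s \<and> org e \<noteq> t)"
proof (induction rule: ttsp.induct)
  case (ser E1 s x E2 t)
  have "s \<in> ends org dst E1" "t \<in> ends org dst E2"
    using ser.IH unfolding ends_def by blast+
  moreover have "s \<noteq> x" "x \<noteq> t" using ser.IH by auto
  ultimately have st: "s \<notin> ends org dst E2" "t \<notin> ends org dst E1" using ser.hyps(4) by auto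
  then have "s \<noteq> t" using \<open>s \<in> ends org dst E1\<close> by auto
  moreover have "\<forall>e\<in>E1 \<union> E2. dst e \<noteq> s \<and> org e \<noteq> t"
    using ser.IH st unfolding ends_def by blast
  ultimately show ?case using ser.IH by blast
qed auto

lemma ttsp_source: "ttsp org dst E s t \<Longrightarrow> s \<in> ends org dst E"
  and ttsp_sink: "ttsp org dst E s t \<Longrightarrow> t \<in> ends org dst E"
  and ttsp_neq: "ttsp org dst E s t \<Longrightarrow> s \<noteq> t"
  and ttsp_into_source: "ttsp org dst E s t \<Longrightarrow> e \<in> E \<Longrightarrow> dst e \<noteq> s"
  and ttsp_from_sink: "ttsp org dst E s t \<Longrightarrow> e \<in> E \<Longrightarrow> org e \<noteq> t"
  using ttsp_terminals[of org dst E s t] by (auto simp: ends_def)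

lemma ttsp_finite: "ttsp org dst E s t \<Longrightarrow> finite E"
  by (induction rule: ttsp.induct) auto

lemma ttsp_cong:
  assumes "ttsp org dst E s t" "\<And>e. e \<in> E \<Longrightarrow> org e = org' e \<and> dst e = dst' e"
  shows "ttsp org' dst' E s t"
  using assms
proof (induction rule: ttsp.induct)
  case (edge e)
  then show ?case using ttsp.edge[of org' e dst'] by auto
next
  case (ser E1 s x E2 t)
  have "ends org dst E1 = ends org' dst' E1" "ends org dst E2 = ends org' dst' E2"
    using ser.prems by (auto intro!: ends_cong)
  then show ?case using ser by - (rule ttsp.ser[where x = x], (auto))
next
  case (par E1 s t E2)
  have "ends org dst E1 = ends org' dst' E1" "ends org dst E2 = ends org' dst' E2"
    using par.prems by (auto intro!: ends_cong)
  then show ?case using par by - (rule ttsp.par, (auto))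
qed

lemma ttsp_edgeI: "org e = s \<Longrightarrow> dst e = t \<Longrightarrow> s \<noteq> t \<Longrightarrow> ttsp org dst {e} s t"
  using ttsp.edge by metis

text \<open>Reversing all edges exchanges the terminals, so facts about the sink carry over to the
  source.\<close>

lemma ttsp_converse: "ttsp org dst E s t \<Longrightarrow> ttsp dst org E t s"
proof (induction rule: ttsp.induct)
  case (edge e)
  then show ?case by (intro ttsp_edgeI) auto
next
  case (ser E1 s x E2 t)
  have "ttsp dst org (E2 \<union> E1) t s"
    using ser by - (rule ttsp.ser[where x = x], (auto simp: ends_def))
  then show ?case by (simp add: Un_commute)
next
  case (par E1 s t E2)
  then show ?case by - (rule ttsp.par, (auto simp: ends_def))
qed

lemma ttsp_serI: "\<lbrakk>ttsp org dst E1 s x; ttsp org dst E2 x t; E1 \<inter> E2 = {};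
    ends org dst E1 \<inter> ends org dst E2 \<subseteq> {x}; E = E1 \<union> E2\<rbrakk> \<Longrightarrow> ttsp org dst E s t"
  using ttsp.ser by metis

lemma ttsp_parI: "\<lbrakk>ttsp org dst E1 s t; ttsp org dst E2 s t; E1 \<inter> E2 = {};
    ends org dst E1 \<inter> ends org dst E2 \<subseteq> {s, t}; E = E1 \<union> E2\<rbrakk> \<Longrightarrow> ttsp org dst E s t"
  using ttsp.par by metis

subsection \<open>Reductions\<close>

text \<open>A parallel composition has an edge into \<open>t\<close> in both parts, so uniqueness of
  \<open>e\<close> leaves only series compositions, with \<open>e\<close> in the second part.
  Together with its mirror image this opens up both sides of a series composition at the joint,
  where a series reduction takes place.\<close>

lemma ttsp_split_last:
  assumes "ttsp org dst E s t" "e \<in> E" "dst e = t" "\<And>e'. e' \<in> E \<Longrightarrow> dst e' = t \<Longrightarrow> e' = e"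
  shows "E = {e} \<and> org e = s \<or> ttsp org dst (E - {e}) s (org e) \<and> t \<notin> ends org dst (E - {e})"
  using assms
proof (induction rule: ttsp.induct)
  case (edge e')
  then show ?case by auto
next
  case (ser E1 s x E2 t)
  have t1: "t \<notin> ends org dst E1"
    using ser.hyps(4) ttsp_sink[OF ser.hyps(2)] ttsp_neq[OF ser.hyps(2)] by blast
  then have "e \<notin> E1" using ser.prems(1,2) by (auto simp: ends_def)
  then have e2: "e \<in> E2" using ser.prems by auto
  have "E2 = {e} \<and> org e = x \<or> ttsp org dst (E2 - {e}) x (org e) \<and> t \<notin> ends org dst (E2 - {e})"
    by (rule ser.IH(2)) (use e2 ser.prems in blast)+
  then consider "E2 = {e}" "org e = x" |
    "ttsp org dst (E2 - {e}) x (org e)" "t \<notin> ends org dst (E2 - {e})"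
    by blast
  then show ?case
  proof cases
    case 1
    then have "E1 \<union> E2 - {e} = E1" using \<open>e \<notin> E1\<close> by auto
    then show ?thesis using ser.hyps 1 t1 by auto
  next
    case 2
    have eq: "E1 \<union> E2 - {e} = E1 \<union> (E2 - {e})" using \<open>e \<notin> E1\<close> by auto
    have "ends org dst (E2 - {e}) \<subseteq> ends org dst E2" by (auto intro!: ends_mono)
    then have "ttsp org dst (E1 \<union> (E2 - {e})) s (org e)"
      using ser.hyps 2 by - (rule ttsp.ser[where x = x], (auto))
    then show ?thesis using 2 t1 unfolding eq by simp
  qed
next
  case (par E1 s t E2)
  obtain e1 e2 where "e1 \<in> E1" "dst e1 = t" "e2 \<in> E2" "dst e2 = t"
    using ttsp_terminals[OF par.hyps(1)] ttsp_terminals[OF par.hyps(2)] by blast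
  then show ?case using par.hyps par.prems by blast
qed

lemma ttsp_split_first:
  assumes "ttsp org dst E s t" "e \<in> E" "org e = s" "\<And>e'. e' \<in> E \<Longrightarrow> org e' = s \<Longrightarrow> e' = e"
  shows "E = {e} \<and> dst e = t \<or> ttsp org dst (E - {e}) (dst e) t \<and> s \<notin> ends org dst (E - {e})"
proof -
  have "E = {e} \<and> dst e = t \<or> ttsp dst org (E - {e}) t (dst e) \<and> s \<notin> ends dst org (E - {e})"
    by (rule ttsp_split_last[OF ttsp_converse[OF assms(1)]]) (use assms(2-4) in blast)+
  then show ?thesis using ttsp_converse[of dst org "E - {e}" t "dst e"] by (auto simp: ends_def Un_commute)
qed

text \<open>The first part of a series composition does not touch \<open>t\<close>, and the second
  does not touch \<open>s\<close>. An edge from \<open>s\<close> to \<open>t\<close> that is not the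
  whole graph therefore lies in a part of a parallel composition.\<close>

lemma ttsp_split_parallel:
  assumes "ttsp org dst E s t" "e \<in> E" "org e = s" "dst e = t"
  shows "E = {e} \<or> ttsp org dst (E - {e}) s t"
  using assms
proof (induction rule: ttsp.induct)
  case (edge e')
  then show ?case by auto
next
  case (ser E1 s x E2 t)
  have "t \<notin> ends org dst E1"
    using ser.hyps(4) ttsp_sink[OF ser.hyps(2)] ttsp_neq[OF ser.hyps(2)] by blast
  moreover have "s \<notin> ends org dst E2"
    using ser.hyps(4) ttsp_source[OF ser.hyps(1)] ttsp_neq[OF ser.hyps(1)] by blast
  ultimately show ?case using ser.prems by (auto simp: ends_def)
next
  case (par E1 s t E2)
  have *: "E = {e} \<or> ttsp org dst (E - {e}) s t" if "E = A \<union> B" "e \<in> A" "A \<inter> B = {}"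
    "ends org dst A \<inter> ends org dst B \<subseteq> {s, t}" "ttsp org dst B s t"
    "A = {e} \<or> ttsp org dst (A - {e}) s t" for E A B
  proof (cases "A = {e}")
    case True
    then have "E - {e} = B" using that by auto
    then show ?thesis using that by simp
  next
    case False
    have "E - {e} = (A - {e}) \<union> B" using that by auto
    moreover have "ends org dst (A - {e}) \<subseteq> ends org dst A" by (auto intro!: ends_mono)
    ultimately show ?thesis using that False by - (rule disjI2, rule ttsp_parI[of _ _ "A - {e}" _ _ B], (auto))
  qed
  show ?case
  proof (cases "e \<in> E1")
    case True
    show ?thesis by (rule *[of _ E1 E2]) (use par.hyps par.prems par.IH True in blast)+
  next
    case False
    show ?thesis by (rule *[of _ E2 E1]) (use par.hyps par.prems par.IH False in blast)+
  qed
qed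

text \<open>A reduction gives a fresh edge \<open>g\<close> its ends by updating \<open>org\<close>
  and \<open>dst\<close>; edge sets without \<open>g\<close> do not notice.\<close>

lemma ends_upd:
  assumes "g \<notin> E" "A \<subseteq> E"
  shows "ends (org(g := u)) (dst(g := w)) A = ends org dst A"
  using assms by (intro ends_cong) auto

lemma ttsp_upd:
  assumes "g \<notin> E" "ttsp org dst E s t"
  shows "ttsp (org(g := u)) (dst(g := w)) E s t"
  using assms by - (rule ttsp_cong[OF assms(2)], (auto))

text \<open>The node \<open>x\<close> is either the joint of a series composition or an inner node
  of one part. At the joint, \<open>e\<close> ends the first part and \<open>f\<close> starts the
  second: both are split off, \<open>g\<close> takes the place of \<open>e\<close>, and the rest of
  the second part follows. Otherwise induction applies inside the part.\<close>

lemma ttsp_series_reduction: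
  assumes "ttsp org dst E s t" "g \<notin> E" "e \<in> E" "f \<in> E" "dst e = x" "org f = x"
    "\<And>e'. e' \<in> E \<Longrightarrow> dst e' = x \<Longrightarrow> e' = e" "\<And>e'. e' \<in> E \<Longrightarrow> org e' = x \<Longrightarrow> e' = f"
  shows "ttsp (org(g := org e)) (dst(g := dst f)) (insert g (E - {e, f})) s t"
  using assms
proof (induction rule: ttsp.induct)
  case (edge e')
  then show ?case by auto
next
  case (ser E1 s y E2 t)
  let ?org = "org(g := org e)" and ?dst = "dst(g := dst f)"
  note g = \<open>g \<notin> E1 \<union> E2\<close>
  show ?case
  proof (cases "x = y")
    case True
    have e: "e \<in> E1" "e \<notin> E2" using ser.prems(2,4) True ttsp_into_source[OF ser.hyps(2)] by blast+
    have f: "f \<in> E2" "f \<notin> E1" using ser.prems(3,5) True ttsp_from_sink[OF ser.hyps(1)] by blast+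
    have 1: "E1 = {e} \<and> org e = s \<or> ttsp org dst (E1 - {e}) s (org e) \<and> x \<notin> ends org dst (E1 - {e})"
      by (rule ttsp_split_last[OF ser.hyps(1)[folded True] e(1)]) (use ser.prems in blast)+
    have 2: "E2 = {f} \<and> dst f = t \<or> ttsp org dst (E2 - {f}) (dst f) t \<and> x \<notin> ends org dst (E2 - {f})"
      by (rule ttsp_split_first[OF ser.hyps(2)[folded True] f(1)]) (use ser.prems in blast)+
    have eq1: "insert g (E1 \<union> E2 - {e, f}) = (insert g (E1 - {e})) \<union> (E2 - {f})"
      using e f by auto
    have sub: "ends org dst (E1 - {e}) \<subseteq> ends org dst E1" "ends org dst (E2 - {f}) \<subseteq> ends org dst E2"
      by (auto intro!: ends_mono)
    have oe: "org e \<in> ends org dst E1" "org e \<noteq> x" "dst f \<in> ends org dst E2" "dst f \<noteq> x"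
      using e f True ttsp_from_sink[OF ser.hyps(1)] ttsp_into_source[OF ser.hyps(2)]
      by (auto simp: ends_def)
    have ne: "org e \<notin> ends org dst E2" "dst f \<notin> ends org dst E1"
      using oe ser.hyps(4) True by auto
    have gg: "ttsp ?org ?dst {g} (org e) (dst f)"
      by (rule ttsp_edgeI) (use oe ne in auto)
    have 3: "ttsp ?org ?dst (insert g (E1 - {e})) s (dst f)"
    proof (cases "E1 = {e}")
      case True
      then show ?thesis using gg 1 ttsp_neq[OF ser.hyps(1)]
        using ttsp_terminals[OF ser.hyps(1)] by auto
    next
      case False
      then have t1: "ttsp org dst (E1 - {e}) s (org e)" using 1 by auto
      have eq: "ends ?org ?dst (E1 - {e}) = ends org dst (E1 - {e})" by (auto intro!: ends_upd[OF g])
      show ?thesis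
        using g ne sub
        by - (rule ttsp_serI[OF ttsp_upd[OF _ t1] gg], (auto simp: ends_upd eq))
    qed
    show ?thesis
    proof (cases "E2 = {f}")
      case True
      then have "dst f = t" using 2 ttsp_terminals[of org dst "E2 - {f}" "dst f" t] by auto
      then show ?thesis using 3 eq1 True by (simp del: fun_upd_apply)
    next
      case False
      then have t2: "ttsp org dst (E2 - {f}) (dst f) t" "x \<notin> ends org dst (E2 - {f})" using 2 by auto
      have eq: "ends ?org ?dst (E1 - {e}) = ends org dst (E1 - {e})"
        "ends ?org ?dst (E2 - {f}) = ends org dst (E2 - {f})" by (auto intro!: ends_upd[OF g])
      show ?thesis
        unfolding eq1
        apply (rule ttsp.ser[OF 3 ttsp_upd[OF _ t2(1)]])
        using g apply simp
        using g ser.hyps(3) apply blast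
        using ne sub ser.hyps(4) True t2(2) unfolding ends_simps eq by auto
    qed
  next
    case False
    \<comment> \<open>Away from the joint a node belongs to one part only, which keeps
      \<open>e\<close> and \<open>f\<close> together.\<close>
    have ex: "x \<in> ends org dst E1 \<Longrightarrow> x \<in> ends org dst E2 \<Longrightarrow> False" using False ser.hyps by blast
    show ?thesis
    proof (cases "e \<in> E1")
      case True
      then have "x \<in> ends org dst E1" using ser.prems(4) in_ends(2)[of e E1 dst org] by auto
      then have "f \<notin> E2" using ex ser.prems(5) in_ends(1)[of f E2 org dst] by auto
      then have f: "f \<in> E1" using ser.prems(3) by auto
      have "ttsp ?org ?dst (insert g (E1 - {e, f})) s y"
        by (rule ser.IH(1)) (use ser.prems True f in blast)+
      moreover have "ends ?org ?dst (E1 - {e,f}) = ends org dst (E1 - {e,f})"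
        "ends ?org ?dst E2 = ends org dst E2" by (auto intro!: ends_upd[OF g])
      moreover have "ends org dst (E1 - {e,f}) \<subseteq> ends org dst E1" by (auto intro!: ends_mono)
      moreover have "org e \<in> ends org dst E1" "dst f \<in> ends org dst E1"
        using True f by (auto simp: ends_def)
      ultimately show ?thesis
        using ser.hyps ser.prems(1-5) True f g
        by - (rule ttsp_serI[OF _ ttsp_upd[OF _ ser.hyps(2)], where ?E1.0 = "insert g (E1 - {e, f})"], (auto))
    next
      case False
      then have e: "e \<in> E2" using ser.prems(2) by auto
      then have "x \<in> ends org dst E2" using ser.prems(4) in_ends(2)[of e E2 dst org] by auto
      then have "f \<notin> E1" using ex ser.prems(5) in_ends(1)[of f E1 org dst] by auto
      then have f: "f \<in> E2" using ser.prems(3) by auto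
      have "ttsp ?org ?dst (insert g (E2 - {e, f})) y t"
        by (rule ser.IH(2)) (use ser.prems e f in blast)+
      moreover have "ends ?org ?dst (E2 - {e,f}) = ends org dst (E2 - {e,f})"
        "ends ?org ?dst E1 = ends org dst E1" by (auto intro!: ends_upd[OF g])
      moreover have "ends org dst (E2 - {e,f}) \<subseteq> ends org dst E2" by (auto intro!: ends_mono)
      moreover have "org e \<in> ends org dst E2" "dst f \<in> ends org dst E2"
        using e f by (auto simp: ends_def)
      ultimately show ?thesis
        using ser.hyps ser.prems(1-5) e f g
        by - (rule ttsp_serI[OF ttsp_upd[OF _ ser.hyps(1)], where ?E2.0 = "insert g (E2 - {e, f})"], (auto))
    qed
  qed
next
  case (par E1 s t E2)
  let ?org = "org(g := org e)" and ?dst = "dst(g := dst f)"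
  have *: "ttsp ?org ?dst (insert g (A \<union> B - {e, f})) s t"
    if A: "ttsp org dst A s t" "ttsp org dst B s t" "A \<inter> B = {}"
      "ends org dst A \<inter> ends org dst B \<subseteq> {s, t}" "e \<in> A" "f \<in> A \<union> B" "g \<notin> A \<union> B"
      "f \<in> A \<Longrightarrow> ttsp ?org ?dst (insert g (A - {e, f})) s t" for A B
  proof -
    have "x \<in> ends org dst A" using A par.prems(2-5) by (auto simp: ends_def)
    \<comment> \<open>\<open>x\<close> has both an entering and a leaving edge, so it is no terminal
      and cannot be shared by the two parts.\<close>
    moreover have "x \<noteq> s" "x \<noteq> t"
      using par.prems(2-5) A(5,6) ttsp_into_source[OF A(1)] ttsp_into_source[OF A(2)]
        ttsp_from_sink[OF A(1)] ttsp_from_sink[OF A(2)] by auto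
    ultimately have "x \<notin> ends org dst B" using A by auto
    then have "f \<notin> B" using par.prems(5) in_ends(1)[of f B org dst] by auto
    with A(6) have f: "f \<in> A" "f \<notin> B" by auto
    have "ends ?org ?dst (A - {e,f}) = ends org dst (A - {e,f})"
      "ends ?org ?dst B = ends org dst B" by (auto intro!: ends_upd[OF A(7)])
    moreover have "ends org dst (A - {e,f}) \<subseteq> ends org dst A" by (auto intro!: ends_mono)
    moreover have "org e \<in> ends org dst A" "dst f \<in> ends org dst A"
      using A f by (auto simp: ends_def)
    ultimately show ?thesis
      using A f
      by - (rule ttsp_parI[OF _ ttsp_upd[OF _ A(2)], where ?E1.0 = "insert g (A - {e, f})"], (auto))
  qed
  show ?case
  proof (cases "e \<in> E1")
    case True
    show ?thesis by (rule *) (use par.hyps par.prems par.IH True in blast)+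
  next
    case False
    have "ttsp ?org ?dst (insert g (E2 \<union> E1 - {e, f})) s t"
      by (rule *) (use par.hyps par.prems par.IH False in blast)+
    then show ?thesis by (simp add: Un_commute del: fun_upd_apply)
  qed
qed

text \<open>Parallel edges have two distinct nodes in common, so the parts of a series composition
  cannot separate them. If the parts of a parallel composition do, both edges lead from
  \<open>s\<close> to \<open>t\<close> and can be split off.\<close>

lemma ttsp_parallel_reduction:
  assumes "ttsp org dst E s t" "g \<notin> E" "e \<in> E" "f \<in> E" "e \<noteq> f" "org e = org f" "dst e = dst f"
  shows "ttsp (org(g := org e)) (dst(g := dst e)) (insert g (E - {e, f})) s t"
  using assms
proof (induction rule: ttsp.induct)
  case (edge e')
  then show ?case by auto
next
  case (ser E1 s x E2 t)
  let ?org = "org(g := org e)" and ?dst = "dst(g := dst e)"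
  note g = \<open>g \<notin> E1 \<union> E2\<close>
  have neq: "org e \<noteq> dst e"
    if "e \<in> E1 \<union> E2" for e using that ser.hyps(1,2)
  proof -
    have "org e \<noteq> dst e" if "ttsp org dst E s t" "e \<in> E" for E s t
      using that by (induction rule: ttsp.induct) auto
    then show ?thesis using ser.hyps(1,2) that by blast
  qed
  show ?case
  proof (cases "e \<in> E1")
    case True
    then have "f \<notin> E2" using ser.prems ser.hyps(4) neq[of e] in_ends[of e E1] in_ends[of f E2] by (metis IntI UnI1 singletonD subsetD)
    then have f: "f \<in> E1" using ser.prems(3) by auto
    have "ttsp ?org ?dst (insert g (E1 - {e, f})) s x"
      by (rule ser.IH(1)) (use ser.prems True f in blast)+
    moreover have "ends ?org ?dst (E1 - {e,f}) = ends org dst (E1 - {e,f})"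
      "ends ?org ?dst E2 = ends org dst E2" by (auto intro!: ends_upd[OF g])
    moreover have "ends org dst (E1 - {e,f}) \<subseteq> ends org dst E1" by (auto intro!: ends_mono)
    moreover have "org e \<in> ends org dst E1" "dst e \<in> ends org dst E1"
      using True f by (auto simp: ends_def)
    ultimately show ?thesis
      using ser.hyps ser.prems(1-5) True f g
      by - (rule ttsp_serI[OF _ ttsp_upd[OF _ ser.hyps(2)], where ?E1.0 = "insert g (E1 - {e, f})"], (auto))
  next
    case False
    then have e: "e \<in> E2" using ser.prems(2) by auto
    then have "f \<notin> E1" using ser.prems ser.hyps(4) neq[of e] in_ends[of f E1] in_ends[of e E2] by (metis IntI UnI2 singletonD subsetD)
    then have f: "f \<in> E2" using ser.prems(3) by auto
    have "ttsp ?org ?dst (insert g (E2 - {e, f})) x t"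
      by (rule ser.IH(2)) (use ser.prems e f in blast)+
    moreover have "ends ?org ?dst (E2 - {e,f}) = ends org dst (E2 - {e,f})"
      "ends ?org ?dst E1 = ends org dst E1" by (auto intro!: ends_upd[OF g])
    moreover have "ends org dst (E2 - {e,f}) \<subseteq> ends org dst E2" by (auto intro!: ends_mono)
    moreover have "org e \<in> ends org dst E2" "dst e \<in> ends org dst E2"
      using e f by (auto simp: ends_def)
    ultimately show ?thesis
      using ser.hyps ser.prems(1-5) e f g
      by - (rule ttsp_serI[OF ttsp_upd[OF _ ser.hyps(1)], where ?E2.0 = "insert g (E2 - {e, f})"], (auto))
  qed
next
  case (par E1 s t E2)
  let ?org = "org(g := org e)" and ?dst = "dst(g := dst e)"
  have *: "ttsp ?org ?dst (insert g (A \<union> B - {e, f})) s t"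
    if A: "ttsp org dst A s t" "ttsp org dst B s t" "A \<inter> B = {}"
      "ends org dst A \<inter> ends org dst B \<subseteq> {s, t}" "e \<in> A" "f \<in> A \<union> B" "g \<notin> A \<union> B"
      "f \<in> A \<Longrightarrow> ttsp ?org ?dst (insert g (A - {e, f})) s t" for A B
  proof (cases "f \<in> A")
    case True
    have "f \<notin> B" using True A by auto
    have "ends ?org ?dst (A - {e,f}) = ends org dst (A - {e,f})"
      "ends ?org ?dst B = ends org dst B" by (auto intro!: ends_upd[OF A(7)])
    moreover have "ends org dst (A - {e,f}) \<subseteq> ends org dst A" by (auto intro!: ends_mono)
    moreover have "org e \<in> ends org dst A" "dst e \<in> ends org dst A"
      using A by (auto simp: ends_def)
    ultimately show ?thesis
      using A True \<open>f \<notin> B\<close>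
      by - (rule ttsp_parI[OF _ ttsp_upd[OF _ A(2)], where ?E1.0 = "insert g (A - {e, f})"], (auto))
  next
    case False
    then have f: "f \<in> B" using A by auto
    \<comment> \<open>Both ends are shared by \<open>A\<close> and \<open>B\<close> and hence
      terminals. The new edge joins what is left of \<open>A\<close>, and what is left of
      \<open>B\<close> is then put in parallel to this.\<close>
    have "org e \<in> ends org dst A \<inter> ends org dst B" "dst e \<in> ends org dst A \<inter> ends org dst B"
      using A(5) f par.prems(5,6) in_ends(1)[of e A org dst] in_ends(2)[of e A dst org]
        in_ends(1)[of f B org dst] in_ends(2)[of f B dst org] by simp_all
    then have st: "org e = s" "dst e = t"
      using A(4) ttsp_from_sink[OF A(1)] ttsp_into_source[OF A(1)] A(5) by auto
    have 1: "A = {e} \<or> ttsp org dst (A - {e}) s t"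
      by (rule ttsp_split_parallel) (use A st in auto)
    have 2: "B = {f} \<or> ttsp org dst (B - {f}) s t"
      by (rule ttsp_split_parallel) (use A f st par.prems in auto)
    have gg: "ttsp ?org ?dst {g} s t"
      by (rule ttsp_edgeI) (use st ttsp_neq[OF A(1)] in auto)
    have ee: "ends ?org ?dst (A - {e}) = ends org dst (A - {e})"
      "ends ?org ?dst (B - {f}) = ends org dst (B - {f})" by (auto intro!: ends_upd[OF A(7)])
    have sub: "ends org dst (A - {e}) \<subseteq> ends org dst A" "ends org dst (B - {f}) \<subseteq> ends org dst B"
      by (auto intro!: ends_mono)
    have 3: "ttsp ?org ?dst (insert g (A - {e})) s t"
    proof (cases "A = {e}")
      case True
      then show ?thesis using gg by simp
    next
      case False
      then have "ttsp org dst (A - {e}) s t" using 1 by auto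
      from ttsp_upd[OF _ this] show ?thesis
        using gg A sub ee st by - (rule ttsp_parI[of _ _ "A - {e}" _ _ "{g}"], (auto))
    qed
    have eq: "insert g (A \<union> B - {e, f}) = insert g (A - {e}) \<union> (B - {f})"
      using False f A by auto
    show ?thesis
    proof (cases "B = {f}")
      case True
      then show ?thesis using 3 eq by simp
    next
      case False
      then have "ttsp org dst (B - {f}) s t" using 2 by auto
      from ttsp_upd[OF _ this] show ?thesis unfolding eq
        using 3 A sub ee st by - (rule ttsp.par, (auto))
    qed
  qed
  show ?case
  proof (cases "e \<in> E1")
    case True
    show ?thesis by (rule *) (use par.hyps par.prems par.IH True in blast)+
  next
    case False
    have "ttsp ?org ?dst (insert g (E2 \<union> E1 - {e, f})) s t"
      by (rule *) (use par.hyps par.prems par.IH False in blast)+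
    then show ?thesis by (simp add: Un_commute del: fun_upd_apply)
  qed
qed

subsection \<open>Progress\<close>

text \<open>Membership in \<open>D\<close> propagates from \<open>t\<close> back to
  \<open>s\<close>. Unique in-edges exclude parallel compositions, each of which would bring two
  edges into its sink, so the graph is a path and its edges have distinct tails.\<close>

lemma ttsp_path:
  assumes "ttsp org dst E s t" "\<And>e. e \<in> E \<Longrightarrow> dst e \<in> D \<Longrightarrow> org e \<in> D"
    "\<And>e e'. e \<in> E \<Longrightarrow> e' \<in> E \<Longrightarrow> dst e \<in> D \<Longrightarrow> dst e = dst e' \<Longrightarrow> e = e'" "t \<in> D"
  shows "s \<in> D \<and> inj_on org E"
  using assms
proof (induction rule: ttsp.induct)
  case (ser E1 s x E2 t)
  have 2: "x \<in> D \<and> inj_on org E2" by (rule ser.IH(2)) (use ser.prems in blast)+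
  have 1: "s \<in> D \<and> inj_on org E1" by (rule ser.IH(1)) (use ser.prems 2 in blast)+
  have "org e \<noteq> org e'" if "e \<in> E1" "e' \<in> E2" for e e'
    using that ser.hyps(4) ttsp_from_sink[OF ser.hyps(1) that(1)] in_ends(1)[of e E1 org dst] in_ends(2)[of e E1 dst org] in_ends(1)[of e' E2 org dst] in_ends(2)[of e' E2 dst org]
    by auto
  then have "org ` (E1 - E2) \<inter> org ` (E2 - E1) = {}" by blast
  then show ?case using 1 2 inj_on_Un by blast
next
  case (par E1 s t E2)
  obtain e1 e2 where "e1 \<in> E1" "dst e1 = t" "e2 \<in> E2" "dst e2 = t"
    using ttsp_terminals[OF par.hyps(1)] ttsp_terminals[OF par.hyps(2)] by blast
  then have "e1 = e2" using par.prems(2)[of e1 e2] par.prems(3) by auto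
  then show ?case using par.hyps(3) \<open>e1 \<in> E1\<close> \<open>e2 \<in> E2\<close> by blast
next
  case (edge e)
  then show ?case by simp
qed

text \<open>\<open>D\<close> is the set of nodes that have been reduced to in-degree one, \<open>v\<close> the next node in
  topological order: if neither reduction applies to an edge into \<open>v\<close>, there is only one.\<close>

lemma ttsp_progress:
  assumes "ttsp org dst E s t" "\<And>e. e \<in> E \<Longrightarrow> dst e \<in> insert v D \<Longrightarrow> org e \<in> D"
    "\<And>e e'. e \<in> E \<Longrightarrow> e' \<in> E \<Longrightarrow> dst e \<in> D \<Longrightarrow> dst e = dst e' \<Longrightarrow> e = e'"
    "\<And>e e'. e \<in> E \<Longrightarrow> e' \<in> E \<Longrightarrow> dst e = v \<Longrightarrow> dst e' = v \<Longrightarrow> org e = org e' \<Longrightarrow> e = e'"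
    "\<And>e. e \<in> E \<Longrightarrow> dst e = v \<Longrightarrow> org e = s \<or> (\<exists>e'\<in>E. e' \<noteq> e \<and> org e' = org e)"
    "e \<in> E" "e' \<in> E" "dst e = v" "dst e' = v"
  shows "e = e'"
  using assms
proof (induction arbitrary: e e' rule: ttsp.induct)
  case (ser E1 s x E2 t)
  have x: "s \<noteq> x" "x \<noteq> t" "s \<notin> ends org dst E2" "t \<notin> ends org dst E1"
    using ser.hyps ttsp_neq[OF ser.hyps(1)] ttsp_neq[OF ser.hyps(2)]
      ttsp_source[OF ser.hyps(1)] ttsp_sink[OF ser.hyps(2)] by auto
  have mixed: False if "a \<in> E1" "b \<in> E2" "dst a = v" "dst b = v" for a b
    using that ser.hyps(4) ttsp_into_source[OF ser.hyps(2)] in_ends(1)[of a E1 org dst] in_ends(2)[of a E1 dst org] in_ends(1)[of b E2 org dst] in_ends(2)[of b E2 dst org]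
    by auto
  have org_mixed: False if "a \<in> E1" "b \<in> E2" "org b = org a" for a b
    using that ser.hyps(4) ttsp_from_sink[OF ser.hyps(1)] in_ends(1)[of a E1 org dst] in_ends(2)[of a E1 dst org] in_ends(1)[of b E2 org dst] in_ends(2)[of b E2 dst org]
    by auto
  show ?case
  proof (cases "e \<in> E1")
    case True
    then have "e' \<in> E1" using mixed ser.prems by blast
    show ?thesis
    proof (rule ser.IH(1))
      fix a assume "a \<in> E1" "dst a = v"
      then show "org a = s \<or> (\<exists>e'\<in>E1. e' \<noteq> a \<and> org e' = org a)"
        using ser.prems(4)[of a] org_mixed[of a] by blast
    qed (use ser.prems True \<open>e' \<in> E1\<close> in blast)+
  next
    case False
    then have e: "e \<in> E2" "e' \<in> E2" using mixed ser.prems by blast+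
    show ?thesis
    proof (rule ser.IH(2))
      fix a assume a: "a \<in> E2" "dst a = v"
      then show "org a = x \<or> (\<exists>e'\<in>E2. e' \<noteq> a \<and> org e' = org a)"
        using ser.prems(4)[of a] org_mixed[of _ a] x in_ends(1)[of a E2 org dst] in_ends(2)[of a E2 dst org] by (metis UnCI UnE)
    qed (use ser.prems e in blast)+
  qed
next
  case (par E1 s t E2)
  have org_mixed: "org a = s" if "a \<in> E1" "b \<in> E2" "org b = org a" for a b
    using that par.hyps(4) ttsp_from_sink[OF par.hyps(1)] in_ends(1)[of a E1 org dst] in_ends(2)[of a E1 dst org] in_ends(1)[of b E2 org dst] in_ends(2)[of b E2 dst org]
    by auto
  have reduced1: "a = b" if "a \<in> E1" "b \<in> E1" "dst a = v" "dst b = v" for a b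
  proof (rule par.IH(1))
    fix a assume "a \<in> E1" "dst a = v"
    then show "org a = s \<or> (\<exists>e'\<in>E1. e' \<noteq> a \<and> org e' = org a)"
      using par.prems(4)[of a] org_mixed[of a] by blast
  qed (use par.prems that in blast)+
  have reduced2: "a = b" if "a \<in> E2" "b \<in> E2" "dst a = v" "dst b = v" for a b
  proof (rule par.IH(2))
    fix a assume "a \<in> E2" "dst a = v"
    then show "org a = s \<or> (\<exists>e'\<in>E2. e' \<noteq> a \<and> org e' = org a)"
      using par.prems(4)[of a] org_mixed[of _ a] by (metis Un_iff)
  qed (use par.prems that in blast)+
  \<comment> \<open>Edges of both parts into \<open>v\<close> force \<open>v = t\<close>, and then
    both parts are paths. So \<open>a\<close> has no sibling in its own part, and one in the other
    part can share its tail only at \<open>s\<close>: in any case \<open>a\<close> starts at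
    \<open>s\<close>, and so does \<open>b\<close>. The two could have been merged in
    parallel.\<close>
  have mixed: False if ab: "a \<in> E1" "b \<in> E2" "dst a = v" "dst b = v" for a b
  proof -
    have v: "v = t"
    proof -
      have "v \<in> ends org dst E1" "v \<in> ends org dst E2"
        using ab in_ends(2)[of a E1 dst org] in_ends(2)[of b E2 dst org] by simp_all
      then have "v = s \<or> v = t" using par.hyps(4) by blast
      moreover have "v \<noteq> s" using ttsp_into_source[OF par.hyps(1)] ab by blast
      ultimately show ?thesis by blast
    qed
    have i1: "inj_on org E1"
    proof -
      have "s \<in> insert v D \<and> inj_on org E1"
      proof (rule ttsp_path[OF par.hyps(1)])
        fix e assume "e \<in> E1" "dst e \<in> insert v D"
        then show "org e \<in> insert v D" using par.prems(1)[of e] by simp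
      next
        fix e e' assume "e \<in> E1" "e' \<in> E1" "dst e \<in> insert v D" "dst e = dst e'"
        then show "e = e'" using reduced1[of e e'] par.prems(2)[of e e'] by auto
      qed (use v in simp)
      then show ?thesis ..
    qed
    have i2: "inj_on org E2"
    proof -
      have "s \<in> insert v D \<and> inj_on org E2"
      proof (rule ttsp_path[OF par.hyps(2)])
        fix e assume "e \<in> E2" "dst e \<in> insert v D"
        then show "org e \<in> insert v D" using par.prems(1)[of e] by simp
      next
        fix e e' assume "e \<in> E2" "e' \<in> E2" "dst e \<in> insert v D" "dst e = dst e'"
        then show "e = e'" using reduced2[of e e'] par.prems(2)[of e e'] by auto
      qed (use v in simp)
      then show ?thesis ..
    qed
    have "org a = s" using par.prems(4)[of a] ab i1 org_mixed[of a] by (auto dest: inj_onD)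
    moreover have "org b = s" using par.prems(4)[of b] ab i2 org_mixed[of _ b] by (auto dest: inj_onD)
    ultimately have "a = b" using par.prems(3)[of a b] ab by auto
    then show False using ab par.hyps by auto
  qed
  consider "e \<in> E1" "e' \<in> E1" | "e \<in> E2" "e' \<in> E2" | "e \<in> E1" "e' \<in> E2" | "e \<in> E2" "e' \<in> E1"
    using par.prems(5,6) by blast
  then show ?case
  proof cases
    case 1
    then show ?thesis using \<open>dst e = v\<close> \<open>dst e' = v\<close> by (rule reduced1)
  next
    case 2
    then show ?thesis using \<open>dst e = v\<close> \<open>dst e' = v\<close> by (rule reduced2)
  next
    case 3
    then have False using \<open>dst e = v\<close> \<open>dst e' = v\<close> by (rule mixed)
    then show ?thesis ..
  next
    case 4
    then have False using mixed[of e' e] \<open>dst e' = v\<close> \<open>dst e = v\<close> by blast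
    then show ?thesis ..
  qed
next
  case (edge a)
  then have "e = a" "e' = a" by blast+
  then show ?case by simp
qed

text \<open>The graph is a path by \<open>ttsp_path\<close>, so no edge has a sibling and all start
  at the source; distinct tails then leave only one edge.\<close>

lemma ttsp_all_reduced:
  assumes "ttsp org dst E s t" "\<And>e. e \<in> E \<Longrightarrow> dst e \<in> D" "\<And>e. e \<in> E \<Longrightarrow> org e \<in> D"
    "\<And>e e'. e \<in> E \<Longrightarrow> e' \<in> E \<Longrightarrow> dst e = dst e' \<Longrightarrow> e = e'"
    "\<And>e. e \<in> E \<Longrightarrow> org e = s \<or> (\<exists>e'\<in>E. e' \<noteq> e \<and> org e' = org e)"
  shows "card E = 1"
proof -
  have "t \<in> D" using ttsp_terminals[OF assms(1)] assms(2) by blast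
  then have inj: "inj_on org E" using ttsp_path[OF assms(1), of D] assms by blast
  then have "org e = s" if "e \<in> E" for e using assms(5)[OF that] that by (auto dest: inj_onD)
  then have "e = e'" if "e \<in> E" "e' \<in> E" for e e' using inj that by (metis inj_onD)
  then obtain e where "E = {e}" using ttsp_terminals[OF assms(1)] by blast
  then show ?thesis by simp
qed

text \<open>In a series composition the first part is searched before the second. In a parallel one
  a node found in one part serves for both unless it is \<open>t\<close>, the only head the parts
  can share; if neither part offers another node, \<open>t\<close> itself qualifies.\<close>

lemma ttsp_next_node:
  assumes "ttsp org dst E s t" "s \<in> D" "\<exists>e\<in>E. dst e \<notin> D"
  shows "\<exists>e\<in>E. dst e \<notin> D \<and> (\<forall>e'\<in>E. dst e' = dst e \<longrightarrow> org e' \<in> D)"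
  using assms
proof (induction rule: ttsp.induct)
  case (ser E1 s x E2 t)
  show ?case
  proof (cases "\<exists>e\<in>E1. dst e \<notin> D")
    case True
    then obtain e where e: "e \<in> E1" "dst e \<notin> D" "\<forall>e'\<in>E1. dst e' = dst e \<longrightarrow> org e' \<in> D"
      using ser by blast
    have "dst e' \<noteq> dst e" if "e' \<in> E2" for e'
      using that e(1) ser.hyps(4) ttsp_into_source[OF ser.hyps(2)] in_ends(1)[of e E1 org dst] in_ends(2)[of e E1 dst org] in_ends(1)[of e' E2 org dst] in_ends(2)[of e' E2 dst org]
      by auto
    then show ?thesis using e by blast
  next
    case False
    then have x: "x \<in> D" using ttsp_terminals[OF ser.hyps(1)] by blast
    then obtain e where e: "e \<in> E2" "dst e \<notin> D" "\<forall>e'\<in>E2. dst e' = dst e \<longrightarrow> org e' \<in> D"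
      using False ser by blast
    then show ?thesis using False by (metis UnE UnI2)
  qed
next
  case (par E1 s t E2)
  have 1: "\<exists>e\<in>A \<union> B. dst e \<notin> D \<and> (\<forall>e'\<in>A \<union> B. dst e' = dst e \<longrightarrow> org e' \<in> D)"
    if A: "e \<in> A" "dst e \<notin> D" "dst e \<noteq> t" "\<forall>e'\<in>A. dst e' = dst e \<longrightarrow> org e' \<in> D"
      "ends org dst A \<inter> ends org dst B \<subseteq> {s, t}" "ttsp org dst A s t" for e A B
  proof -
    have "dst e' \<noteq> dst e" if "e' \<in> B" for e'
    proof
      assume "dst e' = dst e"
      then have "dst e \<in> ends org dst A \<inter> ends org dst B"
        using that A(1) in_ends(2)[of e A dst org] in_ends(2)[of e' B dst org] by simp
      then have "dst e = s" using A(3,5) by blast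
      then show False using ttsp_into_source[OF A(6) A(1)] by simp
    qed
    then show ?thesis using A by blast
  qed
  show ?case
  proof (cases "\<exists>e\<in>E1. dst e \<notin> D \<and> dst e \<noteq> t \<and> (\<forall>e'\<in>E1. dst e' = dst e \<longrightarrow> org e' \<in> D)")
    case True
    then show ?thesis using 1[of _ E1 E2] par.hyps by blast
  next
    case f1: False
    show ?thesis
    proof (cases "\<exists>e\<in>E2. dst e \<notin> D \<and> dst e \<noteq> t \<and> (\<forall>e'\<in>E2. dst e' = dst e \<longrightarrow> org e' \<in> D)")
      case True
      then show ?thesis using 1[of _ E2 E1] par.hyps by (simp add: Un_commute Int_commute) blast
    next
      case f2: False
      have 1: "(\<exists>e\<in>E1. dst e \<notin> D) \<Longrightarrow> t \<notin> D \<and> (\<forall>e'\<in>E1. dst e' = t \<longrightarrow> org e' \<in> D)"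
        using par.IH(1)[OF par.prems(1)] f1 by metis
      have 2: "(\<exists>e\<in>E2. dst e \<notin> D) \<Longrightarrow> t \<notin> D \<and> (\<forall>e'\<in>E2. dst e' = t \<longrightarrow> org e' \<in> D)"
        using par.IH(2)[OF par.prems(1)] f2 by metis
      have t: "t \<notin> D" using par.prems(2) 1 2 by blast
      obtain e1 e2 where e: "e1 \<in> E1" "dst e1 = t" "e2 \<in> E2" "dst e2 = t"
        using ttsp_terminals[OF par.hyps(1)] ttsp_terminals[OF par.hyps(2)] by auto
      then have "\<forall>e'\<in>E1. dst e' = t \<longrightarrow> org e' \<in> D" "\<forall>e'\<in>E2. dst e' = t \<longrightarrow> org e' \<in> D"
        using 1 2 t by blast+
      then show ?thesis using t e by (intro bexI[of _ e1]) auto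
    qed
  qed
qed auto

section \<open>Series-parallel trees\<close>

text \<open>The Boolean at a node is true for a series and false for a parallel composition.\<close>

datatype sptree = Leaf nat | Node bool sptree sptree

primrec leaves :: "sptree \<Rightarrow> nat set" where
  "leaves (Leaf v) = {v}"
| "leaves (Node k l r) = leaves l \<union> leaves r"

text \<open>With \<open>lasts\<close>, these are the sources and sinks of the digraph that the tree
  describes.\<close>

primrec firsts :: "sptree \<Rightarrow> nat set" where
  "firsts (Leaf v) = {v}"
| "firsts (Node k l r) = (if k then firsts l else firsts l \<union> firsts r)"

primrec lasts :: "sptree \<Rightarrow> nat set" where
  "lasts (Leaf v) = {v}"
| "lasts (Node k l r) = (if k then lasts r else lasts l \<union> lasts r)"

primrec valid :: "sptree \<Rightarrow> nat set \<Rightarrow> bool" where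
  "valid (Leaf v) A \<longleftrightarrow> True"
| "valid (Node k l r) A \<longleftrightarrow> valid l A \<and> valid r A \<and> (k \<longrightarrow> lasts l \<subseteq> A \<longrightarrow> firsts r \<subseteq> A)"

primrec disjoint_leaves :: "sptree \<Rightarrow> bool" where
  "disjoint_leaves (Leaf v) \<longleftrightarrow> True"
| "disjoint_leaves (Node k l r) \<longleftrightarrow>
     disjoint_leaves l \<and> disjoint_leaves r \<and> leaves l \<inter> leaves r = {}"

lemma firsts_leaves: "firsts t \<subseteq> leaves t" and lasts_leaves: "lasts t \<subseteq> leaves t"
  and finite_leaves: "finite (leaves t)" and lasts_nonempty: "lasts t \<noteq> {}"
  by (induction t) auto

lemma valid_cong: "A \<inter> leaves t = B \<inter> leaves t \<Longrightarrow> valid t A \<longleftrightarrow> valid t B"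
proof (induction t)
  case (Node k l r)
  have "A \<inter> leaves l = B \<inter> leaves l" "A \<inter> leaves r = B \<inter> leaves r" using Node.prems by auto
  moreover have "lasts l \<subseteq> A \<longleftrightarrow> lasts l \<subseteq> B" "firsts r \<subseteq> A \<longleftrightarrow> firsts r \<subseteq> B"
    using calculation firsts_leaves[of r] lasts_leaves[of l] by blast+
  ultimately show ?case using Node.IH by simp
qed simp

lemma valid_empty: "valid t {}"
  by (induction t) (auto simp: lasts_nonempty)

text \<open>The code doubles as a field number: entries with flag \<open>f\<close> are kept in field
  \<open>f\<close>, so the four flags occupy the fields 0 to 3.\<close>

definition flag :: "bool \<Rightarrow> bool \<Rightarrow> nat" where
  "flag a b = 2 * of_bool a + of_bool b"

lemma flag_less: "flag a b < 4"
  by (simp add: flag_def)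

lemma flag_inject: "flag a b = flag a' b' \<longleftrightarrow> a = a' \<and> b = b'"
  by (auto simp: flag_def)

definition tree_flag :: "sptree \<Rightarrow> nat set \<Rightarrow> nat" where
  "tree_flag t A = flag (firsts t \<subseteq> A) (lasts t \<subseteq> A)"

lemma tree_flag_cong: "A \<inter> leaves t = B \<inter> leaves t \<Longrightarrow> tree_flag t A = tree_flag t B"
proof -
  assume "A \<inter> leaves t = B \<inter> leaves t"
  then have "firsts t \<subseteq> A \<longleftrightarrow> firsts t \<subseteq> B" "lasts t \<subseteq> A \<longleftrightarrow> lasts t \<subseteq> B"
    using firsts_leaves[of t] lasts_leaves[of t] by blast+
  then show ?thesis by (simp add: tree_flag_def)
qed

text \<open>A list and not a set, because the program of a merge step is unrolled along it. Of the
  16 combinations a series composition loses the four in which all sinks of the left part but not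
  all sources of the right part are chosen.\<close>

definition flag_combos :: "bool \<Rightarrow> (nat \<times> nat \<times> nat) list" where
  "flag_combos k = concat (map (\<lambda>(a1, b1, a2, b2).
     if k \<and> b1 \<and> \<not> a2 then []
     else [(flag a1 b1, flag a2 b2, if k then flag a1 b2 else flag (a1 \<and> a2) (b1 \<and> b2))])
     (List.product [False, True] (List.product [False, True] (List.product [False, True] [False, True]))))"

lemma set_flag_combos:
  "set (flag_combos k) = {(flag a1 b1, flag a2 b2, if k then flag a1 b2 else flag (a1 \<and> a2) (b1 \<and> b2))
     | a1 b1 a2 b2. \<not> (k \<and> b1 \<and> \<not> a2)}"
proof (rule set_eqI, rule iffI)
  fix p assume "p \<in> set (flag_combos k)"
  then show "p \<in> {(flag a1 b1, flag a2 b2, if k then flag a1 b2 else flag (a1 \<and> a2) (b1 \<and> b2))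
     | a1 b1 a2 b2. \<not> (k \<and> b1 \<and> \<not> a2)}"
  proof -
    from \<open>p \<in> set (flag_combos k)\<close> obtain q where q: "p \<in> set ((\<lambda>(a1, b1, a2, b2).
        if k \<and> b1 \<and> \<not> a2 then []
        else [(flag a1 b1, flag a2 b2, if k then flag a1 b2 else flag (a1 \<and> a2) (b1 \<and> b2))]) q)"
      unfolding flag_combos_def set_concat set_map by blast
    obtain a1 b1 a2 b2 where "q = (a1, b1, a2, b2)" using prod_cases4 by blast
    then have "\<not> (k \<and> b1 \<and> \<not> a2)"
      "p = (flag a1 b1, flag a2 b2, if k then flag a1 b2 else flag (a1 \<and> a2) (b1 \<and> b2))"
      using q by (cases "k \<and> b1 \<and> \<not> a2"; simp)+
    then show ?thesis by blast
  qed
next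
  fix p assume "p \<in> {(flag a1 b1, flag a2 b2, if k then flag a1 b2 else flag (a1 \<and> a2) (b1 \<and> b2))
     | a1 b1 a2 b2. \<not> (k \<and> b1 \<and> \<not> a2)}"
  then obtain a1 b1 a2 b2 where p: "p = (flag a1 b1, flag a2 b2,
      if k then flag a1 b2 else flag (a1 \<and> a2) (b1 \<and> b2))" "\<not> (k \<and> b1 \<and> \<not> a2)" by blast
  show "p \<in> set (flag_combos k)"
  proof -
    have 1: "(a1, b1, a2, b2) \<in> set (List.product [False, True] (List.product [False, True]
        (List.product [False, True] [False, True])))"
      by (cases a1; cases b1; cases a2; cases b2; simp)
    have 2: "p \<in> set ((\<lambda>(a1, b1, a2, b2).
        if k \<and> b1 \<and> \<not> a2 then []
        else [(flag a1 b1, flag a2 b2, if k then flag a1 b2 else flag (a1 \<and> a2) (b1 \<and> b2))]) (a1, b1, a2, b2))"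
      using p by simp
    show ?thesis unfolding flag_combos_def set_concat set_map using 1 2 by blast
  qed
qed

lemma tree_flag_Node:
  "(f, g, h) \<in> set (flag_combos k) \<Longrightarrow> tree_flag l A = f \<Longrightarrow> tree_flag r A = g \<Longrightarrow>
     valid l A \<Longrightarrow> valid r A \<Longrightarrow> valid (Node k l r) A \<and> tree_flag (Node k l r) A = h"
  unfolding set_flag_combos by (auto simp: tree_flag_def flag_inject split: if_splits)

text \<open>The converse of \<open>tree_flag_Node\<close>: no valid subset is missed by the
  list.\<close>

lemma tree_flag_combos:
  "valid (Node k l r) A \<Longrightarrow>
     (tree_flag l A, tree_flag r A, tree_flag (Node k l r) A) \<in> set (flag_combos k)"
proof -
  assume v: "valid (Node k l r) A"
  have "(if k then flag (firsts l \<subseteq> A) (lasts r \<subseteq> A)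
      else flag (firsts l \<subseteq> A \<and> firsts r \<subseteq> A) (lasts l \<subseteq> A \<and> lasts r \<subseteq> A)) = tree_flag (Node k l r) A"
    by (auto simp: tree_flag_def)
  then show ?thesis using v
    unfolding set_flag_combos mem_Collect_eq
    by (intro exI[of _ "firsts l \<subseteq> A"] exI[of _ "lasts l \<subseteq> A"] exI[of _ "firsts r \<subseteq> A"]
        exI[of _ "lasts r \<subseteq> A"]) (auto simp: tree_flag_def)
qed

lemma flag_combos_less: "(f, g, h) \<in> set (flag_combos k) \<Longrightarrow> f < 4 \<and> g < 4 \<and> h < 4"
  unfolding set_flag_combos by (auto simp: flag_less)

text \<open>\<open>A\<close> may contain items outside the tree, and only its items among the leaves
  are counted, so that one subset can be compared with all trees.\<close>

definition reach :: "(nat \<Rightarrow> nat) \<Rightarrow> sptree \<Rightarrow> (nat \<times> nat) set" where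
  "reach s t = {(sum s (A \<inter> leaves t), tree_flag t A) | A. valid t A}"

lemma reach_Leaf: "reach s (Leaf v) = {(0, 0), (s v, 3)}"
proof -
  have "(s v, 3) \<in> reach s (Leaf v)"
    unfolding reach_def by (rule CollectI, intro exI[of _ "{v}"]) (simp add: tree_flag_def flag_def)
  moreover have "(0, 0) \<in> reach s (Leaf v)"
    unfolding reach_def by (rule CollectI, intro exI[of _ "{}"]) (simp add: tree_flag_def flag_def)
  moreover have "p = (0, 0) \<or> p = (s v, 3)" if p: "p \<in> reach s (Leaf v)" for p
  proof -
    obtain A where "p = (sum s (A \<inter> {v}), tree_flag (Leaf v) A)" using p by (auto simp: reach_def)
    then show ?thesis by (cases "v \<in> A") (simp_all add: tree_flag_def flag_def)
  qed
  ultimately show ?thesis by blast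
qed

lemma reach_Node:
  assumes "disjoint_leaves (Node k l r)"
  shows "reach s (Node k l r) = {(x + y, h) | x y f g h.
    (x, f) \<in> reach s l \<and> (y, g) \<in> reach s r \<and> (f, g, h) \<in> set (flag_combos k)}" (is "?L = ?R")
proof (rule set_eqI, rule iffI)
  have sum: "sum s (A \<inter> leaves (Node k l r)) = sum s (A \<inter> leaves l) + sum s (A \<inter> leaves r)" for A
    unfolding leaves.simps Int_Un_distrib
    by (rule sum.union_disjoint) (use assms in \<open>auto simp: finite_leaves\<close>)
  {
    fix p assume "p \<in> ?L"
    then obtain A where A: "p = (sum s (A \<inter> leaves (Node k l r)), tree_flag (Node k l r) A)"
      "valid (Node k l r) A" by (auto simp: reach_def)
    have "(sum s (A \<inter> leaves l), tree_flag l A) \<in> reach s l"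
      "(sum s (A \<inter> leaves r), tree_flag r A) \<in> reach s r" using A(2) by (auto simp: reach_def)
    then show "p \<in> ?R" using A(1) tree_flag_combos[OF A(2)] sum by blast
  }
  fix p assume "p \<in> ?R"
  then obtain x y f g h where p: "p = (x + y, h)" "(x, f) \<in> reach s l" "(y, g) \<in> reach s r"
    "(f, g, h) \<in> set (flag_combos k)" by blast
  obtain A1 where A1: "x = sum s (A1 \<inter> leaves l)" "f = tree_flag l A1" "valid l A1"
    using p(2) by (auto simp: reach_def)
  obtain A2 where A2: "y = sum s (A2 \<inter> leaves r)" "g = tree_flag r A2" "valid r A2"
    using p(3) by (auto simp: reach_def)
  \<comment> \<open>Choices for the children can be glued: their leaves are disjoint, and
    \<open>valid\<close> and \<open>tree_flag\<close> see a subset only through the leaves.\<close>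
  define A where "A = (A1 \<inter> leaves l) \<union> (A2 \<inter> leaves r)"
  have eq: "A \<inter> leaves l = A1 \<inter> leaves l" "A \<inter> leaves r = A2 \<inter> leaves r"
    using assms by (auto simp: A_def)
  have "tree_flag l A = f" "tree_flag r A = g" "valid l A" "valid r A"
    using A1 A2 tree_flag_cong eq valid_cong by metis+
  with tree_flag_Node[OF p(4)] have "valid (Node k l r) A" "tree_flag (Node k l r) A = h" by blast+
  moreover have "sum s (A \<inter> leaves (Node k l r)) = x + y" using sum eq A1 A2 by simp
  ultimately show "p \<in> ?L" unfolding reach_def p(1) by (intro CollectI exI[of _ A]) simp
qed

section \<open>The constraint on the multigraph of trees\<close>

text \<open>Every edge of the multigraph stands for a series-parallel part of the digraph. The arcs
  between different parts are the pairs meeting in a node.\<close>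

definition constraint ::
    "(nat \<Rightarrow> sptree) \<Rightarrow> (nat \<Rightarrow> nat) \<Rightarrow> (nat \<Rightarrow> nat) \<Rightarrow> nat set \<Rightarrow> nat \<Rightarrow> nat set \<Rightarrow> bool" where
  "constraint X org dst M s A \<longleftrightarrow> (\<forall>e\<in>M. valid (X e) A) \<and>
     (\<forall>x. x \<noteq> s \<longrightarrow> (\<forall>e\<in>M. dst e = x \<longrightarrow> lasts (X e) \<subseteq> A) \<longrightarrow> (\<forall>e\<in>M. org e = x \<longrightarrow> firsts (X e) \<subseteq> A))"

text \<open>Both edges contribute to the conditions at the same two nodes, and \<open>firsts\<close>
  and \<open>lasts\<close> of a parallel tree are unions, so one edge with this tree says the
  same.\<close>

lemma constraint_parallel:
  assumes "e \<in> M" "f \<in> M" "e \<noteq> f" "org e = org f" "dst e = dst f" "g \<notin> M"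
  shows "constraint (X(g := Node False (X e) (X f))) (org(g := org e)) (dst(g := dst e))
    (insert g (M - {e, f})) s A \<longleftrightarrow> constraint X org dst M s A"
proof -
  let ?X = "X(g := Node False (X e) (X f))" and ?org = "org(g := org e)" and ?dst = "dst(g := dst e)"
  let ?M = "insert g (M - {e, f})"
  have ne: "e \<noteq> g" "f \<noteq> g" using assms by auto
  have 1: "(\<forall>a\<in>?M. valid (?X a) A) \<longleftrightarrow> (\<forall>a\<in>M. valid (X a) A)" using assms ne by auto
  have 2: "(\<forall>a\<in>?M. ?dst a = x \<longrightarrow> lasts (?X a) \<subseteq> A) \<longleftrightarrow> (\<forall>a\<in>M. dst a = x \<longrightarrow> lasts (X a) \<subseteq> A)" for x
    using assms ne by auto
  have 3: "(\<forall>a\<in>?M. ?org a = x \<longrightarrow> firsts (?X a) \<subseteq> A) \<longleftrightarrow> (\<forall>a\<in>M. org a = x \<longrightarrow> firsts (X a) \<subseteq> A)" for x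
    using assms ne by auto
  show ?thesis unfolding constraint_def 1 2 3 ..
qed

text \<open>The condition at \<open>x\<close>, which only \<open>e\<close> enters and only
  \<open>f\<close> leaves, is the one that \<open>valid\<close> demands of the new series tree. At
  the other nodes the new edge acts with the \<open>firsts\<close> of \<open>e\<close> and the
  \<open>lasts\<close> of \<open>f\<close>.\<close>

lemma constraint_series:
  assumes "e \<in> M" "f \<in> M" "dst e = x" "org f = x" "org e \<noteq> x" "dst f \<noteq> x" "x \<noteq> s" "g \<notin> M"
    "\<forall>a\<in>M. dst a = x \<longrightarrow> a = e" "\<forall>a\<in>M. org a = x \<longrightarrow> a = f"
  shows "constraint (X(g := Node True (X e) (X f))) (org(g := org e)) (dst(g := dst f))
    (insert g (M - {e, f})) s A \<longleftrightarrow> constraint X org dst M s A"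
proof -
  let ?X = "X(g := Node True (X e) (X f))" and ?org = "org(g := org e)" and ?dst = "dst(g := dst f)"
  let ?M = "insert g (M - {e, f})"
  have ne: "e \<noteq> g" "f \<noteq> g" "e \<noteq> f" using assms(1-8) by auto
  have val: "(\<forall>a\<in>?M. valid (?X a) A) \<longleftrightarrow>
      (\<forall>a\<in>M. valid (X a) A) \<and> (lasts (X e) \<subseteq> A \<longrightarrow> firsts (X f) \<subseteq> A)"
    using assms(1,2,8) ne by auto
  have into: "(\<forall>a\<in>?M. ?dst a = y \<longrightarrow> lasts (?X a) \<subseteq> A) \<longleftrightarrow> (\<forall>a\<in>M. dst a = y \<longrightarrow> lasts (X a) \<subseteq> A)"
    if "y \<noteq> x" for y
    using assms(1-8) ne that by auto
  have out: "(\<forall>a\<in>?M. ?org a = y \<longrightarrow> firsts (?X a) \<subseteq> A) \<longleftrightarrow> (\<forall>a\<in>M. org a = y \<longrightarrow> firsts (X a) \<subseteq> A)"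
    if "y \<noteq> x" for y
    using assms(1-8) ne that by auto
  have none: "a \<in> ?M \<Longrightarrow> ?org a \<noteq> x" for a
    using assms(5,8,10) ne by (cases "a = g") auto
  have in_x: "(\<forall>a\<in>M. dst a = x \<longrightarrow> lasts (X a) \<subseteq> A) \<longleftrightarrow> lasts (X e) \<subseteq> A"
    using assms(1,3,9) by blast
  have out_x: "(\<forall>a\<in>M. org a = x \<longrightarrow> firsts (X a) \<subseteq> A) \<longleftrightarrow> firsts (X f) \<subseteq> A"
    using assms(2,4,10) by blast
  let ?C = "\<lambda>X org dst M y. (\<forall>a\<in>M. dst a = y \<longrightarrow> lasts (X a) \<subseteq> A) \<longrightarrow> (\<forall>a\<in>M. org a = y \<longrightarrow> firsts (X a) \<subseteq> A)"
  have split: "(\<forall>y. y \<noteq> s \<longrightarrow> P y) \<longleftrightarrow> P x \<and> (\<forall>y. y \<noteq> s \<longrightarrow> y \<noteq> x \<longrightarrow> P y)" for P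
    using assms(7) by auto
  \<comment> \<open>No edge leaves \<open>x\<close> after the reduction, so its condition has become
    void.\<close>
  have Cx: "?C ?X ?org ?dst ?M x" using none by blast
  have Cx': "?C X org dst M x \<longleftrightarrow> (lasts (X e) \<subseteq> A \<longrightarrow> firsts (X f) \<subseteq> A)"
    unfolding in_x out_x ..
  have "constraint ?X ?org ?dst ?M s A \<longleftrightarrow> (\<forall>a\<in>?M. valid (?X a) A) \<and> (\<forall>y. y \<noteq> s \<longrightarrow> y \<noteq> x \<longrightarrow> ?C ?X ?org ?dst ?M y)"
    unfolding constraint_def split[of "?C ?X ?org ?dst ?M"] using Cx by (simp del: fun_upd_apply)
  also have "\<dots> \<longleftrightarrow> (\<forall>a\<in>M. valid (X a) A) \<and> (lasts (X e) \<subseteq> A \<longrightarrow> firsts (X f) \<subseteq> A) \<and>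
      (\<forall>y. y \<noteq> s \<longrightarrow> y \<noteq> x \<longrightarrow> ?C X org dst M y)"
    unfolding val using into out by (simp del: fun_upd_apply)
  also have "\<dots> \<longleftrightarrow> constraint X org dst M s A"
    unfolding constraint_def split[of "?C X org dst M"] Cx' by blast
  finally show ?thesis .
qed

section \<open>Minimal series-parallel digraphs as line digraphs\<close>

lemma msp_basic:
  "minimal_series_parallel G \<Longrightarrow> finite (pverts G) \<and> parcs G \<subseteq> pverts G \<times> pverts G \<and>
     sources G \<noteq> {} \<and> sinks G \<noteq> {}"
proof (induction rule: minimal_series_parallel.induct)
  case (single v)
  then show ?case by (auto simp: single_vertex_def sources_def sinks_def)
next
  case (parallel G1 G2)
  obtain v w where "v \<in> sources G1" "w \<in> sinks G1" using parallel by blast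
  then have "v \<in> sources (parallel_comp G1 G2)" "w \<in> sinks (parallel_comp G1 G2)"
    using parallel by (auto simp: sources_def sinks_def parallel_comp_def)
  then show ?case using parallel by (auto simp: parallel_comp_def)
next
  case (series G1 G2)
  obtain v w where "v \<in> sources G1" "w \<in> sinks G2" using series by blast
  then have "v \<in> sources (series_comp G1 G2)" "w \<in> sinks (series_comp G1 G2)"
    using series by (auto simp: sources_def sinks_def series_comp_def)
  then show ?case using series by (auto simp: series_comp_def sources_def sinks_def)
qed

text \<open>A series composition joins all sinks of one part to all sources of the other. Within
  their parts the former have no successors and the latter no predecessors, so these arcs form a
  complete bipartite block that meets no other block in a tail or in a head.\<close>

lemma msp_biclique:
  "minimal_series_parallel G \<Longrightarrow> (u, v) \<in> parcs G \<Longrightarrow> (u', v) \<in> parcs G \<Longrightarrow> (u, w) \<in> parcs G \<Longrightarrow>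
     (u', w) \<in> parcs G"
proof (induction arbitrary: u v u' w rule: minimal_series_parallel.induct)
  case (single v)
  then show ?case by (auto simp: single_vertex_def)
next
  case (parallel G1 G2)
  note b = msp_basic[OF parallel.hyps(1)] msp_basic[OF parallel.hyps(2)]
  show ?case
  proof (cases "v \<in> pverts G1")
    case True
    then have "(u, v) \<in> parcs G1" "(u', v) \<in> parcs G1"
      using parallel.prems(1,2) b parallel.hyps(3) by (auto simp: parallel_comp_def)
    moreover have "(u, w) \<in> parcs G1"
      using calculation(1) parallel.prems(3) b parallel.hyps(3) by (auto simp: parallel_comp_def)
    ultimately have "(u', w) \<in> parcs G1" by (rule parallel.IH(1))
    then show ?thesis by (simp add: parallel_comp_def)
  next
    case False
    then have "(u, v) \<in> parcs G2" "(u', v) \<in> parcs G2"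
      using parallel.prems(1,2) b parallel.hyps(3) by (auto simp: parallel_comp_def)
    moreover have "(u, w) \<in> parcs G2"
      using calculation(1) parallel.prems(3) b parallel.hyps(3) by (auto simp: parallel_comp_def)
    ultimately have "(u', w) \<in> parcs G2" by (rule parallel.IH(2))
    then show ?thesis by (simp add: parallel_comp_def)
  qed
next
  case (series G1 G2)
  note b = msp_basic[OF series.hyps(1)] msp_basic[OF series.hyps(2)]
  let ?G = "series_comp G1 G2"
  have arcs: "(a, c) \<in> parcs ?G \<longleftrightarrow> (a, c) \<in> parcs G1 \<or> (a, c) \<in> parcs G2 \<or> a \<in> sinks G1 \<and> c \<in> sources G2" for a c
    by (auto simp: series_comp_def)
  consider "v \<in> pverts G1" | "v \<in> sources G2" | "v \<in> pverts G2" "v \<notin> sources G2"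
    using series.prems(1) b by (auto simp: arcs sources_def)
  then show ?case
  proof cases
    case 1
    then have v: "v \<notin> pverts G2" using series.hyps(3) by auto
    then have uv: "(u, v) \<in> parcs G1" "(u', v) \<in> parcs G1"
      using series.prems(1,2) b by (auto simp: arcs sources_def)
    then have "u \<in> pverts G1" "u \<notin> sinks G1" using b by (auto simp: sinks_def)
    then have "(u, w) \<in> parcs G1" using series.prems(3) b series.hyps(3) by (auto simp: arcs)
    then show ?thesis using series.IH(1)[OF uv] arcs by blast
  next
    case 2
    then have "v \<in> pverts G2" by (auto simp: sources_def)
    moreover from this have "v \<notin> pverts G1" using series.hyps(3) by auto
    ultimately have "u \<in> sinks G1" "u' \<in> sinks G1"
      using 2 series.prems(1,2) b by (auto simp: arcs sources_def)
    moreover from this have "u \<in> pverts G1" "u \<notin> pverts G2" using series.hyps(3) by (auto simp: sinks_def)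
    ultimately have "w \<in> sources G2" using series.prems(3) b by (auto simp: arcs sinks_def)
    then show ?thesis using \<open>u' \<in> sinks G1\<close> arcs by blast
  next
    case 3
    then have v: "v \<notin> pverts G1" using series.hyps(3) by auto
    then have uv: "(u, v) \<in> parcs G2" "(u', v) \<in> parcs G2"
      using 3 series.prems(1,2) b by (auto simp: arcs)
    then have "u \<in> pverts G2" "u \<notin> pverts G1" using b series.hyps(3) by auto
    then have "(u, w) \<in> parcs G2" using series.prems(3) b by (auto simp: arcs sinks_def)
    then show ?thesis using series.IH(2)[OF uv] arcs by blast
  qed
qed

text \<open>\<open>org\<close> and \<open>dst\<close> present \<open>G\<close> as the line digraph of a multigraph with source \<open>s\<close> and sink \<open>t\<close>.\<close>

definition line_rep :: "'a pair_pre_digraph \<Rightarrow> ('a \<Rightarrow> 'n) \<Rightarrow> ('a \<Rightarrow> 'n) \<Rightarrow> 'n \<Rightarrow> 'n \<Rightarrow> bool" where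
  "line_rep G org dst s t \<longleftrightarrow> s \<noteq> t \<and>
     (\<forall>u\<in>pverts G. \<forall>v\<in>pverts G. (u, v) \<in> parcs G \<longleftrightarrow> dst u = org v) \<and>
     (\<forall>v\<in>pverts G. org v = s \<longleftrightarrow> v \<in> sources G) \<and> (\<forall>v\<in>pverts G. dst v = t \<longleftrightarrow> v \<in> sinks G)"

text \<open>Every line representation will do, so the names that the program finds for the nodes
  need no relation to the construction of \<open>G\<close>. The terminals are generalised because
  the joint of a series composition becomes a terminal of both parts.\<close>

lemma msp_ttsp:
  "minimal_series_parallel G \<Longrightarrow> line_rep G org dst s t \<Longrightarrow> ttsp org dst (pverts G) s t"
proof (induction arbitrary: s t rule: minimal_series_parallel.induct)
  case (single v)
  then show ?case
    by (auto simp: line_rep_def single_vertex_def sources_def sinks_def intro!: ttsp_edgeI)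
next
  case (parallel G1 G2)
  note b = msp_basic[OF parallel.hyps(1)] msp_basic[OF parallel.hyps(2)]
  let ?G = "parallel_comp G1 G2"
  have V: "pverts ?G = pverts G1 \<union> pverts G2" by (simp add: parallel_comp_def)
  have src: "v \<in> sources ?G \<longleftrightarrow> v \<in> sources G1 \<or> v \<in> sources G2" for v
    using b parallel.hyps(3) by (auto simp: sources_def parallel_comp_def)
  have snk: "v \<in> sinks ?G \<longleftrightarrow> v \<in> sinks G1 \<or> v \<in> sinks G2" for v
    using b parallel.hyps(3) by (auto simp: sinks_def parallel_comp_def)
  have arcs: "(u, v) \<in> parcs ?G \<longleftrightarrow> (u, v) \<in> parcs G1 \<or> (u, v) \<in> parcs G2" for u v
    by (auto simp: parallel_comp_def)
  have sub: "sources G1 \<subseteq> pverts G1" "sources G2 \<subseteq> pverts G2" "sinks G1 \<subseteq> pverts G1" "sinks G2 \<subseteq> pverts G2"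
    by (auto simp: sources_def sinks_def)
  have L: "s \<noteq> t" "\<And>u v. u \<in> pverts ?G \<Longrightarrow> v \<in> pverts ?G \<Longrightarrow> (u, v) \<in> parcs ?G \<longleftrightarrow> dst u = org v"
    "\<And>v. v \<in> pverts ?G \<Longrightarrow> org v = s \<longleftrightarrow> v \<in> sources ?G"
    "\<And>v. v \<in> pverts ?G \<Longrightarrow> dst v = t \<longleftrightarrow> v \<in> sinks ?G"
    using parallel.prems unfolding line_rep_def by blast+
  have 1: "line_rep G1 org dst s t"
    unfolding line_rep_def
  proof (intro conjI ballI)
    fix u v assume "u \<in> pverts G1" "v \<in> pverts G1"
    then show "(u, v) \<in> parcs G1 \<longleftrightarrow> dst u = org v"
      using L(2)[of u v] V arcs[of u v] b parallel.hyps(3) by blast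
  next
    fix v assume v: "v \<in> pverts G1"
    show "org v = s \<longleftrightarrow> v \<in> sources G1" using v L(3)[of v] V src[of v] sub parallel.hyps(3) by blast
    show "dst v = t \<longleftrightarrow> v \<in> sinks G1" using v L(4)[of v] V snk[of v] sub parallel.hyps(3) by blast
  qed (rule L(1))
  have 2: "line_rep G2 org dst s t"
    unfolding line_rep_def
  proof (intro conjI ballI)
    fix u v assume "u \<in> pverts G2" "v \<in> pverts G2"
    then show "(u, v) \<in> parcs G2 \<longleftrightarrow> dst u = org v"
      using L(2)[of u v] V arcs[of u v] b parallel.hyps(3) by blast
  next
    fix v assume v: "v \<in> pverts G2"
    show "org v = s \<longleftrightarrow> v \<in> sources G2" using v L(3)[of v] V src[of v] sub parallel.hyps(3) by blast
    show "dst v = t \<longleftrightarrow> v \<in> sinks G2" using v L(4)[of v] V snk[of v] sub parallel.hyps(3) by blast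
  qed (rule L(1))
  have out: "\<exists>w\<in>W. org w = x" if H: "x \<in> ends org dst W" "x \<noteq> t" "line_rep H org dst s t" "W = pverts H"
    "parcs H \<subseteq> W \<times> W" for W x H
  proof -
    from that(1) consider w where "w \<in> W" "org w = x" | w where "w \<in> W" "dst w = x" by (auto simp: ends_def)
    then show ?thesis
    proof cases
      case 2
      then have "w \<notin> sinks H" using that unfolding line_rep_def by blast
      then obtain w' where "(w, w') \<in> parcs H" using 2 H(4) by (auto simp: sinks_def)
      then show ?thesis using 2 that unfolding line_rep_def by (metis mem_Sigma_iff subsetD)
    qed blast
  qed
  have into: "\<exists>w\<in>W. dst w = x" if H: "x \<in> ends org dst W" "x \<noteq> s" "line_rep H org dst s t" "W = pverts H"
    "parcs H \<subseteq> W \<times> W" for W x H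
  proof -
    from that(1) consider w where "w \<in> W" "org w = x" | w where "w \<in> W" "dst w = x" by (auto simp: ends_def)
    then show ?thesis
    proof cases
      case 1
      then have "w \<notin> sources H" using that unfolding line_rep_def by blast
      then obtain w' where "(w', w) \<in> parcs H" using 1 H(4) by (auto simp: sources_def)
      then show ?thesis using 1 that unfolding line_rep_def by (metis mem_Sigma_iff subsetD)
    qed blast
  qed
  \<comment> \<open>A common node that is no terminal would be entered by an item of
    \<open>G1\<close> and left by one of \<open>G2\<close>, which makes an arc between the
    parts.\<close>
  have "x = s \<or> x = t" if x: "x \<in> ends org dst (pverts G1)" "x \<in> ends org dst (pverts G2)" for x
  proof (rule ccontr)
    assume n: "\<not> (x = s \<or> x = t)"
    obtain w where w: "w \<in> pverts G1" "dst w = x" using into[OF x(1) _ 1] n b by blast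
    obtain w' where w': "w' \<in> pverts G2" "org w' = x" using out[OF x(2) _ 2] n b by blast
    have "(w, w') \<in> parcs ?G" using L(2)[of w w'] w w' V by simp
    then show False using arcs[of w w'] b w w' parallel.hyps(3) by blast
  qed
  then show ?case unfolding V
    by (intro ttsp.par[OF parallel.IH(1)[OF 1] parallel.IH(2)[OF 2] parallel.hyps(3)]) auto
next
  case (series G1 G2)
  note b = msp_basic[OF series.hyps(1)] msp_basic[OF series.hyps(2)]
  let ?G = "series_comp G1 G2"
  have V: "pverts ?G = pverts G1 \<union> pverts G2" by (simp add: series_comp_def)
  have arcs: "(a, c) \<in> parcs ?G \<longleftrightarrow> (a, c) \<in> parcs G1 \<or> (a, c) \<in> parcs G2 \<or> a \<in> sinks G1 \<and> c \<in> sources G2" for a c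
    by (auto simp: series_comp_def)
  have sub: "sources G1 \<subseteq> pverts G1" "sources G2 \<subseteq> pverts G2" "sinks G1 \<subseteq> pverts G1" "sinks G2 \<subseteq> pverts G2"
    by (auto simp: sources_def sinks_def)
  obtain a c where a: "a \<in> sinks G1" and c: "c \<in> sources G2" using b by blast
  have ac: "a \<in> pverts G1" "c \<in> pverts G2" using a c sub by auto
  have src: "v \<in> sources ?G \<longleftrightarrow> v \<in> sources G1" for v
  proof
    assume v: "v \<in> sources ?G"
    have "v \<notin> pverts G2"
    proof
      assume "v \<in> pverts G2"
      then have "\<exists>u. (u, v) \<in> parcs ?G" using a arcs by (cases "v \<in> sources G2") (auto simp: sources_def)
      then show False using v by (auto simp: sources_def)
    qed
    then show "v \<in> sources G1" using v arcs by (auto simp: sources_def V)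
  next
    assume "v \<in> sources G1"
    then show "v \<in> sources ?G" using b sub series.hyps(3) by (auto simp: sources_def V arcs)
  qed
  have snk: "v \<in> sinks ?G \<longleftrightarrow> v \<in> sinks G2" for v
  proof
    assume v: "v \<in> sinks ?G"
    have "v \<notin> pverts G1"
    proof
      assume "v \<in> pverts G1"
      then have "\<exists>u. (v, u) \<in> parcs ?G" using c arcs by (cases "v \<in> sinks G1") (auto simp: sinks_def)
      then show False using v by (auto simp: sinks_def)
    qed
    then show "v \<in> sinks G2" using v arcs by (auto simp: sinks_def V)
  next
    assume "v \<in> sinks G2"
    then show "v \<in> sinks ?G" using b sub series.hyps(3) by (auto simp: sinks_def V arcs)
  qed
  have L: "s \<noteq> t" "\<And>u v. u \<in> pverts ?G \<Longrightarrow> v \<in> pverts ?G \<Longrightarrow> (u, v) \<in> parcs ?G \<longleftrightarrow> dst u = org v"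
    "\<And>v. v \<in> pverts ?G \<Longrightarrow> org v = s \<longleftrightarrow> v \<in> sources ?G"
    "\<And>v. v \<in> pverts ?G \<Longrightarrow> dst v = t \<longleftrightarrow> v \<in> sinks ?G"
    using series.prems unfolding line_rep_def by blast+
  \<comment> \<open>This is the joint: the arcs between the parts force one common head on all sinks
    of \<open>G1\<close> and the same node as tail on all sources of \<open>G2\<close>.\<close>
  define x where "x = dst a"
  have orgx: "org v = x \<longleftrightarrow> v \<in> sources G2" if "v \<in> pverts ?G" for v
  proof -
    have "org v = x \<longleftrightarrow> (a, v) \<in> parcs ?G" using L(2)[of a v] that ac V by (auto simp: x_def)
    also have "\<dots> \<longleftrightarrow> v \<in> sources G2" using a ac b series.hyps(3) by (auto simp: arcs sinks_def)
    finally show ?thesis .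
  qed
  have dstx: "dst v = x \<longleftrightarrow> v \<in> sinks G1" if "v \<in> pverts ?G" for v
  proof -
    have "dst v = x \<longleftrightarrow> (v, c) \<in> parcs ?G" using L(2)[of v c] that ac V orgx[of c] c by auto
    also have "\<dots> \<longleftrightarrow> v \<in> sinks G1" using c ac b series.hyps(3) by (auto simp: arcs sources_def)
    finally show ?thesis .
  qed
  have sx: "s \<noteq> x"
    using orgx[of c] L(3)[of c] c ac V src[of c] sub series.hyps(3) by auto
  have xt: "x \<noteq> t"
    using dstx[of a] L(4)[of a] a ac V snk[of a] sub series.hyps(3) by auto
  have 1: "line_rep G1 org dst s x"
    unfolding line_rep_def
  proof (intro conjI ballI)
    fix u v assume "u \<in> pverts G1" "v \<in> pverts G1"
    then show "(u, v) \<in> parcs G1 \<longleftrightarrow> dst u = org v"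
      using L(2)[of u v] V arcs[of u v] b sub series.hyps(3) by blast
  next
    fix v assume v: "v \<in> pverts G1"
    show "org v = s \<longleftrightarrow> v \<in> sources G1" using v L(3)[of v] V src[of v] by blast
    show "dst v = x \<longleftrightarrow> v \<in> sinks G1" using v dstx[of v] V by blast
  qed (rule sx)
  have 2: "line_rep G2 org dst x t"
    unfolding line_rep_def
  proof (intro conjI ballI)
    fix u v assume "u \<in> pverts G2" "v \<in> pverts G2"
    then show "(u, v) \<in> parcs G2 \<longleftrightarrow> dst u = org v"
      using L(2)[of u v] V arcs[of u v] b sub series.hyps(3) by blast
  next
    fix v assume v: "v \<in> pverts G2"
    show "org v = x \<longleftrightarrow> v \<in> sources G2" using v orgx[of v] V by blast
    show "dst v = t \<longleftrightarrow> v \<in> sinks G2" using v L(4)[of v] V snk[of v] by blast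
  qed (rule xt)
  \<comment> \<open>An arc between the parts leads from a sink of \<open>G1\<close> to a source of
    \<open>G2\<close> and so meets in \<open>x\<close>. Any other common node would yield such an
    arc, unless it is \<open>s\<close> or \<open>t\<close>; but \<open>s\<close> is a tail only in
    \<open>G1\<close> and \<open>t\<close> a head only in \<open>G2\<close>.\<close>
  have "y = x" if y: "y \<in> ends org dst (pverts G1)" "y \<in> ends org dst (pverts G2)" for y
  proof (rule ccontr)
    assume n: "y \<noteq> x"
    obtain u where u: "u \<in> pverts G1" "org u = y \<or> dst u = y" using y(1) by (auto simp: ends_def)
    obtain w where w: "w \<in> pverts G2" "org w = y \<or> dst w = y" using y(2) by (auto simp: ends_def)
    have no: False if "p \<in> pverts G1" "q \<in> pverts G2" "(p, q) \<in> parcs ?G" "org q = y \<or> dst p = y" for p q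
    proof -
      have "p \<in> sinks G1" "q \<in> sources G2" using that(1-3) arcs b series.hyps(3) by blast+
      then show False using that(1,2,4) n orgx[of q] dstx[of p] V by auto
    qed
    have no': False if "p \<in> pverts G1" "q \<in> pverts G2" "(q, p) \<in> parcs ?G" for p q
      using that arcs[of q p] b sub series.hyps(3) by blast
    have "\<exists>w'\<in>pverts G2. org w' = y \<or> y = t"
    proof (cases "org w = y")
      case False
      then have "dst w = y" using w by simp
      show ?thesis
      proof (cases "w \<in> sinks G2")
        case True
        then show ?thesis using L(4)[of w] w V snk[of w] \<open>dst w = y\<close> by blast
      next
        case False
        then obtain w' where "(w, w') \<in> parcs G2" using w(1) by (auto simp: sinks_def)
        then have "w' \<in> pverts G2" "(w, w') \<in> parcs ?G" using b arcs by blast+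
        then have "org w' = y" using L(2)[of w w'] w(1) V \<open>dst w = y\<close> by simp
        then show ?thesis using \<open>w' \<in> pverts G2\<close> by blast
      qed
    qed (use w in blast)
    then obtain w' where w': "w' \<in> pverts G2" "org w' = y \<or> y = t" by blast
    show False
    proof (cases "dst u = y")
      case True
      show False
      proof (cases "y = t")
        case True
        then show False using L(4)[of u] u V snk[of u] sub series.hyps(3) \<open>dst u = y\<close> by blast
      next
        case False
        then show False using no[of u w'] u w' L(2)[of u w'] \<open>dst u = y\<close> V by auto
      qed
    next
      case False
      then have ou: "org u = y" using u by simp
      show False
      proof (cases "u \<in> sources G1")
        case True
        then have "y = s" using L(3)[of u] u V src[of u] ou by auto
        then have "org w' \<noteq> y" using L(3)[of w'] w' V src[of w'] sub series.hyps(3) by blast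
        then show False using w' \<open>y = s\<close> L(1) by auto
      next
        case False
        then obtain u' where "(u', u) \<in> parcs G1" using u(1) by (auto simp: sources_def)
        then have u': "u' \<in> pverts G1" "dst u' = y" using b L(2)[of u' u] arcs[of u' u] V ou u by auto
        show False
        proof (cases "y = t")
          case True
          then show False using L(4)[of u'] u' V snk[of u'] sub series.hyps(3) by blast
        next
          case False
          then show False using no[of u' w'] u' w' L(2)[of u' w'] V by auto
        qed
      qed
    qed
  qed
  then show ?case unfolding V
    by (intro ttsp.ser[OF series.IH(1)[OF 1] series.IH(2)[OF 2] series.hyps(3)]) auto
qed

text \<open>The in-neighbours of an item are the edges into its tail. There are none exactly if the
  tail is the source, so exempting \<open>s\<close> in \<open>constraint\<close> expresses the
  proviso \<open>in_nbrs G y \<noteq> {}\<close>.\<close>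

lemma weak_constraint_line_rep:
  assumes "minimal_series_parallel G" "line_rep G org dst s t"
  shows "weak_digraph_constraint G A \<longleftrightarrow> constraint Leaf org dst (pverts G) s A"
proof -
  note b = msp_basic[OF assms(1)]
  have L: "\<And>u v. u \<in> pverts G \<Longrightarrow> v \<in> pverts G \<Longrightarrow> (u, v) \<in> parcs G \<longleftrightarrow> dst u = org v"
    "\<And>v. v \<in> pverts G \<Longrightarrow> org v = s \<longleftrightarrow> v \<in> sources G"
    using assms(2) unfolding line_rep_def by blast+
  have nb: "in_nbrs G y = {u \<in> pverts G. dst u = org y}" if "y \<in> pverts G" for y
    using L(1) that by (auto simp: in_nbrs_def)
  have ne: "in_nbrs G y \<noteq> {} \<longleftrightarrow> org y \<noteq> s" if "y \<in> pverts G" for y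
    using L(2)[OF that] that b by (auto simp: in_nbrs_def sources_def)
  have "weak_digraph_constraint G A \<longleftrightarrow>
      (\<forall>y\<in>pverts G. org y \<noteq> s \<longrightarrow> {u \<in> pverts G. dst u = org y} \<subseteq> A \<longrightarrow> y \<in> A)"
    unfolding weak_digraph_constraint_def using nb ne by auto
  then show ?thesis unfolding constraint_def by auto
qed

section \<open>Reasoning about programs\<close>

text \<open>Memory is treated as an array of records of 22 cells. Nodes, edges and table entries
  share the record numbers but use different fields, so their updates do not collide.\<close>

definition Fld :: "nat \<Rightarrow> expr \<Rightarrow> expr" where
  "Fld f e = Mem (Plus (Times e (Const 22)) (Const f))"

definition SetFld :: "nat \<Rightarrow> expr \<Rightarrow> expr \<Rightarrow> program" where
  "SetFld f e v = Store (Plus (Times e (Const 22)) (Const f)) v"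

definition fld :: "nat \<Rightarrow> (nat \<Rightarrow> nat) \<Rightarrow> nat \<Rightarrow> nat" where
  "fld f M i = M (i * 22 + f)"

definition upd :: "nat \<Rightarrow> nat \<Rightarrow> nat \<Rightarrow> (nat \<Rightarrow> nat) \<Rightarrow> nat \<Rightarrow> nat" where
  "upd f i v M = M(i * 22 + f := v)"

lemma fld_upd: "f < 22 \<Longrightarrow> g < 22 \<Longrightarrow> fld g (upd f i v M) = (if g = f then (fld g M)(i := v) else fld g M)"
proof -
  assume "f < 22" "g < 22"
  then have "(j * 22 + g) div 22 = j" "(j * 22 + g) mod 22 = g"
    "(i * 22 + f) div 22 = i" "(i * 22 + f) mod 22 = f" for j by simp_all
  then have "j * 22 + g = i * 22 + f \<longleftrightarrow> j = i \<and> g = f" for j by metis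
  then show ?thesis by (auto simp: fld_def upd_def fun_eq_iff)
qed

lemma fld_upd_same [simp]: "f < 22 \<Longrightarrow> fld f (upd f i v M) = (fld f M)(i := v)"
  by (simp add: fld_upd)

lemma fld_upd_other [simp]: "f \<noteq> g \<Longrightarrow> f < 22 \<Longrightarrow> g < 22 \<Longrightarrow> fld g (upd f i v M) = fld g M"
  by (simp add: fld_upd)

primrec seqs :: "program list \<Rightarrow> program" where
  "seqs [] = Skip"
| "seqs (p # ps) = Seq p (seqs ps)"

text \<open>Adding the costs of both branches instead of taking the larger one is still an upper
  bound and evaluates by simplification. A loop counts 0 since \<open>wp\<close> is false for it;
  loops are timed by \<open>runs_While\<close>.\<close>

primrec prog_cost :: "program \<Rightarrow> nat" where
  "prog_cost Skip = 1"
| "prog_cost (Assign x e) = 1 + expr_cost e"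
| "prog_cost (Store a e) = 1 + expr_cost a + expr_cost e"
| "prog_cost (Seq P R) = prog_cost P + prog_cost R"
| "prog_cost (program.If b P R) = 1 + test_cost b + prog_cost P + prog_cost R"
| "prog_cost (While b P) = 0"

text \<open>\<open>NI\<close> is the number of records. The factor 100 leaves room for the addresses
  of records, which are below \<open>22 * NI\<close>, and for the constants and intermediate results
  of the program.\<close>

locale ram =
  fixes W S NI :: nat and inp :: "nat list"
  assumes W_large: "100 * (NI + length inp + 1) \<le> W"
    and S_large: "22 * NI \<le> S"
    and inp_le: "\<And>x. x \<in> set inp \<Longrightarrow> x \<le> W"
begin

text \<open>Registers, cells and input values are small by \<open>bounded\<close> and by the locale.
  What remains of \<open>expr_ok\<close> are the constants, the ranges of the addresses and the
  sizes of sums and products.\<close>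

primrec safe :: "state \<Rightarrow> expr \<Rightarrow> bool" where
  "safe \<sigma> (Const k) \<longleftrightarrow> k \<le> W"
| "safe \<sigma> (Reg x) \<longleftrightarrow> True"
| "safe \<sigma> (Input e) \<longleftrightarrow> safe \<sigma> e \<and> eval inp \<sigma> e < length inp"
| "safe \<sigma> (Mem e) \<longleftrightarrow> safe \<sigma> e \<and> eval inp \<sigma> e < S"
| "safe \<sigma> (Plus e1 e2) \<longleftrightarrow> safe \<sigma> e1 \<and> safe \<sigma> e2 \<and> eval inp \<sigma> e1 + eval inp \<sigma> e2 \<le> W"
| "safe \<sigma> (Minus e1 e2) \<longleftrightarrow> safe \<sigma> e1 \<and> safe \<sigma> e2"
| "safe \<sigma> (Times e1 e2) \<longleftrightarrow> safe \<sigma> e1 \<and> safe \<sigma> e2 \<and> eval inp \<sigma> e1 * eval inp \<sigma> e2 \<le> W"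

primrec safe_test :: "state \<Rightarrow> test \<Rightarrow> bool" where
  "safe_test \<sigma> (Less e1 e2) \<longleftrightarrow> safe \<sigma> e1 \<and> safe \<sigma> e2"
| "safe_test \<sigma> (Equal e1 e2) \<longleftrightarrow> safe \<sigma> e1 \<and> safe \<sigma> e2"
| "safe_test \<sigma> (test.Not b) \<longleftrightarrow> safe_test \<sigma> b"
| "safe_test \<sigma> (And b1 b2) \<longleftrightarrow> safe_test \<sigma> b1 \<and> safe_test \<sigma> b2"

definition bounded :: "state \<Rightarrow> bool" where
  "bounded \<sigma> \<longleftrightarrow> (\<forall>x. reg \<sigma> x \<le> W) \<and> (\<forall>a. mem \<sigma> a \<le> W)"

lemma safe_expr_ok: "bounded \<sigma> \<Longrightarrow> safe \<sigma> e \<Longrightarrow> expr_ok W S inp \<sigma> e \<and> eval inp \<sigma> e \<le> W"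
  by (induction e) (auto simp: bounded_def inp_le)

lemma safe_test_ok: "bounded \<sigma> \<Longrightarrow> safe_test \<sigma> b \<Longrightarrow> test_ok W S inp \<sigma> b"
  by (induction b) (auto simp: safe_expr_ok)

text \<open>Total correctness with a time bound. \<open>bounded\<close> occurs as assumption and as
  conclusion, so it is handed on by every composition without being mentioned.\<close>

definition runs :: "program \<Rightarrow> state \<Rightarrow> nat \<Rightarrow> (state \<Rightarrow> bool) \<Rightarrow> bool" where
  "runs P \<sigma> T Q \<longleftrightarrow> (bounded \<sigma> \<longrightarrow>
     (\<exists>t \<tau>. exec W S inp P \<sigma> t \<tau> \<and> t \<le> T \<and> bounded \<tau> \<and> Q \<tau>))"

lemma runs_mono: "runs P \<sigma> T Q \<Longrightarrow> T \<le> T' \<Longrightarrow> (\<And>\<tau>. Q \<tau> \<Longrightarrow> Q' \<tau>) \<Longrightarrow> runs P \<sigma> T' Q'"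
  unfolding runs_def by (meson order_trans)

lemma runs_Seq:
  assumes "runs P \<sigma> T1 (\<lambda>\<tau>. runs R \<tau> T2 Q)" "T1 + T2 \<le> T"
  shows "runs (Seq P R) \<sigma> T Q"
  unfolding runs_def
proof
  assume "bounded \<sigma>"
  then obtain t \<tau> where 1: "exec W S inp P \<sigma> t \<tau>" "t \<le> T1" "bounded \<tau>" "runs R \<tau> T2 Q"
    using assms(1) unfolding runs_def by blast
  then obtain u \<rho> where 2: "exec W S inp R \<tau> u \<rho>" "u \<le> T2" "bounded \<rho>" "Q \<rho>"
    unfolding runs_def by blast
  then show "\<exists>t \<tau>. exec W S inp (Seq P R) \<sigma> t \<tau> \<and> t \<le> T \<and> bounded \<tau> \<and> Q \<tau>"
    using 1 assms(2) by (intro exI[of _ "t + u"] exI[of _ \<rho>]) (auto intro: exec.Seq)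
qed

lemma runs_Seq_post:
  assumes "runs P \<sigma> T1 R" "\<And>\<tau>. R \<tau> \<Longrightarrow> runs P' \<tau> T2 Q" "T1 + T2 \<le> T"
  shows "runs (Seq P P') \<sigma> T Q"
  by (rule runs_Seq[OF runs_mono[OF assms(1) order_refl assms(2)] assms(3)])

lemma runs_If:
  assumes "safe_test \<sigma> b" "holds inp \<sigma> b \<Longrightarrow> runs P \<sigma> T Q" "\<not> holds inp \<sigma> b \<Longrightarrow> runs R \<sigma> T Q"
    "1 + test_cost b + T \<le> T'"
  shows "runs (program.If b P R) \<sigma> T' Q"
  unfolding runs_def
proof
  assume b: "bounded \<sigma>"
  note ok = safe_test_ok[OF b assms(1)]
  show "\<exists>t \<tau>. exec W S inp (program.If b P R) \<sigma> t \<tau> \<and> t \<le> T' \<and> bounded \<tau> \<and> Q \<tau>"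
  proof (cases "holds inp \<sigma> b")
    case True
    then obtain t \<tau> where "exec W S inp P \<sigma> t \<tau>" "t \<le> T" "bounded \<tau>" "Q \<tau>"
      using assms(2) b unfolding runs_def by blast
    then show ?thesis using exec.IfTrue[OF ok True] assms(4) by (meson add_left_mono order_trans)
  next
    case False
    then obtain t \<tau> where "exec W S inp R \<sigma> t \<tau>" "t \<le> T" "bounded \<tau>" "Q \<tau>"
      using assms(3) b unfolding runs_def by blast
    then show ?thesis using exec.IfFalse[OF ok False] assms(4) by (meson add_left_mono order_trans)
  qed
qed

text \<open>\<open>\<mu>\<close> bounds the number of iterations; the additional round in the time
  bound pays for the final test.\<close>

lemma runs_While:
  assumes "I \<sigma>" "\<And>\<sigma>. I \<sigma> \<Longrightarrow> safe_test \<sigma> b"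
    "\<And>\<sigma>. I \<sigma> \<Longrightarrow> holds inp \<sigma> b \<Longrightarrow> runs P \<sigma> T (\<lambda>\<tau>. I \<tau> \<and> \<mu> \<tau> < \<mu> \<sigma>)"
    "\<And>\<sigma>. I \<sigma> \<Longrightarrow> \<not> holds inp \<sigma> b \<Longrightarrow> Q \<sigma>" "(\<mu> \<sigma> + 1) * (1 + test_cost b + T) \<le> T'"
  shows "runs (While b P) \<sigma> T' Q"
proof -
  have "runs (While b P) \<sigma> ((\<mu> \<sigma> + 1) * (1 + test_cost b + T)) Q"
    using assms(1)
  proof (induction "\<mu> \<sigma>" arbitrary: \<sigma> rule: less_induct)
    case less
    show ?case unfolding runs_def
    proof
      assume b: "bounded \<sigma>"
      note ok = safe_test_ok[OF b assms(2)[OF less.prems]]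
      show "\<exists>t \<tau>. exec W S inp (While b P) \<sigma> t \<tau> \<and> t \<le> (\<mu> \<sigma> + 1) * (1 + test_cost b + T) \<and> bounded \<tau> \<and> Q \<tau>"
      proof (cases "holds inp \<sigma> b")
        case True
        then obtain t \<tau> where 1: "exec W S inp P \<sigma> t \<tau>" "t \<le> T" "bounded \<tau>" "I \<tau>" "\<mu> \<tau> < \<mu> \<sigma>"
          using assms(3)[OF less.prems True] b unfolding runs_def by blast
        then obtain u \<rho> where 2: "exec W S inp (While b P) \<tau> u \<rho>" "u \<le> (\<mu> \<tau> + 1) * (1 + test_cost b + T)"
          "bounded \<rho>" "Q \<rho>"
          using less.hyps[OF 1(5,4)] unfolding runs_def by blast
        have "(\<mu> \<tau> + 1) * (1 + test_cost b + T) \<le> \<mu> \<sigma> * (1 + test_cost b + T)"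
          using 1(5) by (intro mult_le_mono1) simp
        then have "1 + test_cost b + t + u \<le> (\<mu> \<sigma> + 1) * (1 + test_cost b + T)"
          using 1(2) 2(2) by simp
        then show ?thesis using exec.WhileTrue[OF ok True 1(1) 2(1)] 2 by blast
      next
        case False
        have "1 + test_cost b \<le> (\<mu> \<sigma> + 1) * (1 + test_cost b + T)" by simp
        then show ?thesis using exec.WhileFalse[OF ok False] assms(4)[OF less.prems False] b by blast
      qed
    qed
  qed
  then show ?thesis using assms(5) runs_mono by blast
qed

text \<open>Straight-line code is executed symbolically by the simplifier. Loops are left out on
  purpose and enter through an invariant.\<close>

primrec wp :: "program \<Rightarrow> (state \<Rightarrow> bool) \<Rightarrow> state \<Rightarrow> bool" where
  "wp Skip Q \<sigma> \<longleftrightarrow> Q \<sigma>"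
| "wp (Assign x e) Q \<sigma> \<longleftrightarrow> safe \<sigma> e \<and> Q (\<sigma>\<lparr>reg := (reg \<sigma>)(x := eval inp \<sigma> e)\<rparr>)"
| "wp (Store a e) Q \<sigma> \<longleftrightarrow> safe \<sigma> a \<and> safe \<sigma> e \<and> eval inp \<sigma> a < S \<and>
     Q (\<sigma>\<lparr>mem := (mem \<sigma>)(eval inp \<sigma> a := eval inp \<sigma> e)\<rparr>)"
| "wp (Seq P R) Q \<sigma> \<longleftrightarrow> wp P (wp R Q) \<sigma>"
| "wp (program.If b P R) Q \<sigma> \<longleftrightarrow> safe_test \<sigma> b \<and>
     (holds inp \<sigma> b \<longrightarrow> wp P Q \<sigma>) \<and> (\<not> holds inp \<sigma> b \<longrightarrow> wp R Q \<sigma>)"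
| "wp (While b P) Q \<sigma> \<longleftrightarrow> False"

lemma wp_runs: "wp P Q \<sigma> \<Longrightarrow> runs P \<sigma> (prog_cost P) Q"
proof (induction P arbitrary: \<sigma> Q)
  case Skip
  then show ?case unfolding runs_def by (intro impI exI[of _ 1] exI[of _ \<sigma>]) (auto intro: exec.Skip[simplified])
next
  case (Assign x e)
  show ?case unfolding runs_def
  proof
    assume b: "bounded \<sigma>"
    have ok: "expr_ok W S inp \<sigma> e" "eval inp \<sigma> e \<le> W" using safe_expr_ok[OF b] Assign by auto
    then have "bounded (\<sigma>\<lparr>reg := (reg \<sigma>)(x := eval inp \<sigma> e)\<rparr>)" using b by (auto simp: bounded_def)
    then show "\<exists>t \<tau>. exec W S inp (Assign x e) \<sigma> t \<tau> \<and> t \<le> prog_cost (Assign x e) \<and> bounded \<tau> \<and> Q \<tau>"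
      using exec.Assign[OF ok(1), of x] Assign by (intro exI conjI) auto
  qed
next
  case (Store a e)
  show ?case unfolding runs_def
  proof
    assume b: "bounded \<sigma>"
    have ok: "expr_ok W S inp \<sigma> a" "expr_ok W S inp \<sigma> e" "eval inp \<sigma> e \<le> W" "eval inp \<sigma> a < S"
      using safe_expr_ok[OF b] Store by auto
    then have "bounded (\<sigma>\<lparr>mem := (mem \<sigma>)(eval inp \<sigma> a := eval inp \<sigma> e)\<rparr>)" using b by (auto simp: bounded_def)
    then show "\<exists>t \<tau>. exec W S inp (Store a e) \<sigma> t \<tau> \<and> t \<le> prog_cost (Store a e) \<and> bounded \<tau> \<and> Q \<tau>"
      using exec.Store[OF ok(1,2,4)] Store by (intro exI conjI) auto
  qed
next
  case (Seq P R)
  have "runs P \<sigma> (prog_cost P) (\<lambda>\<tau>. runs R \<tau> (prog_cost R) Q)"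
    by (rule runs_mono[OF Seq.IH(1)[of "wp R Q"]]) (use Seq in auto)
  then show ?case by (rule runs_Seq) simp
next
  case (If b P R)
  show ?case
    by (rule runs_If[where T = "prog_cost P + prog_cost R"])
      (use If in \<open>auto intro: runs_mono[OF If.IH(1)] runs_mono[OF If.IH(2)]\<close>)
qed simp

lemma runs_wp: "wp P Q \<sigma> \<Longrightarrow> prog_cost P \<le> T \<Longrightarrow> runs P \<sigma> T Q"
  using wp_runs runs_mono by blast

lemma runs_Seq_wp: "wp P (\<lambda>\<tau>. runs R \<tau> T2 Q) \<sigma> \<Longrightarrow> prog_cost P + T2 \<le> T \<Longrightarrow> runs (Seq P R) \<sigma> T Q"
  using runs_Seq wp_runs by blast

text \<open>All side conditions of accessing field \<open>f\<close> of record \<open>i\<close> in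
  one predicate, which the simplifier proves from \<open>i < NI\<close> and \<open>f < 22\<close>
  without looking inside.\<close>

definition fits :: "nat \<Rightarrow> nat \<Rightarrow> bool" where
  "fits f i \<longleftrightarrow> 22 \<le> W \<and> i * 22 \<le> W \<and> f \<le> W \<and> i * 22 + f \<le> W \<and> i * 22 + f < S"

lemma fitsI [simp]: "i < NI \<Longrightarrow> f < 22 \<Longrightarrow> fits f i"
  using W_large S_large unfolding fits_def by auto

lemma eval_Fld [simp]: "eval inp \<sigma> (Fld f e) = fld f (mem \<sigma>) (eval inp \<sigma> e)"
  by (simp add: Fld_def fld_def)

lemma safe_Fld [simp]: "safe \<sigma> (Fld f e) \<longleftrightarrow> safe \<sigma> e \<and> fits f (eval inp \<sigma> e)"
  by (auto simp: Fld_def fits_def)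

lemma wp_SetFld [simp]: "wp (SetFld f e v) Q \<sigma> \<longleftrightarrow> safe \<sigma> e \<and> safe \<sigma> v \<and> fits f (eval inp \<sigma> e) \<and>
    Q (\<sigma>\<lparr>mem := upd f (eval inp \<sigma> e) (eval inp \<sigma> v) (mem \<sigma>)\<rparr>)"
  by (auto simp: SetFld_def fits_def upd_def)

lemma wp_mono: "wp P Q \<sigma> \<Longrightarrow> (\<And>\<tau>. Q \<tau> \<Longrightarrow> Q' \<tau>) \<Longrightarrow> wp P Q' \<sigma>"
proof (induction P arbitrary: \<sigma> Q Q')
  case (Seq P1 P2)
  have "wp P1 (wp P2 Q) \<sigma>" using Seq.prems by simp
  then have "wp P1 (wp P2 Q') \<sigma>" using Seq.IH(1) Seq.IH(2) Seq.prems(2) by blast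
  then show ?case by simp
qed auto

end

lemma expr_cost_Fld [simp]: "expr_cost (Fld f e) = 5 + expr_cost e"
  by (simp add: Fld_def)

lemma prog_cost_SetFld [simp]: "prog_cost (SetFld f e v) = 5 + expr_cost e + expr_cost v"
  by (simp add: SetFld_def)

section \<open>The tables\<close>

abbreviation "inN \<equiv> Input (Const 0)"
abbreviation "inM \<equiv> Input (Const 1)"
abbreviation "inC \<equiv> Input (Const 2)"
abbreviation "rx \<equiv> Reg ''x''"
abbreviation "ry \<equiv> Reg ''y''"
abbreviation "rid \<equiv> Reg ''id''"
abbreviation "rl \<equiv> Reg ''l''"
abbreviation "rr \<equiv> Reg ''r''"

definition row :: "expr \<Rightarrow> expr \<Rightarrow> expr" where
  "row e x = Plus (Times e (Plus inC (Const 1))) x"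

text \<open>0 marks an absent entry, so the choice in field \<open>h\<close> is stored plus one; the
  one in field \<open>4 + h\<close> is stored as it is. The code \<open>x * 22 + f\<close> is the
  distance of the chosen entry from the first cell of its table, so the extraction can use it for
  addressing.\<close>

definition combo_step :: "nat \<times> nat \<times> nat \<Rightarrow> program" where
  "combo_step = (\<lambda>(f, g, h).
     program.If (And (Less (Const 0) (Fld f (row rl rx))) (Less (Const 0) (Fld g (row rr ry))))
       (Seq (SetFld h (row rid (Plus rx ry)) (Plus (Const 1) (Plus (Times rx (Const 22)) (Const f))))
            (SetFld (4 + h) (row rid (Plus rx ry)) (Plus (Times ry (Const 22)) (Const g))))
       Skip)"

definition combo_steps :: "bool \<Rightarrow> program" where
  "combo_steps k = seqs (map combo_step (flag_combos k))"

definition merge_inner :: "bool \<Rightarrow> program" where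
  "merge_inner k = While (Less (Plus rx ry) (Plus inC (Const 1)))
     (Seq (combo_steps k) (Assign ''y'' (Plus ry (Const 1))))"

definition merge_tables :: "bool \<Rightarrow> program" where
  "merge_tables k = Seq (Assign ''x'' (Const 0))
     (While (Less rx (Plus inC (Const 1)))
       (Seq (Assign ''y'' (Const 0)) (Seq (merge_inner k) (Assign ''x'' (Plus rx (Const 1))))))"

text \<open>The edge numbers stay below \<open>2 * n\<close>, and each edge has a table of
  \<open>c + 1\<close> records. Nodes and edges use other fields of the same records.\<close>

locale ssgw_ram =
  fixes W S n c :: nat and s :: "nat \<Rightarrow> nat" and es :: "(nat \<times> nat) list"
  assumes n_pos: "0 < n" and c_pos: "0 < c"
    and W_big: "100 * (2 * n * (c + 1) + length (encode n s c es) + 1) \<le> W"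
    and S_big: "22 * (2 * n * (c + 1)) \<le> S"
    and input_le: "\<And>x. x \<in> set (encode n s c es) \<Longrightarrow> x \<le> W"
    and arcs_less: "\<And>u v. (u, v) \<in> set es \<Longrightarrow> u < n \<and> v < n"
begin

abbreviation "inp \<equiv> encode n s c es"
abbreviation "NI \<equiv> 2 * n * (c + 1)"

sublocale ram W S NI inp
  using W_big S_big input_le by unfold_locales auto

lemma length_inp: "length inp = 3 + n + 2 * length es"
proof -
  have "length (concat (map (\<lambda>(u, v). [u, v]) es)) = 2 * length es" by (induction es) auto
  then show ?thesis by (simp add: encode_def)
qed

lemma length_inp_pos [simp]: "0 < length inp" "Suc 0 < length inp" "2 < length inp"
  by (auto simp: length_inp)

lemma inp_nth [simp]: "inp ! 0 = n" "inp ! Suc 0 = length es" "inp ! 2 = c"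
  by (simp_all add: encode_def)

lemma inp_size: "v < n \<Longrightarrow> inp ! (3 + v) = s v"
  by (simp add: encode_def nth_append)

lemma inp_arc:
  assumes "i < length es"
  shows "inp ! (3 + n + 2 * i) = fst (es ! i)" "inp ! (3 + n + 2 * i + 1) = snd (es ! i)"
proof -
  let ?f = "\<lambda>(u, v). [u, v]"
  have *: "i < length xs \<Longrightarrow> concat (map ?f xs) ! (2 * i) = fst (xs ! i) \<and>
      concat (map ?f xs) ! (2 * i + 1) = snd (xs ! i)" for xs :: "(nat \<times> nat) list" and i
  proof (induction xs arbitrary: i)
    case (Cons x xs)
    then show ?case by (cases i; cases x) auto
  qed simp
  have "inp = ([n, length es, c] @ map s [0..<n]) @ concat (map ?f es)" by (simp add: encode_def)
  then have "inp ! (3 + n + j) = concat (map ?f es) ! j" for j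
    by (simp only: nth_append) simp
  from this[of "2 * i"] this[of "2 * i + 1"]
  show "inp ! (3 + n + 2 * i) = fst (es ! i)" "inp ! (3 + n + 2 * i + 1) = snd (es ! i)"
    using *[OF assms] by (simp_all add: add.assoc)
qed

lemma W_100: "100 \<le> W"
  using W_big by simp

lemma W_simps [simp]: "0 \<le> W" "Suc 0 \<le> W" "numeral k \<le> (100::nat) \<Longrightarrow> numeral k \<le> W"
proof -
  show "0 \<le> W" "Suc 0 \<le> W" using W_100 by linarith+
  show "numeral k \<le> (100::nat) \<Longrightarrow> numeral k \<le> W" using W_100 by (rule order_trans[rotated])
qed

lemma small_le_W: "x \<le> 100 * (NI + length inp) \<Longrightarrow> x \<le> W"
  using W_big by simp

lemma c_less_NI: "c + 1 < NI"
proof -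
  define p where "p = n * (c + 1)"
  have "1 * (c + 1) \<le> p" unfolding p_def using n_pos by (intro mult_le_mono1) simp
  then have "c + 1 \<le> p" by simp
  then have "c + 1 < p + p" by simp
  moreover have "p + p = NI" by (simp add: p_def algebra_simps)
  ultimately show ?thesis by metis
qed

text \<open>A positive capacity makes the records of the tables suffice for the nodes
  \<open>0\<close> to \<open>n + 1\<close> as well.\<close>

lemma n_less_NI: "2 * n + n + n \<le> NI" "n + 1 < NI"
proof -
  have "2 * n * 2 \<le> 2 * n * (c + 1)" using c_pos by (intro mult_le_mono2) simp
  then show "2 * n + n + n \<le> NI" "n + 1 < NI" using n_pos by linarith+
qed

lemma row_less: "e < 2 * n \<Longrightarrow> x \<le> c \<Longrightarrow> e * (c + 1) + x < NI"
proof -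
  assume "e < 2 * n" "x \<le> c"
  then have "(e + 1) * (c + 1) \<le> 2 * n * (c + 1)" by (intro mult_le_mono1) simp
  then show ?thesis using \<open>x \<le> c\<close> by simp
qed

lemma eval_row [simp]: "eval inp \<sigma> (row e x) = eval inp \<sigma> e * (c + 1) + eval inp \<sigma> x"
  by (simp add: row_def)

lemma safe_row [simp]:
  assumes "eval inp \<sigma> e < 2 * n" "eval inp \<sigma> x \<le> c" "safe \<sigma> e" "safe \<sigma> x"
  shows "safe \<sigma> (row e x)"
proof -
  have "eval inp \<sigma> e * (c + 1) + eval inp \<sigma> x \<le> W"
    using row_less[OF assms(1,2)] by (intro small_le_W) simp
  moreover have "c + 1 \<le> W" using c_less_NI by (intro small_le_W) simp
  ultimately show ?thesis using assms by (simp add: row_def)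
qed

definition table :: "(nat \<Rightarrow> nat) \<Rightarrow> nat \<Rightarrow> (nat \<times> nat) set" where
  "table M e = {(x, f). x \<le> c \<and> f < 4 \<and> fld f M (e * (c + 1) + x) \<noteq> 0}"

definition choice_ok :: "bool \<Rightarrow> nat \<Rightarrow> nat \<Rightarrow> nat \<Rightarrow> (nat \<Rightarrow> nat) \<Rightarrow> bool" where
  "choice_ok k l r i M \<longleftrightarrow> (\<forall>z h. (z, h) \<in> table M i \<longrightarrow> (\<exists>x f y g. (f, g, h) \<in> set (flag_combos k) \<and>
     z = x + y \<and> (x, f) \<in> table M l \<and> (y, g) \<in> table M r \<and>
     fld h M (i * (c + 1) + z) = 1 + (x * 22 + f) \<and> fld (4 + h) M (i * (c + 1) + z) = y * 22 + g))"

definition same_outside :: "nat \<Rightarrow> (nat \<Rightarrow> nat) \<Rightarrow> (nat \<Rightarrow> nat) \<Rightarrow> bool" where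
  "same_outside i M M' \<longleftrightarrow> (\<forall>f<22. \<forall>j. 8 \<le> f \<or> j < i * (c + 1) \<or> i * (c + 1) + c < j \<longrightarrow> fld f M' j = fld f M j)"

text \<open>The invariant of a merge. \<open>choice_ok\<close> contains soundness, and
  \<open>D\<close> collects the combinations treated so far, which is completeness; the partial
  table is never described exactly.\<close>

definition merging :: "bool \<Rightarrow> nat \<Rightarrow> nat \<Rightarrow> nat \<Rightarrow> (nat \<Rightarrow> nat) \<Rightarrow> (nat \<times> nat \<times> nat \<times> nat \<times> nat) set \<Rightarrow>
    (nat \<Rightarrow> nat) \<Rightarrow> bool" where
  "merging k l r i M0 D M \<longleftrightarrow> same_outside i M0 M \<and> choice_ok k l r i M \<and>
     (\<forall>(x, y, f, g, h)\<in>D. (f, g, h) \<in> set (flag_combos k) \<longrightarrow> x + y \<le> c \<longrightarrow>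
        (x, f) \<in> table M l \<longrightarrow> (y, g) \<in> table M r \<longrightarrow> (x + y, h) \<in> table M i)"

lemma same_outside_table:
  assumes "same_outside i M M'" "e \<noteq> i"
  shows "table M' e = table M e"
proof -
  have "fld f M' (e * (c + 1) + x) = fld f M (e * (c + 1) + x)" if "f < 4" "x \<le> c" for f x
  proof -
    have "e * (c + 1) + x < i * (c + 1) \<or> i * (c + 1) + c < e * (c + 1) + x"
    proof (cases "e < i")
      case True
      then have "(e + 1) * (c + 1) \<le> i * (c + 1)" by (intro mult_le_mono1) simp
      then show ?thesis using that by simp
    next
      case False
      then have "(i + 1) * (c + 1) \<le> e * (c + 1)" using assms(2) by (intro mult_le_mono1) simp
      then show ?thesis by simp
    qed
    then have "8 \<le> f \<or> e * (c + 1) + x < i * (c + 1) \<or> i * (c + 1) + c < e * (c + 1) + x" by blast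
    moreover have "f < 22" using that by simp
    ultimately show ?thesis using assms(1) unfolding same_outside_def by blast
  qed
  then show ?thesis by (auto simp: table_def)
qed

text \<open>An entry can arise in several ways; a later choice overwrites an earlier one and is just
  as good. The tables of the children are untouched because \<open>l\<close> and \<open>r\<close>
  differ from \<open>i\<close>.\<close>

lemma merging_store:
  assumes m: "merging k l r i M0 D M" and lr: "l < i" "r < i"
    and fgh: "(f, g, h) \<in> set (flag_combos k)" and xy: "x + y \<le> c"
    and t: "(x, f) \<in> table M l" "(y, g) \<in> table M r"
  shows "merging k l r i M0 (insert (x, y, f, g, h) D)
    (upd (4 + h) (i * (c + 1) + (x + y)) (y * 22 + g) (upd h (i * (c + 1) + (x + y)) (1 + (x * 22 + f)) M))"
    (is "merging k l r i M0 ?D ?M")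
proof -
  have h: "h < 4" "f < 4" "g < 4" using flag_combos_less[OF fgh] by auto
  have out: "same_outside i M ?M"
    unfolding same_outside_def using h xy by (auto simp: fld_upd)
  then have tab: "table ?M l = table M l" "table ?M r = table M r"
    using lr same_outside_table[of i M ?M] by auto
  have so: "same_outside i M0 ?M"
    using out m unfolding same_outside_def merging_def by simp
  have mono: "(z, h') \<in> table ?M i \<longleftrightarrow> (z, h') \<in> table M i \<or> (z, h') = (x + y, h)" for z h'
  proof (cases "h' = h")
    case True
    then show ?thesis using h xy by (auto simp: table_def fld_upd)
  next
    case False
    then show ?thesis using h by (cases "h' < 4") (auto simp: table_def fld_upd)
  qed
  have ch: "choice_ok k l r i ?M"
    unfolding choice_ok_def tab
  proof (intro allI impI)
    fix z h' assume zh: "(z, h') \<in> table ?M i"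
    show "\<exists>x f y g. (f, g, h') \<in> set (flag_combos k) \<and> z = x + y \<and> (x, f) \<in> table M l \<and>
       (y, g) \<in> table M r \<and> fld h' ?M (i * (c + 1) + z) = 1 + (x * 22 + f) \<and>
       fld (4 + h') ?M (i * (c + 1) + z) = y * 22 + g"
    proof (cases "(z, h') = (x + y, h)")
      case True
      then show ?thesis using fgh t h
        by - (rule exI[of _ x], rule exI[of _ f], rule exI[of _ y], rule exI[of _ g], auto simp: fld_upd)
    next
      case False
      then have zh': "(z, h') \<in> table M i" using zh mono by blast
      then have "h' < 4" by (auto simp: table_def)
      then have "fld h' ?M (i * (c + 1) + z) = fld h' M (i * (c + 1) + z)"
        "fld (4 + h') ?M (i * (c + 1) + z) = fld (4 + h') M (i * (c + 1) + z)"
        using False h by (auto simp: fld_upd)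
      moreover have "\<exists>x f y g. (f, g, h') \<in> set (flag_combos k) \<and> z = x + y \<and> (x, f) \<in> table M l \<and>
       (y, g) \<in> table M r \<and> fld h' M (i * (c + 1) + z) = 1 + (x * 22 + f) \<and>
       fld (4 + h') M (i * (c + 1) + z) = y * 22 + g"
        using m zh' unfolding merging_def choice_ok_def by blast
      ultimately show ?thesis by presburger
    qed
  qed
  have "(x', f') \<in> table M l \<Longrightarrow> (y', g') \<in> table M r \<Longrightarrow> (x' + y', h') \<in> table ?M i"
    if "(x', y', f', g', h') \<in> ?D" "(f', g', h') \<in> set (flag_combos k)" "x' + y' \<le> c" for x' y' f' g' h'
  proof (cases "(x', y', f', g', h') = (x, y, f, g, h)")
    case False
    assume "(x', f') \<in> table M l" "(y', g') \<in> table M r"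
    then have "(x' + y', h') \<in> table M i" using m that False unfolding merging_def by blast
    then show ?thesis using mono by blast
  qed (use mono in auto)
  then show ?thesis unfolding merging_def tab using so ch by blast
qed

lemma merging_skip:
  assumes "merging k l r i M0 D M" "\<not> ((x, f) \<in> table M l \<and> (y, g) \<in> table M r)"
  shows "merging k l r i M0 (insert (x, y, f, g, h) D) M"
  using assms unfolding merging_def by auto

lemma wp_combo_step:
  assumes m: "merging k (reg \<sigma> ''l'') (reg \<sigma> ''r'') (reg \<sigma> ''id'') M0 D (mem \<sigma>)"
    and lr: "reg \<sigma> ''l'' < reg \<sigma> ''id''" "reg \<sigma> ''r'' < reg \<sigma> ''id''" "reg \<sigma> ''id'' < 2 * n"
    and fgh: "(f, g, h) \<in> set (flag_combos k)" and xy: "reg \<sigma> ''x'' + reg \<sigma> ''y'' \<le> c"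
  shows "wp (combo_step (f, g, h)) (\<lambda>\<tau>. reg \<tau> = reg \<sigma> \<and> merging k (reg \<sigma> ''l'') (reg \<sigma> ''r'')
    (reg \<sigma> ''id'') M0 (insert (reg \<sigma> ''x'', reg \<sigma> ''y'', f, g, h) D) (mem \<tau>)) \<sigma>"
proof -
  have h: "h < 4" "f < 4" "g < 4" using flag_combos_less[OF fgh] by auto
  have le: "reg \<sigma> ''x'' * 22 + f < W" "reg \<sigma> ''y'' * 22 + g \<le> W" "reg \<sigma> ''x'' * 22 \<le> W" "reg \<sigma> ''y'' * 22 \<le> W"
    "reg \<sigma> ''x'' + reg \<sigma> ''y'' \<le> W" "f \<le> W" "g \<le> W"
    using xy h c_less_NI W_big by auto
  have fit: "fits q (e * (c + 1) + x)" if "e < 2 * n" "x \<le> c" "q < 22" for q e x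
    using row_less[OF that(1,2)] that(3) by (rule fitsI)
  have tab: "(x, q) \<in> table M e \<longleftrightarrow> 0 < fld q M (e * (c + 1) + x)" if "q < 4" "x \<le> c" for q x M e
    using that by (simp add: table_def)
  show ?thesis
    using merging_store[OF m lr(1,2) fgh xy] merging_skip[OF m, of "reg \<sigma> ''x''" f "reg \<sigma> ''y''" g h]
      lr xy le h fit tab
    by (auto simp: combo_step_def)
qed

lemma wp_combo_steps:
  assumes "merging k (reg \<sigma> ''l'') (reg \<sigma> ''r'') (reg \<sigma> ''id'') M0 D (mem \<sigma>)"
    "reg \<sigma> ''l'' < reg \<sigma> ''id''" "reg \<sigma> ''r'' < reg \<sigma> ''id''" "reg \<sigma> ''id'' < 2 * n"
    "set fs \<subseteq> set (flag_combos k)" "reg \<sigma> ''x'' + reg \<sigma> ''y'' \<le> c"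
  shows "wp (seqs (map combo_step fs)) (\<lambda>\<tau>. reg \<tau> = reg \<sigma> \<and> merging k (reg \<sigma> ''l'') (reg \<sigma> ''r'')
    (reg \<sigma> ''id'') M0 ({(reg \<sigma> ''x'', reg \<sigma> ''y'', f, g, h) | f g h. (f, g, h) \<in> set fs} \<union> D) (mem \<tau>)) \<sigma>"
  using assms
proof (induction fs arbitrary: \<sigma> D)
  case (Cons a fs)
  obtain f g h where a: "a = (f, g, h)" by (cases a) auto
  have 1: "wp (combo_step a) (\<lambda>\<tau>. reg \<tau> = reg \<sigma> \<and> merging k (reg \<sigma> ''l'') (reg \<sigma> ''r'')
    (reg \<sigma> ''id'') M0 (insert (reg \<sigma> ''x'', reg \<sigma> ''y'', f, g, h) D) (mem \<tau>)) \<sigma>"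
    unfolding a by (rule wp_combo_step) (use Cons.prems a in auto)
  have eq: "{(x, y, f', g', h') | f' g' h'. (f', g', h') \<in> set fs} \<union> insert (x, y, f, g, h) D =
    {(x, y, f', g', h') | f' g' h'. (f', g', h') \<in> set (a # fs)} \<union> D" for x y :: nat
    by (auto simp: a)
  show ?case
    unfolding list.map seqs.simps wp.simps
  proof (rule wp_mono[OF 1])
    fix \<tau> :: state assume t: "reg \<tau> = reg \<sigma> \<and> merging k (reg \<sigma> ''l'') (reg \<sigma> ''r'')
      (reg \<sigma> ''id'') M0 (insert (reg \<sigma> ''x'', reg \<sigma> ''y'', f, g, h) D) (mem \<tau>)"
    show "wp (seqs (map combo_step fs)) (\<lambda>\<tau>. reg \<tau> = reg \<sigma> \<and> merging k (reg \<sigma> ''l'') (reg \<sigma> ''r'')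
      (reg \<sigma> ''id'') M0 ({(reg \<sigma> ''x'', reg \<sigma> ''y'', f, g, h) | f g h. (f, g, h) \<in> set (a # fs)} \<union> D) (mem \<tau>)) \<tau>"
      using Cons.IH[of \<tau> "insert (reg \<sigma> ''x'', reg \<sigma> ''y'', f, g, h) D"] Cons.prems t
      unfolding eq[symmetric] by simp
  qed
qed simp

text \<open>Covers both kinds of composition and depends on the program text alone, not on the
  instance; 100 pays for the control of the loop.\<close>

definition merge_cost :: nat where
  "merge_cost = 100 + prog_cost (combo_steps False) + prog_cost (combo_steps True)"

lemma runs_merge_inner:
  assumes m: "merging k l r i M0 {(x, y, f, g, h). x < X} (mem \<sigma>)"
    and "reg \<sigma> = R(''x'' := X, ''y'' := 0)" "R ''l'' = l" "R ''r'' = r" "R ''id'' = i"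
    and lr: "l < i" "r < i" "i < 2 * n" and X: "X \<le> c"
  shows "runs (merge_inner k) \<sigma> ((c + 2) * merge_cost) (\<lambda>\<tau>.
    (\<exists>y. reg \<tau> = R(''x'' := X, ''y'' := y)) \<and> merging k l r i M0 {(x, y, f, g, h). x < X + 1} (mem \<tau>))"
proof -
  define I where "I \<tau> \<longleftrightarrow> (\<exists>Y. reg \<tau> = R(''x'' := X, ''y'' := Y) \<and> Y \<le> c + 1 \<and>
    merging k l r i M0 {(x, y, f, g, h). x < X \<or> x = X \<and> y < Y} (mem \<tau>))" for \<tau> :: state
  have cN: "c + 1 < W" using c_less_NI W_big by auto
  \<comment> \<open>Combinations with \<open>x + y > c\<close> may be added to \<open>D\<close> for
    free. Leaving the inner loop at the first of them therefore settles all larger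
    \<open>y\<close>.\<close>
  have mono: "merging k l r i M0 D' M" if "merging k l r i M0 D M"
    "\<And>x y f g h. (x, y, f, g, h) \<in> D' \<Longrightarrow> x + y \<le> c \<Longrightarrow> (f, g, h) \<in> set (flag_combos k) \<Longrightarrow> (x, y, f, g, h) \<in> D" for D D' M
    using that unfolding merging_def by blast
  show ?thesis
    unfolding merge_inner_def
  proof (rule runs_While[where I = I and \<mu> = "\<lambda>\<tau>. c + 1 - reg \<tau> ''y''" and T = "prog_cost (combo_steps k) + 4"])
    show "I \<sigma>" unfolding I_def using assms by (intro exI[of _ 0]) simp
  next
    fix \<tau> :: state assume "I \<tau>"
    then show "safe_test \<tau> (Less (Plus rx ry) (Plus inC (Const 1)))"
      using cN X W_big c_less_NI by (auto simp: I_def)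
  next
    fix \<tau> :: state assume I: "I \<tau>" and "holds inp \<tau> (Less (Plus rx ry) (Plus inC (Const 1)))"
    then obtain Y where Y: "reg \<tau> = R(''x'' := X, ''y'' := Y)" "X + Y \<le> c"
      "merging k l r i M0 {(x, y, f, g, h). x < X \<or> x = X \<and> y < Y} (mem \<tau>)"
      by (auto simp: I_def)
    have regs: "reg \<tau> ''l'' = l" "reg \<tau> ''r'' = r" "reg \<tau> ''id'' = i" "reg \<tau> ''x'' = X" "reg \<tau> ''y'' = Y"
      using Y(1) assms(3-5) by auto
    have "wp (combo_steps k) (\<lambda>\<tau>'. reg \<tau>' = reg \<tau> \<and> merging k l r i M0
        ({(X, Y, f, g, h) | f g h. (f, g, h) \<in> set (flag_combos k)} \<union> {(x, y, f, g, h). x < X \<or> x = X \<and> y < Y}) (mem \<tau>')) \<tau>"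
      using wp_combo_steps[of k \<tau> M0 _ "flag_combos k"] Y lr unfolding combo_steps_def regs by simp
    then have "wp (combo_steps k) (wp (Assign ''y'' (Plus ry (Const 1)))
        (\<lambda>\<tau>'. I \<tau>' \<and> c + 1 - reg \<tau>' ''y'' < c + 1 - reg \<tau> ''y'')) \<tau>"
    proof (rule wp_mono)
      fix \<rho> :: state assume r: "reg \<rho> = reg \<tau> \<and> merging k l r i M0
        ({(X, Y, f, g, h) | f g h. (f, g, h) \<in> set (flag_combos k)} \<union> {(x, y, f, g, h). x < X \<or> x = X \<and> y < Y}) (mem \<rho>)"
      then have "merging k l r i M0 {(x, y, f, g, h). x < X \<or> x = X \<and> y < Y + 1} (mem \<rho>)"
        by (elim conjE) (erule mono, auto)
      moreover have "reg \<rho> = R(''x'' := X, ''y'' := Y)" using r Y by simp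
      ultimately show "wp (Assign ''y'' (Plus ry (Const 1)))
          (\<lambda>\<tau>'. I \<tau>' \<and> c + 1 - reg \<tau>' ''y'' < c + 1 - reg \<tau> ''y'') \<rho>"
        using Y cN unfolding wp.simps by (auto simp: I_def intro!: exI[of _ "Y + 1"])
    qed
    then show "runs (Seq (combo_steps k) (Assign ''y'' (Plus ry (Const 1)))) \<tau> (prog_cost (combo_steps k) + 4)
        (\<lambda>\<tau>'. I \<tau>' \<and> c + 1 - reg \<tau>' ''y'' < c + 1 - reg \<tau> ''y'')"
      by (intro runs_wp) auto
  next
    fix \<tau> :: state assume "I \<tau>" and "\<not> holds inp \<tau> (Less (Plus rx ry) (Plus inC (Const 1)))"
    then obtain Y where Y: "reg \<tau> = R(''x'' := X, ''y'' := Y)" "\<not> X + Y \<le> c"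
      "merging k l r i M0 {(x, y, f, g, h). x < X \<or> x = X \<and> y < Y} (mem \<tau>)"
      by (auto simp: I_def)
    then have "merging k l r i M0 {(x, y, f, g, h). x < X + 1} (mem \<tau>)"
      by (intro mono[OF Y(3)]) auto
    then show "(\<exists>y. reg \<tau> = R(''x'' := X, ''y'' := y)) \<and> merging k l r i M0 {(x, y, f, g, h). x < X + 1} (mem \<tau>)"
      using Y by blast
  next
    have "prog_cost (combo_steps k) + 20 \<le> merge_cost" unfolding merge_cost_def by (cases k) auto
    then have "(c + 1 - reg \<sigma> ''y'' + 1) * (1 + test_cost (Less (Plus rx ry) (Plus inC (Const 1))) +
        (prog_cost (combo_steps k) + 4)) \<le> (c + 2) * merge_cost"
      using assms(2) by (intro mult_le_mono) auto
    then show "(c + 1 - reg \<sigma> ''y'' + 1) * (1 + test_cost (Less (Plus rx ry) (Plus inC (Const 1))) +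
        (prog_cost (combo_steps k) + 4)) \<le> (c + 2) * merge_cost" .
  qed
qed

text \<open>The table of a fresh number is empty, so the invariant holds at first with no
  combination treated; at the end soundness and completeness determine the table.\<close>

lemma runs_merge_tables:
  assumes "reg \<sigma> ''l'' = l" "reg \<sigma> ''r'' = r" "reg \<sigma> ''id'' = i" "mem \<sigma> = M0"
    and lr: "l < i" "r < i" "i < 2 * n" and empty: "table M0 i = {}"
  shows "runs (merge_tables k) \<sigma> ((c + 2) * ((c + 2) * merge_cost + 30) + 10) (\<lambda>\<tau>.
    (\<exists>x y. reg \<tau> = (reg \<sigma>)(''x'' := x, ''y'' := y)) \<and> same_outside i M0 (mem \<tau>) \<and> choice_ok k l r i (mem \<tau>) \<and>
    table (mem \<tau>) i = {(x + y, h) | x y f g h. x + y \<le> c \<and> (x, f) \<in> table M0 l \<and> (y, g) \<in> table M0 r \<and>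
      (f, g, h) \<in> set (flag_combos k)})"
proof -
  define I where "I \<tau> \<longleftrightarrow> (\<exists>X Y. reg \<tau> = (reg \<sigma>)(''x'' := X, ''y'' := Y) \<and> X \<le> c + 1 \<and>
    merging k l r i M0 {(x, y, f, g, h). x < X} (mem \<tau>))" for \<tau> :: state
  have cN: "c + 1 < W" using c_less_NI W_big by auto
  let ?T = "(c + 2) * merge_cost + 10"
  have I0: "I (\<sigma>\<lparr>reg := (reg \<sigma>)(''x'' := 0)\<rparr>)"
  proof -
    have "merging k l r i M0 {} M0"
      unfolding merging_def choice_ok_def same_outside_def empty by auto
    then have "merging k l r i M0 {(x, y, f, g, h). x < 0} (mem \<sigma>)"
      using assms(4) by (simp add: case_prod_unfold)
    moreover have "(reg \<sigma>)(''x'' := 0) = (reg \<sigma>)(''x'' := 0, ''y'' := reg \<sigma> ''y'')"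
      by (auto simp: fun_eq_iff)
    ultimately show ?thesis unfolding I_def
      by - (rule exI[of _ 0], rule exI[of _ "reg \<sigma> ''y''"], simp)
  qed
  show ?thesis
    unfolding merge_tables_def
  proof (rule runs_Seq_wp[where ?T2.0 = "(c + 2) * (8 + ?T)"])
    show "wp (Assign ''x'' (Const 0)) (\<lambda>\<tau>. runs (While (Less rx (Plus inC (Const 1)))
       (Seq (Assign ''y'' (Const 0)) (Seq (merge_inner k) (Assign ''x'' (Plus rx (Const 1))))))
      \<tau> ((c + 2) * (8 + ?T)) (\<lambda>\<tau>. (\<exists>x y. reg \<tau> = (reg \<sigma>)(''x'' := x, ''y'' := y)) \<and>
        same_outside i M0 (mem \<tau>) \<and> choice_ok k l r i (mem \<tau>) \<and>
        table (mem \<tau>) i = {(x + y, h) | x y f g h. x + y \<le> c \<and> (x, f) \<in> table M0 l \<and> (y, g) \<in> table M0 r \<and>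
          (f, g, h) \<in> set (flag_combos k)})) \<sigma>"
      unfolding wp.simps safe.simps eval.simps
    proof (intro conjI, simp, rule runs_While[where I = I and \<mu> = "\<lambda>\<tau>. c + 1 - reg \<tau> ''x''" and T = ?T])
      show "I (\<sigma>\<lparr>reg := (reg \<sigma>)(''x'' := 0)\<rparr>)" by (rule I0)
    next
      fix \<tau> :: state assume "I \<tau>"
      show "safe_test \<tau> (Less rx (Plus inC (Const 1)))" using cN by simp
    next
      fix \<tau> :: state assume I: "I \<tau>" and h: "holds inp \<tau> (Less rx (Plus inC (Const 1)))"
      then obtain X Y where X: "reg \<tau> = (reg \<sigma>)(''x'' := X, ''y'' := Y)" "X \<le> c"
        "merging k l r i M0 {(x, y, f, g, h). x < X} (mem \<tau>)"
        by (auto simp: I_def)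
      show "runs (Seq (Assign ''y'' (Const 0)) (Seq (merge_inner k) (Assign ''x'' (Plus rx (Const 1))))) \<tau> ?T
        (\<lambda>\<tau>'. I \<tau>' \<and> c + 1 - reg \<tau>' ''x'' < c + 1 - reg \<tau> ''x'')"
      proof (rule runs_Seq_wp[where ?T2.0 = "(c + 2) * merge_cost + 4"])
        show "wp (Assign ''y'' (Const 0)) (\<lambda>\<tau>'. runs (Seq (merge_inner k) (Assign ''x'' (Plus rx (Const 1)))) \<tau>'
          ((c + 2) * merge_cost + 4) (\<lambda>\<tau>'. I \<tau>' \<and> c + 1 - reg \<tau>' ''x'' < c + 1 - reg \<tau> ''x'')) \<tau>"
          unfolding wp.simps safe.simps eval.simps
        proof (intro conjI, simp, rule runs_Seq_post[OF runs_merge_inner[where R = "reg \<sigma>"]])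
          show "merging k l r i M0 {(x, y, f, g, h). x < X} (mem (\<tau>\<lparr>reg := (reg \<tau>)(''y'' := 0)\<rparr>))"
            using X by simp
          show "reg (\<tau>\<lparr>reg := (reg \<tau>)(''y'' := 0)\<rparr>) = (reg \<sigma>)(''x'' := X, ''y'' := 0)" using X by simp
        next
          fix \<rho> :: state assume "(\<exists>y. reg \<rho> = (reg \<sigma>)(''x'' := X, ''y'' := y)) \<and>
            merging k l r i M0 {(x, y, f, g, h). x < X + 1} (mem \<rho>)"
          then obtain y where y: "reg \<rho> = (reg \<sigma>)(''x'' := X, ''y'' := y)"
            "merging k l r i M0 {(x, y, f, g, h). x < X + 1} (mem \<rho>)" by blast
          have r: "((reg \<sigma>)(''x'' := X, ''y'' := y))(''x'' := X + 1) = (reg \<sigma>)(''x'' := X + 1, ''y'' := y)"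
            by (auto simp: fun_eq_iff)
          have "I (\<rho>\<lparr>reg := (reg \<rho>)(''x'' := X + 1)\<rparr>)"
            unfolding I_def using y X(2) r by - (rule exI[of _ "X + 1"], rule exI[of _ y], simp)
          then show "runs (Assign ''x'' (Plus rx (Const 1))) \<rho> 4
              (\<lambda>\<tau>'. I \<tau>' \<and> c + 1 - reg \<tau>' ''x'' < c + 1 - reg \<tau> ''x'')"
            using y X cN by (intro runs_wp) auto
        qed (use assms lr X in auto)
      qed simp
    next
      fix \<tau> :: state assume I: "I \<tau>" and h: "\<not> holds inp \<tau> (Less rx (Plus inC (Const 1)))"
      then obtain Y where X: "reg \<tau> = (reg \<sigma>)(''x'' := c + 1, ''y'' := Y)"
        "merging k l r i M0 {(x, y, f, g, h). x < c + 1} (mem \<tau>)"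
        by (auto simp: I_def le_Suc_eq)
      have so: "same_outside i M0 (mem \<tau>)" and ch: "choice_ok k l r i (mem \<tau>)"
        using X(2) unfolding merging_def by auto
      have tab: "table (mem \<tau>) l = table M0 l" "table (mem \<tau>) r = table M0 r"
        using same_outside_table[OF so] lr by auto
      have "table (mem \<tau>) i = {(x + y, h) | x y f g h. x + y \<le> c \<and> (x, f) \<in> table M0 l \<and> (y, g) \<in> table M0 r \<and>
          (f, g, h) \<in> set (flag_combos k)}" (is "?L = ?R")
      proof (rule set_eqI, rule iffI)
        fix p assume p: "p \<in> ?L"
        obtain z h where zh: "p = (z, h)" by (cases p)
        have "z \<le> c" using p zh by (auto simp: table_def)
        obtain x f y g where "(f, g, h) \<in> set (flag_combos k)" "z = x + y" "(x, f) \<in> table M0 l" "(y, g) \<in> table M0 r"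
          using ch p unfolding choice_ok_def zh tab by blast
        then show "p \<in> ?R" using zh \<open>z \<le> c\<close> by blast
      next
        fix p assume "p \<in> ?R"
        then obtain x y f g h where p: "p = (x + y, h)" "x + y \<le> c" "(x, f) \<in> table M0 l" "(y, g) \<in> table M0 r"
          "(f, g, h) \<in> set (flag_combos k)" by blast
        have "(x, y, f, g, h) \<in> {(x, y, f, g, h). x < c + 1}" using p(2) by simp
        then show "p \<in> ?L" using X(2) p unfolding merging_def tab by blast
      qed
      then show "(\<exists>x y. reg \<tau> = (reg \<sigma>)(''x'' := x, ''y'' := y)) \<and> same_outside i M0 (mem \<tau>) \<and>
        choice_ok k l r i (mem \<tau>) \<and>
        table (mem \<tau>) i = {(x + y, h) | x y f g h. x + y \<le> c \<and> (x, f) \<in> table M0 l \<and> (y, g) \<in> table M0 r \<and>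
          (f, g, h) \<in> set (flag_combos k)}"
        using X so ch by blast
    next
      show "(c + 1 - reg (\<sigma>\<lparr>reg := (reg \<sigma>)(''x'' := 0)\<rparr>) ''x'' + 1) *
          (1 + test_cost (Less rx (Plus inC (Const 1))) + ?T) \<le> (c + 2) * (8 + ?T)"
        by (intro mult_le_mono) auto
    qed
  next
    have "(c + 2) * (8 + ?T) \<le> (c + 2) * ((c + 2) * merge_cost + 30)" by (intro mult_le_mono) auto
    then show "prog_cost (Assign ''x'' (Const 0)) + (c + 2) * (8 + ?T) \<le> (c + 2) * ((c + 2) * merge_cost + 30) + 10"
      by simp
  qed
qed

end

section \<open>The reduction\<close>

lemma ttsp_into_node:
  "ttsp org dst E s t \<Longrightarrow> x \<in> ends org dst E \<Longrightarrow> x \<noteq> s \<Longrightarrow> \<exists>e\<in>E. dst e = x"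
proof (induction rule: ttsp.induct)
  case (ser E1 s x' E2 t)
  show ?case
  proof (cases "x \<in> ends org dst E1")
    case True
    then show ?thesis using ser by blast
  next
    case False
    then have "x \<in> ends org dst E2" "x \<noteq> x'" using ser.prems ttsp_sink[OF ser.hyps(1)] by auto
    then show ?thesis using ser by blast
  qed
next
  case (par E1 s t E2)
  then show ?case by auto
qed auto

text \<open>The nodes in \<open>D\<close> are finished, \<open>v\<close> is the current one. Its in-edges still to be
  handled are \<open>inl v\<close>, its out-edges still to be moved to the in-list of their head are
  \<open>outl v\<close>, and \<open>st\<close> are the nodes all of whose in-edges are known. \<open>id\<close> is the next free edge
  number. References in \<open>acc\<close> and \<open>pe\<close> are shifted by one, 0 meaning none.\<close>

locale graph_state =
  fixes n :: nat and org dst :: "nat \<Rightarrow> nat" and M D :: "nat set" and v :: nat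
    and inl outl :: "nat \<Rightarrow> nat list" and st :: "nat list" and i :: nat
    and od pend acc pe :: "nat \<Rightarrow> nat"
  assumes sp: "ttsp org dst M (n + 1) 0"
    and M_less: "\<And>e. e \<in> M \<Longrightarrow> e < i"
    and card_M: "card M + i = 2 * n"
    and i_ge: "n \<le> i"
    and nodes_le: "\<And>e. e \<in> M \<Longrightarrow> org e \<le> n + 1 \<and> dst e \<le> n + 1"
    and v_le: "v \<le> n + 1"
    and out_todo: "\<And>x. x \<notin> insert v D \<Longrightarrow> set (outl x) = {e \<in> M. org e = x}"
    and out_done: "\<And>x. x \<in> D \<Longrightarrow> outl x = []"
    and out_cur: "set (outl v) \<subseteq> {e \<in> M. org e = v}"
    and out_dist: "\<And>x. distinct (outl x)"
    and in_todo: "\<And>w. w \<notin> insert v D \<Longrightarrow>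
      set (inl w) = {e \<in> M. dst e = w \<and> org e \<in> insert v D \<and> e \<notin> set (outl (org e))}"
    and in_done: "\<And>w. w \<in> D \<Longrightarrow> inl w = []"
    and in_cur: "set (inl v) \<subseteq> {e \<in> M. dst e = v}"
    and in_phase: "inl v \<noteq> [] \<Longrightarrow> set (outl v) = {e \<in> M. org e = v}"
    and in_dist: "\<And>w. distinct (inl w)"
    and pend_card: "\<And>w. w \<notin> insert v D \<Longrightarrow>
      pend w = card {e \<in> M. dst e = w \<and> (org e \<notin> insert v D \<or> e \<in> set (outl (org e)))}"
    and od_card: "\<And>e. e \<in> M \<Longrightarrow> od (org e) = card {e' \<in> M. org e' = org e}"
    and settled_acc: "\<And>e. e \<in> M \<Longrightarrow> dst e = v \<Longrightarrow> e \<notin> set (inl v) \<Longrightarrow> acc (org e) = e + 1"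
    and acc_live: "\<And>u a. acc u = a + 1 \<Longrightarrow> dst a = v \<Longrightarrow> a \<in> M \<and> org a = u \<and> a \<notin> set (inl v)"
    and acc_old: "\<And>u a. acc u = a + 1 \<Longrightarrow> dst a \<in> insert v D \<and> a < i"
    and pe_edge: "\<And>e. e \<in> M \<Longrightarrow> dst e \<in> D \<or> dst e = v \<and> inl v = [] \<Longrightarrow> pe (dst e) = e + 1"
    and settled: "\<And>e. e \<in> M \<Longrightarrow> dst e \<in> insert v D \<Longrightarrow> e \<notin> set (inl v) \<Longrightarrow>
      org e = n + 1 \<or> (\<exists>e'\<in>M. e' \<noteq> e \<and> org e' = org e)"
    and closed: "\<And>e. e \<in> M \<Longrightarrow> dst e \<in> insert v D \<Longrightarrow> org e \<in> D"
    and v_notin: "v \<notin> D"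
    and src_in: "n + 1 \<in> insert v D"
    and stack: "set st = {w. w \<notin> insert v D \<and> (\<exists>e\<in>M. dst e = w) \<and>
      (\<forall>e\<in>M. dst e = w \<longrightarrow> org e \<in> insert v D \<and> e \<notin> set (outl (org e)))}"
    and st_dist: "distinct st"
begin

text \<open>A potential for the number of steps. A reduction removes an edge, settling and
  distributing lower the second and third summand, and moving to the next node lowers the last; no
  step raises a summand. As it starts linear in \<open>n\<close>, so is the number of steps.\<close>

definition rest_work :: nat where
  "rest_work = card M + card {e \<in> M. dst e \<notin> insert v D \<or> e \<in> set (inl v)} +
     card {e \<in> M. org e \<notin> insert v D \<or> e \<in> set (outl (org e))} + card ({..n + 1} - insert v D)"

lemma finite_M: "finite M"
  using sp by (rule ttsp_finite)

lemma i_notin: "i \<notin> M"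
  using M_less by blast

lemma out_list: "e \<in> set (outl x) \<Longrightarrow> e \<in> M \<and> org e = x"
proof -
  assume e: "e \<in> set (outl x)"
  consider "x = v" | "x \<notin> insert v D" | "x \<in> D" by blast
  then show ?thesis using e out_todo[of x] out_done[of x] out_cur by cases auto
qed

lemma in_list: "e \<in> set (inl w) \<Longrightarrow> e \<in> M \<and> dst e = w \<and> e \<notin> set (outl x)"
proof -
  assume e: "e \<in> set (inl w)"
  have out: "e \<in> set (outl x) \<Longrightarrow> org e = x" using out_list by blast
  consider "w = v" | "w \<notin> insert v D" | "w \<in> D" by blast
  then show ?thesis
  proof cases
    case 1
    then have "e \<in> M" "dst e = v" using e in_cur by blast+
    then have "outl (org e) = []" using closed[of e] out_done by simp
    then show ?thesis using \<open>e \<in> M\<close> \<open>dst e = v\<close> 1 out by auto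
  next
    case 2
    then show ?thesis using e in_todo[of w] out by auto
  next
    case 3
    then show ?thesis using e in_done by simp
  qed
qed

lemma pop_in:
  assumes "inl v = e # es"
  shows "e \<in> M" "dst e = v" "org e \<in> D" "org e \<noteq> v" "e \<notin> set es" "outl (org e) = []"
    "\<And>e'. e' \<in> set es \<Longrightarrow> e' \<in> M \<and> dst e' = v"
proof -
  show 1: "e \<in> M" "dst e = v" using in_list[of e v] assms by auto
  show 2: "org e \<in> D" using closed[OF 1(1)] 1(2) by simp
  then show "org e \<noteq> v" using v_notin by auto
  show "e \<notin> set es" using in_dist[of v] assms by simp
  show "outl (org e) = []" using 2 by (rule out_done)
  show "\<And>e'. e' \<in> set es \<Longrightarrow> e' \<in> M \<and> dst e' = v" using in_list[of _ v] assms by auto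
qed

text \<open>A finished node other than the source has a single in-edge, and \<open>pe\<close> finds
  it. So the out-degree is all that a series reduction has to check.\<close>

lemma pe_pred:
  assumes "e \<in> M" "org e \<in> D" "org e \<noteq> n + 1"
  obtains p where "p \<in> M" "dst p = org e" "pe (org e) = p + 1" "org p \<in> D"
    "\<And>q. q \<in> M \<Longrightarrow> dst q = org e \<Longrightarrow> q = p"
proof -
  have "org e \<in> ends org dst M" using assms(1) by (simp add: ends_def)
  then obtain p where p: "p \<in> M" "dst p = org e" using ttsp_into_node[OF sp] assms(3) by blast
  have q: "pe (org e) = q + 1" if "q \<in> M" "dst q = org e" for q using pe_edge[of q] that assms(2) by simp
  show ?thesis
  proof (rule that[OF p q[OF p]])
    show "org p \<in> D" using closed[OF p(1)] p(2) assms(2) by simp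
    fix q' assume "q' \<in> M" "dst q' = org e"
    then show "q' = p" using q[of q'] q[OF p] by simp
  qed
qed

text \<open>An edge \<open>g\<close> that leaves a finished node and enters \<open>v\<close> replaces two edges. Both kinds of
  reduction are of this form.\<close>

lemma replace:
  assumes inv: "inl v = e # es"
    and p: "p \<in> M" "p \<noteq> e" "org p \<in> D" "dst p \<in> insert v D" "p \<notin> set (inl v)"
    and sp': "ttsp (org(i := org p)) (dst(i := v)) (insert i (M - {p, e})) (n + 1) 0"
    and od'_card: "\<And>e'. e' \<in> insert i (M - {p, e}) \<Longrightarrow> od' ((org(i := org p)) e') =
      card {a \<in> insert i (M - {p, e}). (org(i := org p)) a = (org(i := org p)) e'}"
    and acc_p: "dst p = v \<Longrightarrow> acc' = acc(org p := 0)" "dst p \<noteq> v \<Longrightarrow> acc' = acc"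
    and only: "\<And>a. a \<in> M \<Longrightarrow> org a = org e \<Longrightarrow> a = e \<or> org e = org p"
  shows "graph_state n (org(i := org p)) (dst(i := v)) (insert i (M - {p, e})) D v
      (inl(v := i # es)) outl st (i + 1) od' pend acc' pe"
    and "graph_state.rest_work n (org(i := org p)) (dst(i := v)) (insert i (M - {p, e})) D v
      (inl(v := i # es)) outl < rest_work"
proof -
  let ?org = "org(i := org p)" and ?dst = "dst(i := v)" and ?M = "insert i (M - {p, e})"
    and ?inl = "inl(v := i # es)"
  note e = pop_in[OF inv]
  have ip: "i \<noteq> p" "i \<noteq> e" using i_notin p(1) e(1) by auto
  have es_i: "i \<notin> set es" using e(7) i_notin by blast
  have card: "card ?M + 1 = card M"
  proof -
    have "card {p, e} \<le> card M" using p e finite_M by (intro card_mono) auto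
    then have "card (M - {p, e}) + 2 = card M" using p e finite_M by (simp add: card_Diff_subset)
    then show ?thesis using finite_M i_notin by simp
  qed
  have org_M: "a \<in> M \<Longrightarrow> ?org a = org a" "a \<in> M \<Longrightarrow> ?dst a = dst a" for a using i_notin by auto
  have outl_p: "outl (org p) = []" using p(3) by (rule out_done)
  \<comment> \<open>\<open>p\<close>, \<open>e\<close> and the new edge all leave finished nodes,
    and none of them enters a node still to be visited. Hence lists and counters of the unvisited
    nodes stay correct.\<close>
  have far_out: "{a \<in> ?M. ?org a = x} = {a \<in> M. org a = x}" if "x \<notin> D" for x
    using that p(3) e(3) i_notin by auto
  have far_in: "{a \<in> ?M. ?dst a = w \<and> P (?org a) a} = {a \<in> M. dst a = w \<and> P (org a) a}"
    if "w \<notin> insert v D" for w P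
    using that p(4) e(2) i_notin by auto
  show "graph_state n ?org ?dst ?M D v ?inl outl st (i + 1) od' pend acc' pe"
  proof
    show "ttsp ?org ?dst ?M (n + 1) 0" by (rule sp')
    show "e' < i + 1" if "e' \<in> ?M" for e' using that M_less[of e'] by auto
    show "card ?M + (i + 1) = 2 * n" using card card_M by simp
    show "n \<le> i + 1" using i_ge by simp
    show "?org e' \<le> n + 1 \<and> ?dst e' \<le> n + 1" if "e' \<in> ?M" for e'
      using that nodes_le[of e'] nodes_le[OF p(1)] v_le by auto
    show "v \<le> n + 1" by (rule v_le)
    show "set (outl x) = {e \<in> ?M. ?org e = x}" if "x \<notin> insert v D" for x
      using that out_todo[OF that] far_out[of x] by simp
    show "outl x = []" if "x \<in> D" for x using that by (rule out_done)
    show "set (outl v) \<subseteq> {e \<in> ?M. ?org e = v}" using out_cur far_out[OF v_notin] by simp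
    show "distinct (outl x)" for x by (rule out_dist)
    show "set (?inl w) = {e \<in> ?M. ?dst e = w \<and> ?org e \<in> insert v D \<and> e \<notin> set (outl (?org e))}"
      if "w \<notin> insert v D" for w
      using in_todo[OF that] far_in[OF that, of "\<lambda>u a. u \<in> insert v D \<and> a \<notin> set (outl u)"] that by simp
    show "?inl w = []" if "w \<in> D" for w using that in_done v_notin by auto
    show "set (?inl v) \<subseteq> {e \<in> ?M. ?dst e = v}"
      using e(5,7) p(5) inv i_notin by auto
    show "set (outl v) = {e \<in> ?M. ?org e = v}" using in_phase inv far_out[OF v_notin] by simp
    show "distinct (?inl w)" for w using in_dist[of w] in_dist[of v] inv es_i by simp
    show "pend w = card {e \<in> ?M. ?dst e = w \<and> (?org e \<notin> insert v D \<or> e \<in> set (outl (?org e)))}"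
      if "w \<notin> insert v D" for w
      using pend_card[OF that] far_in[OF that, of "\<lambda>u a. u \<notin> insert v D \<or> a \<in> set (outl u)"] by simp
    show "od' (?org e') = card {a \<in> ?M. ?org a = ?org e'}" if "e' \<in> ?M" for e'
      using that by (rule od'_card)
    have acc'_D: "acc' u = a + 1 \<Longrightarrow> acc u = a + 1" for u a
      using acc_p by (cases "dst p = v") (auto split: if_splits)
    show acc_old': "?dst a \<in> insert v D \<and> a < i + 1" if "acc' u = a + 1" for u a
      using acc_old[OF acc'_D[OF that]] by auto
    show "acc' (?org e') = e' + 1" if e': "e' \<in> ?M" "?dst e' = v" "e' \<notin> set (?inl v)" for e'
    proof -
      have 1: "e' \<in> M" "e' \<noteq> p" "e' \<noteq> e" "dst e' = v" "e' \<notin> set (inl v)" using e' inv by auto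
      then have 2: "acc (org e') = e' + 1" by (intro settled_acc)
      show ?thesis
      \<comment> \<open>If \<open>p\<close> enters \<open>v\<close>, it is settled itself and owns
        the entry of \<open>acc\<close> at its tail, so clearing that entry affects no other settled
        edge.\<close>
      proof (cases "dst p = v")
        case True
        have "acc (org p) = p + 1" using p True by (intro settled_acc) auto
        then have "org e' \<noteq> org p" using 2 1(2) by auto
        then show ?thesis using acc_p(1)[OF True] 2 org_M(1)[OF 1(1)] by simp
      next
        case False
        then show ?thesis using acc_p(2) 2 org_M(1)[OF 1(1)] by simp
      qed
    qed
    show "a \<in> ?M \<and> ?org a = u \<and> a \<notin> set (?inl v)" if a: "acc' u = a + 1" "?dst a = v" for u a
    proof -
      have 1: "acc u = a + 1" using acc'_D a by simp
      then have "a < i" using acc_old by blast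
      then have 2: "a \<in> M" "org a = u" "a \<notin> set (inl v)" using acc_live[OF 1] a(2) by auto
      have "a \<noteq> p"
      proof
        assume "a = p"
        then have "dst p = v" using a(2) ip by simp
        then show False using acc_p(1) a(1) 2(2) \<open>a = p\<close> by simp
      qed
      then show ?thesis using 2 inv i_notin by auto
    qed
    show "pe (?dst e') = e' + 1" if e': "e' \<in> ?M" "?dst e' \<in> D \<or> ?dst e' = v \<and> ?inl v = []" for e'
    proof -
      have "?dst e' \<in> D" using e' by simp
      then have "e' \<noteq> i" using v_notin by auto
      then show ?thesis using e' \<open>?dst e' \<in> D\<close> pe_edge[of e'] by auto
    qed
    show "?org e' = n + 1 \<or> (\<exists>e''\<in>?M. e'' \<noteq> e' \<and> ?org e'' = ?org e')"
      if e': "e' \<in> ?M" "?dst e' \<in> insert v D" "e' \<notin> set (?inl v)" for e'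
    proof -
      have 1: "e' \<in> M" "e' \<noteq> p" "e' \<noteq> e" "e' \<noteq> i" "e' \<notin> set (inl v)" using e' inv by auto
      then have "org e' = n + 1 \<or> (\<exists>e''\<in>M. e'' \<noteq> e' \<and> org e'' = org e')"
        using settled[of e'] e'(2) by auto
      then show ?thesis
      proof
        assume "\<exists>e''\<in>M. e'' \<noteq> e' \<and> org e'' = org e'"
        then obtain e'' where 2: "e'' \<in> M" "e'' \<noteq> e'" "org e'' = org e'" by blast
        show ?thesis
        \<comment> \<open>A sibling that vanishes is replaced by the new edge, which starts at
          \<open>org p\<close>. By \<open>only\<close>, \<open>e\<close> leaves a sibling behind
          only if it has the same tail as \<open>p\<close>.\<close>
        proof (cases "e'' \<in> {p, e}")
          case True
          then have "org e' = org p" using 2 only[of e'] 1 by auto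
          then show ?thesis using 1 by (intro disjI2 bexI[of _ i]) auto
        next
          case False
          then show ?thesis using 2 1 i_notin by (intro disjI2 bexI[of _ e'']) auto
        qed
      qed (use 1 in auto)
    qed
    show "?org e' \<in> D" if "e' \<in> ?M" "?dst e' \<in> insert v D" for e'
      using that closed[of e'] p(3) by (cases "e' = i") auto
    show "v \<notin> D" by (rule v_notin)
    show "n + 1 \<in> insert v D" by (rule src_in)
    show "distinct st" by (rule st_dist)
    show "set st = {w. w \<notin> insert v D \<and> (\<exists>e\<in>?M. ?dst e = w) \<and>
      (\<forall>e\<in>?M. ?dst e = w \<longrightarrow> ?org e \<in> insert v D \<and> e \<notin> set (outl (?org e)))}"
    proof -
      have "(\<exists>e\<in>?M. ?dst e = w) \<longleftrightarrow> (\<exists>e\<in>M. dst e = w)" if "w \<notin> insert v D" for w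
        using far_in[OF that, of "\<lambda>_ _. True"] by blast
      moreover have "(\<forall>e\<in>?M. ?dst e = w \<longrightarrow> ?org e \<in> insert v D \<and> e \<notin> set (outl (?org e))) \<longleftrightarrow>
          (\<forall>e\<in>M. dst e = w \<longrightarrow> org e \<in> insert v D \<and> e \<notin> set (outl (org e)))" if "w \<notin> insert v D" for w
        using far_in[OF that, of "\<lambda>u a. \<not> (u \<in> insert v D \<and> a \<notin> set (outl u))"] by blast
      ultimately show ?thesis unfolding stack by blast
    qed
  qed
  then interpret new: graph_state n ?org ?dst ?M D v ?inl outl st "i + 1" od' pend acc' pe .
  \<comment> \<open>The new edge takes the place of \<open>e\<close> in the in-list and has nothing
    to be distributed, so only the number of edges changes.\<close>
  have S: "{a \<in> ?M. ?org a \<notin> insert v D \<or> a \<in> set (outl (?org a))} =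
      {a \<in> M. org a \<notin> insert v D \<or> a \<in> set (outl (org a))}"
    using p(3) e(3,6) outl_p i_notin by auto
  have C: "card {a \<in> ?M. ?dst a \<notin> insert v D \<or> a \<in> set (?inl v)} =
      card {a \<in> M. dst a \<notin> insert v D \<or> a \<in> set (inl v)}"
  proof -
    let ?R = "{a \<in> M. dst a \<notin> insert v D \<or> a \<in> set (inl v)} - {e}"
    have "{a \<in> ?M. ?dst a \<notin> insert v D \<or> a \<in> set (?inl v)} = insert i ?R"
      using inv e(2,5) p(4,5) i_notin by auto
    then have "card {a \<in> ?M. ?dst a \<notin> insert v D \<or> a \<in> set (?inl v)} = card (insert i ?R)"
      by (rule arg_cong)
    also have "\<dots> = Suc (card ?R)"
      by (rule card_insert_disjoint) (use finite_M i_notin in auto)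
    also have "\<dots> = card (insert e ?R)"
      by (rule card_insert_disjoint[symmetric]) (use finite_M in auto)
    also have "insert e ?R = {a \<in> M. dst a \<notin> insert v D \<or> a \<in> set (inl v)}"
      using inv e(1) by auto
    finally show ?thesis .
  qed
  show "new.rest_work < rest_work"
    unfolding rest_work_def new.rest_work_def S C card[symmetric] by simp
qed

text \<open>\<open>acc\<close> at the tail of \<open>e\<close> points to an edge settled at
  \<open>v\<close>, so the two are parallel. The merged edge returns to the in-list: its tail has
  lost an out-edge, which may enable a series reduction.\<close>

lemma step_parallel:
  assumes inv: "inl v = e # es" and a: "acc (org e) = a + 1" "dst a = v"
  shows "graph_state n (org(i := org e)) (dst(i := v)) (insert i (M - {a, e})) D v
      (inl(v := i # es)) outl st (i + 1) (od(org e := od (org e) - 1)) pend (acc(org e := 0)) pe"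
    and "graph_state.rest_work n (org(i := org e)) (dst(i := v)) (insert i (M - {a, e})) D v
      (inl(v := i # es)) outl < rest_work"
    and "a \<in> M" "org a = org e" "a \<noteq> e"
proof -
  note e = pop_in[OF inv]
  show A: "a \<in> M" "org a = org e" using acc_live[OF a] by auto
  have a_in: "a \<notin> set (inl v)" using acc_live[OF a] by auto
  then show ne: "a \<noteq> e" using inv by auto
  let ?org = "org(i := org a)" and ?M = "insert i (M - {a, e})"
  have sp': "ttsp ?org (dst(i := v)) ?M (n + 1) 0"
    using ttsp_parallel_reduction[OF sp i_notin A(1) e(1) ne A(2)] a(2) e(2) by simp
  have od': "(od(org e := od (org e) - 1)) (?org e') = card {b \<in> ?M. ?org b = ?org e'}" if "e' \<in> ?M" for e'
  proof (cases "?org e' = org e")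
    case True
    let ?B = "{b \<in> M. org b = org e} - {a, e}"
    have "{b \<in> M. org b = org e} = insert e (insert a ?B)"
      using e(1) A by auto
    then have "card {b \<in> M. org b = org e} = card (insert e (insert a ?B))" by (rule arg_cong)
    also have "\<dots> = Suc (Suc (card ?B))" using finite_M ne by simp
    finally have 1: "od (org e) = Suc (Suc (card ?B))" using od_card[OF e(1)] by simp
    have "{b \<in> ?M. ?org b = org e} = insert i ?B"
      using A(2) i_notin by auto
    then have "card {b \<in> ?M. ?org b = org e} = card (insert i ?B)" by (rule arg_cong)
    also have "\<dots> = Suc (card ?B)" using finite_M i_notin by simp
    finally have "card {b \<in> ?M. ?org b = org e} = od (org e) - 1" using 1 by simp
    then show ?thesis using True by simp
  next
    case False
    then have "e' \<in> M" "?org e' = org e'" using that A(2) by (auto split: if_splits)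
    moreover have "{b \<in> ?M. ?org b = org e'} = {b \<in> M. org b = org e'}"
      using False A(2) i_notin \<open>?org e' = org e'\<close> by auto
    ultimately show ?thesis using od_card[of e'] False by simp
  qed
  have r: "inl v = e # es" "a \<in> M" "a \<noteq> e" "org a \<in> D" "dst a \<in> insert v D" "a \<notin> set (inl v)"
    using inv A ne e(3) a(2) a_in by auto
  show "graph_state n (org(i := org e)) (dst(i := v)) (insert i (M - {a, e})) D v
      (inl(v := i # es)) outl st (i + 1) (od(org e := od (org e) - 1)) pend (acc(org e := 0)) pe"
    "graph_state.rest_work n (org(i := org e)) (dst(i := v)) (insert i (M - {a, e})) D v
      (inl(v := i # es)) outl < rest_work"
    using replace[where od' = "od(org e := od (org e) - 1)" and acc' = "acc(org e := 0)", OF r sp' od']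
      a(2) A(2) by (simp_all del: fun_upd_apply)
qed

text \<open>The tail of \<open>e\<close> has one out-edge and, being finished, one in-edge
  \<open>p\<close>. No degree counter changes: this tail disappears, and at \<open>org p\<close> the
  new edge replaces \<open>p\<close>.\<close>

lemma step_series:
  assumes inv: "inl v = e # es" and od1: "od (org e) = 1" and ns: "org e \<noteq> n + 1"
    and p: "pe (org e) = p + 1"
  shows "graph_state n (org(i := org p)) (dst(i := v)) (insert i (M - {p, e})) D v
      (inl(v := i # es)) outl st (i + 1) od pend acc pe"
    and "graph_state.rest_work n (org(i := org p)) (dst(i := v)) (insert i (M - {p, e})) D v
      (inl(v := i # es)) outl < rest_work"
    and "p \<in> M" "dst p = org e" "p \<noteq> e" "\<forall>a\<in>M. dst a = org e \<longrightarrow> a = p" "\<forall>a\<in>M. org a = org e \<longrightarrow> a = e"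
      "org p \<noteq> org e"
proof -
  note e = pop_in[OF inv]
  obtain q where q: "q \<in> M" "dst q = org e" "pe (org e) = q + 1" "org q \<in> D"
    "\<And>b. b \<in> M \<Longrightarrow> dst b = org e \<Longrightarrow> b = q"
    using pe_pred[OF e(1,3) ns] by blast
  have qp: "q = p" using q(3) p by simp
  note q = q[unfolded qp]
  show P: "p \<in> M" "dst p = org e" by (rule q(1), rule q(2))
  show ne: "p \<noteq> e" using P(2) e(2,4) by auto
  show "\<forall>a\<in>M. dst a = org e \<longrightarrow> a = p" using q(5) by blast
  have "card {b \<in> M. org b = org e} = 1" using od_card[OF e(1)] od1 by simp
  then obtain z where "{b \<in> M. org b = org e} = {z}" by (auto simp: card_1_singleton_iff)
  then have z: "b \<in> M \<Longrightarrow> org b = org e \<Longrightarrow> b = z" for b by blast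
  have only: "b = e" if "b \<in> M" "org b = org e" for b
    using z[OF that] z[OF e(1) refl] by simp
  show "\<forall>a\<in>M. org a = org e \<longrightarrow> a = e" using only by blast
  have op: "org p \<noteq> org e" using only[OF P(1)] ne by auto
  then show "org p \<noteq> org e" .
  let ?org = "org(i := org p)" and ?M = "insert i (M - {p, e})"
  have sp': "ttsp ?org (dst(i := v)) ?M (n + 1) 0"
  proof -
    have "ttsp ?org (dst(i := dst e)) ?M (n + 1) 0"
    proof (rule ttsp_series_reduction[OF sp i_notin P(1) e(1) P(2) refl])
      show "a = p" if "a \<in> M" "dst a = org e" for a using that by (rule q(5))
      show "a = e" if "a \<in> M" "org a = org e" for a using that by (rule only)
    qed
    then show ?thesis unfolding e(2) .
  qed
  have od': "od (?org e') = card {b \<in> ?M. ?org b = ?org e'}" if "e' \<in> ?M" for e'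
  proof (cases "?org e' = org p")
    case True
    have "od (org p) = card {b \<in> M. org b = org p}" using od_card[OF P(1)] .
    moreover have "{b \<in> M. org b = org p} = insert p ({b \<in> M. org b = org p} - {p})"
      using P(1) by auto
    moreover have "{b \<in> ?M. ?org b = org p} = insert i ({b \<in> M. org b = org p} - {p})"
      using op i_notin by auto
    moreover have "card (insert i ({b \<in> M. org b = org p} - {p})) = Suc (card ({b \<in> M. org b = org p} - {p}))"
      by (rule card_insert_disjoint) (use finite_M i_notin in auto)
    moreover have "card (insert p ({b \<in> M. org b = org p} - {p})) = Suc (card ({b \<in> M. org b = org p} - {p}))"
      by (rule card_insert_disjoint) (use finite_M in auto)
    ultimately show ?thesis using True by metis
  next
    case False
    then have e': "e' \<in> M" "?org e' = org e'" "e' \<noteq> e" using that by (auto split: if_splits)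
    then have "org e' \<noteq> org e" using only by blast
    then have "{b \<in> ?M. ?org b = org e'} = {b \<in> M. org b = org e'}"
      using False i_notin e'(2) by auto
    then show ?thesis using od_card[of e'] e' by simp
  qed
  have pv: "dst p \<noteq> v" using P(2) e(4) by simp
  have "p \<notin> set (inl v)" using pv in_list by blast
  then have r: "inl v = e # es" "p \<in> M" "p \<noteq> e" "org p \<in> D" "dst p \<in> insert v D" "p \<notin> set (inl v)"
    using inv P ne e(3) q(4) by auto
  show "graph_state n (org(i := org p)) (dst(i := v)) (insert i (M - {p, e})) D v
      (inl(v := i # es)) outl st (i + 1) od pend acc pe"
    "graph_state.rest_work n (org(i := org p)) (dst(i := v)) (insert i (M - {p, e})) D v
      (inl(v := i # es)) outl < rest_work"
    using replace[where od' = od and acc' = acc, OF r sp' od'] pv only by (simp_all del: fun_upd_apply)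
qed

text \<open>\<open>pe\<close> is written each time an edge is settled, but only the last value has
  to be right: once the in-list is empty, \<open>ttsp_progress\<close> leaves \<open>e\<close> as
  the only edge into \<open>v\<close>.\<close>

lemma step_settle:
  assumes inv: "inl v = e # es" and na: "\<not> (0 < acc (org e) \<and> dst (acc (org e) - 1) = v)"
    and no: "\<not> (od (org e) = 1 \<and> org e \<noteq> n + 1)"
  shows "graph_state n org dst M D v (inl(v := es)) outl st i od pend (acc(org e := e + 1)) (pe(v := e + 1))"
    and "graph_state.rest_work n org dst M D v (inl(v := es)) outl < rest_work"
proof -
  let ?inl = "inl(v := es)" and ?acc = "acc(org e := e + 1)" and ?pe = "pe(v := e + 1)"
  note e = pop_in[OF inv]
  have acc': "?acc (org e') = e' + 1" if "e' \<in> M" "dst e' = v" "e' \<notin> set es" for e'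
  proof (cases "e' = e")
    case False
    then have "acc (org e') = e' + 1" using that inv by (intro settled_acc) auto
    moreover from this have "org e' \<noteq> org e" using na that(2) by auto
    ultimately show ?thesis by simp
  qed simp
  have settled': "org e' = n + 1 \<or> (\<exists>e''\<in>M. e'' \<noteq> e' \<and> org e'' = org e')"
    if "e' \<in> M" "dst e' \<in> insert v D" "e' \<notin> set es" for e'
  proof (cases "e' = e")
    case True
    show ?thesis
    proof (rule ccontr)
      \<comment> \<open>Without a sibling the tail has out-degree 1, so a tail other than the source
        would have allowed a series reduction.\<close>
      assume n: "\<not> ?thesis"
      then have "{b \<in> M. org b = org e} = {e}" using True e(1) by auto
      then have "od (org e) = 1" using od_card[OF e(1)] by simp
      then show False using no n True by simp
    qed
  next
    case False
    then show ?thesis using settled[of e'] that inv by auto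
  qed
  have uniq: "e' = e" if "es = []" "e' \<in> M" "dst e' = v" for e'
  proof (rule ttsp_progress[OF sp, where v = v and D = D])
    show "org a \<in> D" if "a \<in> M" "dst a \<in> insert v D" for a using that by (rule closed)
    show "a = b" if "a \<in> M" "b \<in> M" "dst a \<in> D" "dst a = dst b" for a b
      using pe_edge[of a] pe_edge[of b] that by simp
    show "a = b" if "a \<in> M" "b \<in> M" "dst a = v" "dst b = v" "org a = org b" for a b
      using acc'[of a] acc'[of b] that \<open>es = []\<close> by simp
    show "org a = n + 1 \<or> (\<exists>e''\<in>M. e'' \<noteq> a \<and> org e'' = org a)" if "a \<in> M" "dst a = v" for a
      using settled'[of a] that \<open>es = []\<close> by simp
  qed (use that e in auto)
  show "graph_state n org dst M D v ?inl outl st i od pend ?acc ?pe"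
  proof
    show "set (?inl w) = {e \<in> M. dst e = w \<and> org e \<in> insert v D \<and> e \<notin> set (outl (org e))}"
      if "w \<notin> insert v D" for w using in_todo[OF that] that by simp
    show "?inl w = []" if "w \<in> D" for w using in_done[OF that] that v_notin by auto
    show "set (?inl v) \<subseteq> {e \<in> M. dst e = v}" using e(7) by auto
    show "set (outl v) = {e \<in> M. org e = v}" using in_phase inv by simp
    show "distinct (?inl w)" for w using in_dist[of w] in_dist[of v] inv by simp
    show "?acc (org e') = e' + 1" if "e' \<in> M" "dst e' = v" "e' \<notin> set (?inl v)" for e'
      using that by (intro acc') auto
    show "a \<in> M \<and> org a = u \<and> a \<notin> set (?inl v)" if a: "?acc u = a + 1" "dst a = v" for u a
    proof (cases "u = org e")
      case True
      then show ?thesis using a e by auto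
    next
      case False
      then show ?thesis using acc_live[of u a] a inv by auto
    qed
    show "dst a \<in> insert v D \<and> a < i" if a: "?acc u = a + 1" for u a
    proof (cases "u = org e")
      case True
      then show ?thesis using a e M_less[of e] by auto
    next
      case False
      then show ?thesis using acc_old[of u a] a by auto
    qed
    show "?pe (dst e') = e' + 1" if "e' \<in> M" "dst e' \<in> D \<or> dst e' = v \<and> ?inl v = []" for e'
      using that pe_edge[of e'] uniq[of e'] v_notin by auto
    show "org e' = n + 1 \<or> (\<exists>e''\<in>M. e'' \<noteq> e' \<and> org e'' = org e')"
      if "e' \<in> M" "dst e' \<in> insert v D" "e' \<notin> set (?inl v)" for e'
      using that by (intro settled') auto
  qed (rule sp M_less card_M i_ge nodes_le v_le out_todo out_done out_cur out_dist pend_card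
      od_card acc_old closed v_notin src_in stack st_dist in_dist; assumption)+
  then interpret new: graph_state n org dst M D v ?inl outl st i od pend ?acc ?pe .
  let ?R = "{a \<in> M. dst a \<notin> insert v D \<or> a \<in> set es}"
  have "{a \<in> M. dst a \<notin> insert v D \<or> a \<in> set (inl v)} = insert e ?R" "e \<notin> ?R"
    using inv e(1,2,5) by auto
  then have "card {a \<in> M. dst a \<notin> insert v D \<or> a \<in> set (inl v)} = Suc (card ?R)"
    using finite_M by simp
  then show "new.rest_work < rest_work" unfolding rest_work_def new.rest_work_def by simp
qed

lemma pop_out:
  assumes "outl v = e # es"
  shows "e \<in> M" "org e = v" "dst e \<notin> insert v D" "e \<notin> set es" "e \<notin> set (inl w)"
    "0 < pend (dst e)"
proof -
  show 1: "e \<in> M" "org e = v" using out_list[of e v] assms by auto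
  show 2: "dst e \<notin> insert v D" using closed[OF 1(1)] 1(2) v_notin by metis
  show "e \<notin> set es" using out_dist[of v] assms by simp
  show "e \<notin> set (inl w)" using in_list[of e w v] assms by auto
  have "e \<in> {a \<in> M. dst a = dst e \<and> (org a \<notin> insert v D \<or> a \<in> set (outl (org a)))}" using 1 assms by simp
  then show "0 < pend (dst e)" unfolding pend_card[OF 2] using finite_M by (auto simp: card_gt_0_iff)
qed

text \<open>\<open>pend\<close> counts the edges into a node that have not reached its in-list. It
  drops to 0 exactly when all of them are known, and at this moment the node is pushed onto the
  stack.\<close>

lemma step_distribute:
  assumes iv: "inl v = []" and outv: "outl v = e # es"
  shows "graph_state n org dst M D v (inl(dst e := e # inl (dst e))) (outl(v := es))
      (if pend (dst e) = 1 then dst e # st else st) i od (pend(dst e := pend (dst e) - 1)) acc pe"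
    and "graph_state.rest_work n org dst M D v (inl(dst e := e # inl (dst e))) (outl(v := es)) < rest_work"
proof -
  let ?w = "dst e"
  let ?inl = "inl(?w := e # inl ?w)" and ?outl = "outl(v := es)" and ?pend = "pend(?w := pend ?w - 1)"
  let ?st = "if pend ?w = 1 then ?w # st else st"
  note e = pop_out[OF outv]
  have wv: "?w \<noteq> v" using e(3) by simp
  have inlv: "?inl v = []" using iv wv by simp
  have out_eq: "a \<in> set (?outl (org a)) \<longleftrightarrow> a \<in> set (outl (org a)) \<and> a \<noteq> e" for a
    using outv e(2,4) by auto
  let ?P = "{a \<in> M. dst a = ?w \<and> (org a \<notin> insert v D \<or> a \<in> set (outl (org a)))}"
  let ?P' = "{a \<in> M. dst a = ?w \<and> (org a \<notin> insert v D \<or> a \<in> set (?outl (org a)))}"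
  have P: "?P' = ?P - {e}" "e \<in> ?P" unfolding out_eq using e(1,2) outv by auto
  have cP: "card ?P' = pend ?w - 1" using P finite_M pend_card[OF e(3)] by (simp add: card_Diff_singleton)
  have "finite ?P'" using finite_M by simp
  then have "?P' = {} \<longleftrightarrow> pend ?w - 1 = 0" unfolding cP[symmetric] by (rule card_0_eq[symmetric])
  then have pw: "pend ?w = 1 \<longleftrightarrow> ?P' = {}" using e(6) by linarith
  show "graph_state n org dst M D v ?inl ?outl ?st i od ?pend acc pe"
  proof
    show "set (?outl x) = {e \<in> M. org e = x}" if "x \<notin> insert v D" for x
      using out_todo[OF that] that by auto
    show "?outl x = []" if "x \<in> D" for x using out_done[OF that] that v_notin by auto
    show "set (?outl v) \<subseteq> {e \<in> M. org e = v}" using out_cur outv by auto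
    show "distinct (?outl x)" for x using out_dist[of x] out_dist[of v] outv by simp
    show "set (?inl w) = {e \<in> M. dst e = w \<and> org e \<in> insert v D \<and> e \<notin> set (?outl (org e))}"
      if "w \<notin> insert v D" for w
    proof (cases "w = ?w")
      case True
      then show ?thesis using in_todo[OF that] e(1,2) unfolding out_eq by auto
    next
      case False
      then show ?thesis using in_todo[OF that] unfolding out_eq by auto
    qed
    show "?inl w = []" if "w \<in> D" for w using in_done[OF that] that e(3) by auto
    show "set (?inl v) \<subseteq> {e \<in> M. dst e = v}" using inlv by simp
    show "set (?outl v) = {e \<in> M. org e = v}" if "?inl v \<noteq> []" using that inlv by simp
    show "distinct (?inl w)" for w using in_dist[of w] in_dist[of ?w] e(5)[of ?w] by simp
    show "?pend w = card {e \<in> M. dst e = w \<and> (org e \<notin> insert v D \<or> e \<in> set (?outl (org e)))}"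
      if "w \<notin> insert v D" for w
    proof (cases "w = ?w")
      case True
      then show ?thesis using cP by simp
    next
      case False
      then have "{a \<in> M. dst a = w \<and> (org a \<notin> insert v D \<or> a \<in> set (?outl (org a)))} =
        {a \<in> M. dst a = w \<and> (org a \<notin> insert v D \<or> a \<in> set (outl (org a)))}"
        unfolding out_eq by auto
      then show ?thesis using False pend_card[OF that] by simp
    qed
    show "acc (org e') = e' + 1" if "e' \<in> M" "dst e' = v" "e' \<notin> set (?inl v)" for e'
      using that iv by (intro settled_acc) auto
    show "a \<in> M \<and> org a = u \<and> a \<notin> set (?inl v)" if "acc u = a + 1" "dst a = v" for u a
      using acc_live[OF that] inlv by simp
    show "pe (dst e') = e' + 1" if "e' \<in> M" "dst e' \<in> D \<or> dst e' = v \<and> ?inl v = []" for e'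
      using that iv by (intro pe_edge) auto
    show "org e' = n + 1 \<or> (\<exists>e''\<in>M. e'' \<noteq> e' \<and> org e'' = org e')"
      if "e' \<in> M" "dst e' \<in> insert v D" "e' \<notin> set (?inl v)" for e'
      using that iv by (intro settled) auto
    have st_eq: "set st = {w. w \<notin> insert v D \<and> (\<exists>e\<in>M. dst e = w) \<and>
      {a \<in> M. dst a = w \<and> (org a \<notin> insert v D \<or> a \<in> set (outl (org a)))} = {}}"
      unfolding stack by blast
    have w_st: "?w \<notin> set st" unfolding st_eq using P(2) by blast
    have other: "{a \<in> M. dst a = w \<and> (org a \<notin> insert v D \<or> a \<in> set (?outl (org a)))} =
        {a \<in> M. dst a = w \<and> (org a \<notin> insert v D \<or> a \<in> set (outl (org a)))}" if "w \<noteq> ?w" for w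
      using that unfolding out_eq by auto
    have "set ?st = {w. w \<notin> insert v D \<and> (\<exists>e\<in>M. dst e = w) \<and>
      {a \<in> M. dst a = w \<and> (org a \<notin> insert v D \<or> a \<in> set (?outl (org a)))} = {}}" (is "_ = ?S")
    proof (rule set_eqI)
      fix w
      show "w \<in> set ?st \<longleftrightarrow> w \<in> ?S"
      proof (cases "w = ?w")
        case True
        have S: "?w \<in> ?S \<longleftrightarrow> ?P' = {}" using e(1,3) by blast
        have st: "?w \<in> set ?st \<longleftrightarrow> pend ?w = 1" using w_st by simp
        show ?thesis unfolding True S st by (rule pw)
      next
        case False
        then have "w \<in> set ?st \<longleftrightarrow> w \<in> set st" by simp
        then show ?thesis unfolding st_eq using other[OF False] by blast
      qed
    qed
    then show "set ?st = {w. w \<notin> insert v D \<and> (\<exists>e\<in>M. dst e = w) \<and>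
      (\<forall>e\<in>M. dst e = w \<longrightarrow> org e \<in> insert v D \<and> e \<notin> set (?outl (org e)))}" by blast
    show "distinct ?st" using st_dist w_st by simp
  qed (rule sp M_less card_M i_ge nodes_le v_le out_todo out_done out_cur out_dist pend_card
      od_card acc_old closed v_notin src_in stack st_dist in_dist; assumption)+
  then interpret new: graph_state n org dst M D v ?inl ?outl ?st i od ?pend acc pe .
  let ?R = "{a \<in> M. org a \<notin> insert v D \<or> a \<in> set (outl (org a))}"
  have "{a \<in> M. org a \<notin> insert v D \<or> a \<in> set (?outl (org a))} = ?R - {e}" "e \<in> ?R"
    unfolding out_eq using e(1,2) outv by auto
  then have "card {a \<in> M. org a \<notin> insert v D \<or> a \<in> set (?outl (org a))} < card ?R"
    using card_Diff1_less[of ?R e] finite_M by simp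
  then show "new.rest_work < rest_work" unfolding rest_work_def new.rest_work_def using inlv iv by simp
qed

lemma step_next:
  assumes iv: "inl v = []" and ov: "outl v = []" and st: "st = w # ws"
  shows "graph_state n org dst M (insert v D) w inl outl ws i od pend acc pe"
    and "graph_state.rest_work n org dst M (insert v D) w inl outl < rest_work"
proof -
  have w: "w \<notin> insert v D" "\<exists>e\<in>M. dst e = w" "w \<notin> set ws"
    "\<And>e. e \<in> M \<Longrightarrow> dst e = w \<Longrightarrow> org e \<in> insert v D \<and> e \<notin> set (outl (org e))"
    using stack st st_dist by auto
  have w_le: "w \<le> n + 1" using w(2) nodes_le by auto
  have outw: "set (outl w) = {e \<in> M. org e = w}" using out_todo[OF w(1)] .
  have inw: "set (inl w) = {e \<in> M. dst e = w}" using in_todo[OF w(1)] w(4) by blast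
  have cond: "org e \<in> insert w (insert v D) \<and> e \<notin> set (outl (org e)) \<longleftrightarrow>
      org e \<in> insert v D \<and> e \<notin> set (outl (org e))" if "e \<in> M" for e
    using outw that by auto
  show "graph_state n org dst M (insert v D) w inl outl ws i od pend acc pe"
  proof
    show "w \<le> n + 1" by (rule w_le)
    show "set (outl x) = {e \<in> M. org e = x}" if "x \<notin> insert w (insert v D)" for x
      using that by (intro out_todo) auto
    show "outl x = []" if "x \<in> insert v D" for x using that out_done ov by auto
    show "set (outl w) \<subseteq> {e \<in> M. org e = w}" using outw by simp
    show "set (inl x) = {e \<in> M. dst e = x \<and> org e \<in> insert w (insert v D) \<and> e \<notin> set (outl (org e))}"
      if "x \<notin> insert w (insert v D)" for x
    proof -
      have "set (inl x) = {e \<in> M. dst e = x \<and> org e \<in> insert v D \<and> e \<notin> set (outl (org e))}"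
        using that by (intro in_todo) auto
      then show ?thesis using cond by blast
    qed
    show "inl x = []" if "x \<in> insert v D" for x using that in_done iv by auto
    show "set (inl w) \<subseteq> {e \<in> M. dst e = w}" using inw by simp
    show "set (outl w) = {e \<in> M. org e = w}" by (rule outw)
    show "pend x = card {e \<in> M. dst e = x \<and> (org e \<notin> insert w (insert v D) \<or> e \<in> set (outl (org e)))}"
      if "x \<notin> insert w (insert v D)" for x
    proof -
      have "pend x = card {e \<in> M. dst e = x \<and> (org e \<notin> insert v D \<or> e \<in> set (outl (org e)))}"
        using that by (intro pend_card) auto
      moreover have "{e \<in> M. dst e = x \<and> (org e \<notin> insert w (insert v D) \<or> e \<in> set (outl (org e)))} =
          {e \<in> M. dst e = x \<and> (org e \<notin> insert v D \<or> e \<in> set (outl (org e)))}"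
        using cond by blast
      ultimately show ?thesis by simp
    qed
    show "acc (org e) = e + 1" if "e \<in> M" "dst e = w" "e \<notin> set (inl w)" for e
      using that inw by blast
    \<comment> \<open>\<open>acc\<close> is not cleared for a new node, which would cost too much.
      Stale entries betray themselves by heads in \<open>insert v D\<close>, hence other than
      \<open>w\<close>.\<close>
    show "a \<in> M \<and> org a = u \<and> a \<notin> set (inl w)" if "acc u = a + 1" "dst a = w" for u a
      using acc_old[OF that(1)] that(2) w(1) by simp
    show "dst a \<in> insert w (insert v D) \<and> a < i" if "acc u = a + 1" for u a
      using acc_old[OF that] by blast
    show "pe (dst e) = e + 1" if "e \<in> M" "dst e \<in> insert v D \<or> dst e = w \<and> inl w = []" for e
    proof (rule pe_edge[OF that(1)])
      have "inl w \<noteq> []" if "dst e = w" using that inw \<open>e \<in> M\<close> by (metis (mono_tags, lifting) empty_iff empty_set mem_Collect_eq)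
      then show "dst e \<in> D \<or> dst e = v \<and> inl v = []" using that(2) iv by blast
    qed
    show "org e = n + 1 \<or> (\<exists>e'\<in>M. e' \<noteq> e \<and> org e' = org e)"
      if "e \<in> M" "dst e \<in> insert w (insert v D)" "e \<notin> set (inl w)" for e
      by (rule settled) (use that inw iv in auto)
    show "org e \<in> insert v D" if "e \<in> M" "dst e \<in> insert w (insert v D)" for e
      using that closed[of e] w(4)[of e] by blast
    show "w \<notin> insert v D" by (rule w(1))
    show "n + 1 \<in> insert w (insert v D)" using src_in by simp
    show "distinct ws" using st_dist st by simp
    show "set ws = {x. x \<notin> insert w (insert v D) \<and> (\<exists>e\<in>M. dst e = x) \<and>
      (\<forall>e\<in>M. dst e = x \<longrightarrow> org e \<in> insert w (insert v D) \<and> e \<notin> set (outl (org e)))}"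
    proof -
      have "set ws = set st - {w}" using st w(3) by auto
      also have "\<dots> = {x. x \<notin> insert w (insert v D) \<and> (\<exists>e\<in>M. dst e = x) \<and>
        (\<forall>e\<in>M. dst e = x \<longrightarrow> org e \<in> insert v D \<and> e \<notin> set (outl (org e)))}"
        unfolding stack by blast
      also have "\<dots> = {x. x \<notin> insert w (insert v D) \<and> (\<exists>e\<in>M. dst e = x) \<and>
        (\<forall>e\<in>M. dst e = x \<longrightarrow> org e \<in> insert w (insert v D) \<and> e \<notin> set (outl (org e)))}"
        using cond by blast
      finally show ?thesis .
    qed
  qed (rule sp M_less card_M i_ge nodes_le v_le out_todo out_done out_cur out_dist pend_card
      od_card acc_old closed v_notin src_in stack st_dist in_dist; assumption)+
  then interpret new: graph_state n org dst M "insert v D" w inl outl ws i od pend acc pe .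
  have "{a \<in> M. dst a \<notin> insert w (insert v D) \<or> a \<in> set (inl w)} =
      {a \<in> M. dst a \<notin> insert v D \<or> a \<in> set (inl v)}"
    using inw iv w(1) by auto
  moreover have "{a \<in> M. org a \<notin> insert w (insert v D) \<or> a \<in> set (outl (org a))} =
      {a \<in> M. org a \<notin> insert v D \<or> a \<in> set (outl (org a))}"
    using cond by blast
  moreover have "card ({..n + 1} - insert w (insert v D)) < card ({..n + 1} - insert v D)"
  proof -
    have "{..n + 1} - insert w (insert v D) = ({..n + 1} - insert v D) - {w}" by blast
    moreover have "w \<in> {..n + 1} - insert v D" using w(1) w_le by simp
    ultimately show ?thesis using card_Diff1_less[of "{..n + 1} - insert v D" w] by simp
  qed
  ultimately show "new.rest_work < rest_work" unfolding rest_work_def new.rest_work_def by simp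
qed

text \<open>An unvisited head would give, by \<open>ttsp_next_node\<close>, a node whose in-edges
  are all known, and this would be on the stack. So all heads are visited, and irreducibility leaves
  one edge. Hence the main loop never pops an empty stack.\<close>

lemma stuck:
  assumes iv: "inl v = []" and ov: "outl v = []" and st: "st = []"
  shows "card M = 1"
proof -
  have all: "dst e \<in> insert v D" if "e \<in> M" for e
  proof (rule ccontr)
    assume "dst e \<notin> insert v D"
    then obtain e' where e': "e' \<in> M" "dst e' \<notin> insert v D"
      "\<forall>a\<in>M. dst a = dst e' \<longrightarrow> org a \<in> insert v D"
      using ttsp_next_node[OF sp src_in] \<open>e \<in> M\<close> by blast
    then have "\<forall>a\<in>M. dst a = dst e' \<longrightarrow> org a \<in> insert v D \<and> a \<notin> set (outl (org a))"
      using ov out_done by auto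
    then have "dst e' \<in> set st" unfolding stack using e' by blast
    then show False using st by simp
  qed
  show ?thesis
  proof (rule ttsp_all_reduced[OF sp, where D = "insert v D"])
    show "org e \<in> insert v D" if "e \<in> M" for e using closed[OF that all[OF that]] by simp
    show "e = e'" if "e \<in> M" "e' \<in> M" "dst e = dst e'" for e e'
      using pe_edge[of e] pe_edge[of e'] that all[of e] all[of e'] iv by auto
    show "org e = n + 1 \<or> (\<exists>e'\<in>M. e' \<noteq> e \<and> org e' = org e)" if "e \<in> M" for e
      using settled[OF that all[OF that]] iv by simp
  qed (rule all)
qed

end

section \<open>The main loop\<close>

text \<open>References are shifted by one, 0 meaning none.\<close>

primrec lst :: "(nat \<Rightarrow> nat) \<Rightarrow> nat \<Rightarrow> nat list \<Rightarrow> bool" where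
  "lst nx p [] \<longleftrightarrow> p = 0"
| "lst nx p (x # xs) \<longleftrightarrow> p = x + 1 \<and> lst nx (nx x) xs"

lemma lst_upd [simp]: "e \<notin> set xs \<Longrightarrow> lst (nx(e := y)) p xs = lst nx p xs"
  by (induction xs arbitrary: p) auto

lemma lst_pos: "lst nx p xs \<Longrightarrow> 0 < p \<longleftrightarrow> xs \<noteq> []"
  by (cases xs) auto

abbreviation "rv \<equiv> Reg ''v''"
abbreviation "re \<equiv> Reg ''e''"
abbreviation "ru \<equiv> Reg ''u''"
abbreviation "ra \<equiv> Reg ''a''"
abbreviation "rp \<equiv> Reg ''p''"
abbreviation "rw \<equiv> Reg ''w''"
abbreviation "rtop \<equiv> Reg ''top''"

text \<open>Fields: 0-3 and 4-7 hold the table entries and their choices, 8 and 9 the in- and out-list of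
  a node, 10 the list successor of an edge, 11 that of a node on the stack, 12 and 13 tail and head of
  an edge, 14 some predecessor of an item, 15 the out-degree, 16 the number of in-edges not yet known,
  17 \<open>acc\<close>, 18 \<open>pe\<close>, 19 and 20 the children of an edge, 21 the chosen table entry of an edge.\<close>

definition pop_edge :: program where
  "pop_edge = Seq (Assign ''e'' (Minus (Fld 8 rv) (Const 1))) (Seq (SetFld 8 rv (Fld 10 re))
     (Seq (Assign ''u'' (Fld 12 re)) (Assign ''a'' (Fld 17 ru))))"

definition parallel_prep :: program where
  "parallel_prep = Seq (SetFld 15 ru (Minus (Fld 15 ru) (Const 1))) (Seq (SetFld 17 ru (Const 0))
     (Seq (Assign ''l'' (Minus ra (Const 1))) (Seq (Assign ''r'' re) (Assign ''p'' ru))))"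

definition series_prep :: program where
  "series_prep = Seq (Assign ''l'' (Minus (Fld 18 ru) (Const 1)))
     (Seq (Assign ''r'' re) (Assign ''p'' (Fld 12 rl)))"

definition new_edge :: program where
  "new_edge = Seq (SetFld 19 rid rl) (Seq (SetFld 20 rid rr) (Seq (SetFld 12 rid rp) (Seq (SetFld 13 rid rv)
     (Seq (SetFld 10 rid (Fld 8 rv)) (Seq (SetFld 8 rv (Plus rid (Const 1)))
       (Assign ''id'' (Plus rid (Const 1))))))))"

definition settle_edge :: program where
  "settle_edge = Seq (SetFld 17 ru (Plus re (Const 1))) (SetFld 18 rv (Plus re (Const 1)))"

definition distribute_edge :: program where
  "distribute_edge = Seq (Assign ''e'' (Minus (Fld 9 rv) (Const 1))) (Seq (SetFld 9 rv (Fld 10 re))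
     (Seq (Assign ''w'' (Fld 13 re)) (Seq (SetFld 10 re (Fld 8 rw)) (Seq (SetFld 8 rw (Plus re (Const 1)))
       (Seq (SetFld 16 rw (Minus (Fld 16 rw) (Const 1)))
         (program.If (Equal (Fld 16 rw) (Const 0))
           (Seq (SetFld 11 rw rtop) (Assign ''top'' (Plus rw (Const 1)))) Skip))))))"

definition next_node :: program where
  "next_node = Seq (Assign ''v'' (Minus rtop (Const 1))) (Assign ''top'' (Fld 11 rv))"

definition handle_edge :: program where
  "handle_edge = program.If (And (Less (Const 0) ra) (Equal (Fld 13 (Minus ra (Const 1))) rv))
     (Seq parallel_prep (Seq (merge_tables False) new_edge))
     (program.If (And (Equal (Fld 15 ru) (Const 1)) (test.Not (Equal ru (Plus inN (Const 1)))))
       (Seq series_prep (Seq (merge_tables True) new_edge))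
       settle_edge)"

definition main_body :: program where
  "main_body = program.If (Less (Const 0) (Fld 8 rv)) (Seq pop_edge handle_edge)
     (program.If (Less (Const 0) (Fld 9 rv)) distribute_edge next_node)"

definition main_loop :: program where
  "main_loop = While (Less (Plus rid (Const 1)) (Times (Const 2) inN)) main_body"

text \<open>The measure of the main loop refers to lists and sets that are not a function of the
  state. The least value that the invariant admits for a state serves instead.\<close>

lemma (in ram) runs_While_indexed:
  assumes "I k \<sigma>" "\<And>k \<sigma>. I k \<sigma> \<Longrightarrow> safe_test \<sigma> b"
    "\<And>k \<sigma>. I k \<sigma> \<Longrightarrow> holds inp \<sigma> b \<Longrightarrow> runs P \<sigma> T (\<lambda>\<tau>. \<exists>k'<k. I k' \<tau>)"
    "\<And>k \<sigma>. I k \<sigma> \<Longrightarrow> \<not> holds inp \<sigma> b \<Longrightarrow> Q \<sigma>" "(k + 1) * (1 + test_cost b + T) \<le> T'"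
  shows "runs (While b P) \<sigma> T' Q"
proof (rule runs_While[where I = "\<lambda>\<sigma>. \<exists>k. I k \<sigma>" and \<mu> = "\<lambda>\<sigma>. LEAST k. I k \<sigma>" and T = T])
  show "\<exists>k. I k \<sigma>" using assms(1) by blast
  show "safe_test \<sigma> b" if "\<exists>k. I k \<sigma>" for \<sigma> using that assms(2) by blast
  show "Q \<sigma>" if "\<exists>k. I k \<sigma>" "\<not> holds inp \<sigma> b" for \<sigma> using that assms(4) by blast
  show "runs P \<sigma> T (\<lambda>\<tau>. (\<exists>k. I k \<tau>) \<and> (LEAST k. I k \<tau>) < (LEAST k. I k \<sigma>))"
    if "\<exists>k. I k \<sigma>" "holds inp \<sigma> b" for \<sigma>
  proof (rule runs_mono[OF assms(3)[OF _ that(2)] order_refl])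
    show "I (LEAST k. I k \<sigma>) \<sigma>" using that(1) by (rule LeastI_ex)
    fix \<tau> assume "\<exists>k'<(LEAST k. I k \<sigma>). I k' \<tau>"
    then obtain k' where "k' < (LEAST k. I k \<sigma>)" "I k' \<tau>" by blast
    then show "(\<exists>k. I k \<tau>) \<and> (LEAST k. I k \<tau>) < (LEAST k. I k \<sigma>)"
      using Least_le[of "\<lambda>k. I k \<tau>" k'] by auto
  qed
  have "(LEAST k. I k \<sigma>) \<le> k" using assms(1) by (rule Least_le)
  then have "((LEAST k. I k \<sigma>) + 1) * (1 + test_cost b + T) \<le> (k + 1) * (1 + test_cost b + T)"
    by (intro mult_le_mono1) simp
  then show "((LEAST k. I k \<sigma>) + 1) * (1 + test_cost b + T) \<le> T'" using assms(5) by (rule order_trans)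
qed

context ssgw_ram
begin

section \<open>Trees and tables during the reduction\<close>

lemma table_cong: "(\<And>f. f < 4 \<Longrightarrow> fld f M' = fld f M) \<Longrightarrow> table M' = table M"
  by (auto simp: table_def fun_eq_iff)

lemma choice_ok_cong:
  assumes "\<And>f. f < 8 \<Longrightarrow> fld f M' = fld f M"
  shows "choice_ok k l r i M' = choice_ok k l r i M"
proof -
  have "table M' = table M" using assms by (intro table_cong) simp
  moreover have "h < 4 \<Longrightarrow> fld h M' = fld h M \<and> fld (4 + h) M' = fld (4 + h) M" for h
    using assms by simp
  moreover have "(z, h) \<in> table M i \<Longrightarrow> h < 4" for z h by (simp add: table_def)
  ultimately show ?thesis unfolding choice_ok_def by (metis (no_types, lifting))
qed

text \<open>\<open>X\<close> gives a tree to every number used so far, also to consumed edges; the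
  fields 19 and 20 turn these numbers into a forest with the roots \<open>M\<close>. That children
  have smaller numbers and only one parent lets a single descending pass distribute the choices
  later.\<close>

definition forest :: "(nat \<Rightarrow> sptree) \<Rightarrow> nat set \<Rightarrow> nat \<Rightarrow> (nat \<Rightarrow> nat) \<Rightarrow> bool" where
  "forest X M i m \<longleftrightarrow>
    (\<forall>e\<in>M. \<forall>e'\<in>M. e \<noteq> e' \<longrightarrow> leaves (X e) \<inter> leaves (X e') = {}) \<and>
    (\<Union>e\<in>M. leaves (X e)) = {..<n} \<and>
    (\<forall>e<i. disjoint_leaves (X e)) \<and>
    (\<forall>e<n. X e = Leaf e) \<and>
    (\<forall>e. n \<le> e \<and> e < i \<longrightarrow> fld 19 m e < e \<and> fld 20 m e < e \<and> fld 19 m e \<notin> M \<and> fld 20 m e \<notin> M \<and>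
       fld 19 m e \<noteq> fld 20 m e) \<and>
    (\<forall>e. n \<le> e \<and> e < i \<longrightarrow> (\<exists>k. X e = Node k (X (fld 19 m e)) (X (fld 20 m e)) \<and>
       choice_ok k (fld 19 m e) (fld 20 m e) e m)) \<and>
    (\<forall>e e'. n \<le> e \<and> e < e' \<and> e' < i \<longrightarrow> {fld 19 m e, fld 20 m e} \<inter> {fld 19 m e', fld 20 m e'} = {}) \<and>
    (\<forall>e<i. e \<notin> M \<longrightarrow> (\<exists>e'. n \<le> e' \<and> e' < i \<and> (fld 19 m e' = e \<or> fld 20 m e' = e))) \<and>
    (\<forall>e<i. table m e = {(x, f). (x, f) \<in> reach s (X e) \<and> x \<le> c}) \<and>
    (\<forall>e. i \<le> e \<and> e < 2 * n \<longrightarrow> table m e = {})"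

lemma forestD:
  assumes "forest X M i m"
  shows "\<forall>e\<in>M. \<forall>e'\<in>M. e \<noteq> e' \<longrightarrow> leaves (X e) \<inter> leaves (X e') = {}"
    and "(\<Union>e\<in>M. leaves (X e)) = {..<n}"
    and "\<forall>e<i. disjoint_leaves (X e)"
    and "\<forall>e<n. X e = Leaf e"
    and "\<forall>e. n \<le> e \<and> e < i \<longrightarrow> fld 19 m e < e \<and> fld 20 m e < e \<and> fld 19 m e \<notin> M \<and> fld 20 m e \<notin> M \<and>
       fld 19 m e \<noteq> fld 20 m e"
    and "\<forall>e. n \<le> e \<and> e < i \<longrightarrow> (\<exists>k. X e = Node k (X (fld 19 m e)) (X (fld 20 m e)) \<and>
       choice_ok k (fld 19 m e) (fld 20 m e) e m)"
    and "\<forall>e e'. n \<le> e \<and> e < e' \<and> e' < i \<longrightarrow> {fld 19 m e, fld 20 m e} \<inter> {fld 19 m e', fld 20 m e'} = {}"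
    and "\<forall>e<i. e \<notin> M \<longrightarrow> (\<exists>e'. n \<le> e' \<and> e' < i \<and> (fld 19 m e' = e \<or> fld 20 m e' = e))"
    and "\<forall>e<i. table m e = {(x, f). (x, f) \<in> reach s (X e) \<and> x \<le> c}"
    and "\<forall>e. i \<le> e \<and> e < 2 * n \<longrightarrow> table m e = {}"
  using assms unfolding forest_def by - (elim conjE, assumption)+

lemma forest_cong:
  assumes "forest X M i m" "\<And>f. f < 8 \<Longrightarrow> fld f m' = fld f m" "fld 19 m' = fld 19 m" "fld 20 m' = fld 20 m"
  shows "forest X M i m'"
proof -
  have "table m' = table m" using assms(2) by (intro table_cong) simp
  moreover have "choice_ok k l r e m' = choice_ok k l r e m" for k l r e
    by (rule choice_ok_cong) (rule assms(2))
  ultimately show ?thesis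
    using assms(1) unfolding forest_def assms(3,4) by simp
qed

lemma choice_ok_outside:
  assumes "choice_ok k l r e m" "same_outside i m m'" "e \<noteq> i" "l \<noteq> i" "r \<noteq> i"
  shows "choice_ok k l r e m'"
proof -
  have tab: "table m' e = table m e" "table m' l = table m l" "table m' r = table m r"
    using same_outside_table[OF assms(2)] assms(3-5) by auto
  have "fld g m' (e * (c + 1) + z) = fld g m (e * (c + 1) + z)" if "z \<le> c" "g < 22" for g z
  proof -
    have "e * (c + 1) + z < i * (c + 1) \<or> i * (c + 1) + c < e * (c + 1) + z"
    proof (cases "e < i")
      case True
      then have "(e + 1) * (c + 1) \<le> i * (c + 1)" by (intro mult_le_mono1) simp
      then show ?thesis using that by simp
    next
      case False
      then have "(i + 1) * (c + 1) \<le> e * (c + 1)" using assms(3) by (intro mult_le_mono1) simp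
      then show ?thesis by simp
    qed
    then show ?thesis using assms(2) that unfolding same_outside_def by blast
  qed
  then have same: "fld h m' (e * (c + 1) + z) = fld h m (e * (c + 1) + z)"
    "fld (4 + h) m' (e * (c + 1) + z) = fld (4 + h) m (e * (c + 1) + z)" if "(z, h) \<in> table m e" for z h
    using that by (auto simp: table_def)
  show ?thesis unfolding choice_ok_def tab
  proof (intro allI impI)
    fix z h assume zh: "(z, h) \<in> table m e"
    then have "\<exists>x f y g. (f, g, h) \<in> set (flag_combos k) \<and> z = x + y \<and> (x, f) \<in> table m l \<and> (y, g) \<in> table m r \<and>
       fld h m (e * (c + 1) + z) = 1 + (x * 22 + f) \<and> fld (4 + h) m (e * (c + 1) + z) = y * 22 + g"
      using assms(1) unfolding choice_ok_def by blast
    then show "\<exists>x f y g. (f, g, h) \<in> set (flag_combos k) \<and> z = x + y \<and> (x, f) \<in> table m l \<and> (y, g) \<in> table m r \<and>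
       fld h m' (e * (c + 1) + z) = 1 + (x * 22 + f) \<and> fld (4 + h) m' (e * (c + 1) + z) = y * 22 + g"
      unfolding same[OF zh] .
  qed
qed

lemma forest_step:
  assumes F: "forest X M i m" and M: "M \<subseteq> {..<i}" "l \<in> M" "r \<in> M" "l \<noteq> r" "n \<le> i" "i < 2 * n"
    and so: "same_outside i m m1"
    and m': "\<And>f. f < 8 \<Longrightarrow> fld f m' = fld f m1" "fld 19 m' = (fld 19 m)(i := l)" "fld 20 m' = (fld 20 m)(i := r)"
    and ch: "choice_ok k l r i m1"
    and tab: "table m1 i = {(x + y, h) | x y f g h. x + y \<le> c \<and> (x, f) \<in> table m l \<and> (y, g) \<in> table m r \<and>
      (f, g, h) \<in> set (flag_combos k)}"
  shows "forest (X(i := Node k (X l) (X r))) (insert i (M - {l, r})) (i + 1) m'"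
proof -
  let ?X = "X(i := Node k (X l) (X r))" and ?M = "insert i (M - {l, r})"
  have li: "l < i" "r < i" "i \<notin> M" using M by auto
  have tm: "table m' = table m1" using m' by (intro table_cong) simp
  have cm: "choice_ok k' l' r' e m' = choice_ok k' l' r' e m1" for k' l' r' e
    by (rule choice_ok_cong) (rule m'(1))
  have F1: "\<And>e e'. e \<in> M \<Longrightarrow> e' \<in> M \<Longrightarrow> e \<noteq> e' \<Longrightarrow> leaves (X e) \<inter> leaves (X e') = {}"
    and F2: "(\<Union>e\<in>M. leaves (X e)) = {..<n}"
    and F3: "\<And>e. e < i \<Longrightarrow> disjoint_leaves (X e)"
    and F4: "\<And>e. e < n \<Longrightarrow> X e = Leaf e"
    and F5: "\<And>e. n \<le> e \<Longrightarrow> e < i \<Longrightarrow> fld 19 m e < e \<and> fld 20 m e < e \<and> fld 19 m e \<notin> M \<and> fld 20 m e \<notin> M \<and>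
       fld 19 m e \<noteq> fld 20 m e"
    and F6: "\<And>e. n \<le> e \<Longrightarrow> e < i \<Longrightarrow> \<exists>k. X e = Node k (X (fld 19 m e)) (X (fld 20 m e)) \<and>
       choice_ok k (fld 19 m e) (fld 20 m e) e m"
    and F7: "\<And>e e'. n \<le> e \<Longrightarrow> e < e' \<Longrightarrow> e' < i \<Longrightarrow> {fld 19 m e, fld 20 m e} \<inter> {fld 19 m e', fld 20 m e'} = {}"
    and F8: "\<And>e. e < i \<Longrightarrow> e \<notin> M \<Longrightarrow> \<exists>e'. n \<le> e' \<and> e' < i \<and> (fld 19 m e' = e \<or> fld 20 m e' = e)"
    and F9: "\<And>e. e < i \<Longrightarrow> table m e = {(x, f). (x, f) \<in> reach s (X e) \<and> x \<le> c}"
    and F10: "\<And>e. i \<le> e \<Longrightarrow> e < 2 * n \<Longrightarrow> table m e = {}"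
    using forestD(1)[OF F] apply blast
    using forestD(2)[OF F] apply blast
    using forestD(3)[OF F] apply blast
    using forestD(4)[OF F] apply blast
    using forestD(5)[OF F] apply blast
    using forestD(6)[OF F] apply blast
    using forestD(7)[OF F] apply blast
    using forestD(8)[OF F] apply blast
    using forestD(9)[OF F] apply blast
    using forestD(10)[OF F] apply blast
    done
  have dl: "disjoint_leaves (Node k (X l) (X r))" using F3 li F1[OF M(2-4)] by simp
  have X_M: "e \<in> M \<Longrightarrow> ?X e = X e" for e using li by auto
  show ?thesis
    unfolding forest_def
  proof (intro conjI allI ballI impI)
    fix e e' assume e: "e \<in> ?M" "e' \<in> ?M" "e \<noteq> e'"
    have "leaves (X a) \<inter> (leaves (X l) \<union> leaves (X r)) = {}" if "a \<in> M - {l, r}" for a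
      using that F1[of a l] F1[of a r] M by blast
    then show "leaves (?X e) \<inter> leaves (?X e') = {}"
      using e X_M F1[of e e'] li by (cases "e = i"; cases "e' = i") auto
  next
    have "(\<Union>e\<in>?M. leaves (?X e)) = leaves (?X i) \<union> (\<Union>e\<in>M - {l, r}. leaves (?X e))" by simp
    also have "(\<Union>e\<in>M - {l, r}. leaves (?X e)) = (\<Union>e\<in>M - {l, r}. leaves (X e))"
      using X_M by (intro SUP_cong) auto
    also have "leaves (?X i) \<union> \<dots> = (\<Union>e\<in>M. leaves (X e))" using M(2,3) by auto
    finally show "(\<Union>e\<in>?M. leaves (?X e)) = {..<n}" using F2 by simp
  next
    fix e assume "e < i + 1"
    then show "disjoint_leaves (?X e)" using F3[of e] dl by (cases "e = i") (auto simp del: disjoint_leaves.simps)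
  next
    fix e assume "e < n"
    then show "?X e = Leaf e" using F4[of e] M(5) by simp
  next
    fix e assume e: "n \<le> e \<and> e < i + 1"
    have "fld 19 m' e < e \<and> fld 20 m' e < e \<and> fld 19 m' e \<notin> ?M \<and> fld 20 m' e \<notin> ?M \<and>
       fld 19 m' e \<noteq> fld 20 m' e"
      using e F5[of e] m' M li by (cases "e = i") auto
    then show "fld 19 m' e < e" "fld 20 m' e < e" "fld 19 m' e \<notin> ?M" "fld 20 m' e \<notin> ?M"
       "fld 19 m' e \<noteq> fld 20 m' e" by auto
    show "\<exists>k. ?X e = Node k (?X (fld 19 m' e)) (?X (fld 20 m' e)) \<and>
       choice_ok k (fld 19 m' e) (fld 20 m' e) e m'"
    proof (cases "e = i")
      case True
      then show ?thesis using ch li unfolding m'(2,3) cm by (intro exI[of _ k]) simp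
    next
      case False
      then have "e < i" using e by simp
      then obtain k' where k': "X e = Node k' (X (fld 19 m e)) (X (fld 20 m e))"
        "choice_ok k' (fld 19 m e) (fld 20 m e) e m" using F6 e by blast
      have lt: "fld 19 m e < i" "fld 20 m e < i" using F5[of e] e \<open>e < i\<close> by auto
      have "choice_ok k' (fld 19 m e) (fld 20 m e) e m1"
        by (rule choice_ok_outside[OF k'(2) so]) (use lt \<open>e < i\<close> in auto)
      then show ?thesis using k' False lt unfolding m'(2,3) cm by (intro exI[of _ k']) simp
    qed
  next
    fix e e' assume e: "n \<le> e \<and> e < e' \<and> e' < i + 1"
    then have "e < i" by simp
    show "{fld 19 m' e, fld 20 m' e} \<inter> {fld 19 m' e', fld 20 m' e'} = {}"
    proof (cases "e' = i")
      case True
      then show ?thesis using F5[of e] e M(2,3) unfolding m'(2,3) by auto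
    next
      case False
      then show ?thesis using F7[of e e'] e unfolding m'(2,3) by auto
    qed
  next
    fix e assume e: "e < i + 1" "e \<notin> ?M"
    then have "e < i" by (cases "e = i") auto
    show "\<exists>e'. n \<le> e' \<and> e' < i + 1 \<and> (fld 19 m' e' = e \<or> fld 20 m' e' = e)"
    proof (cases "e \<in> M")
      case True
      then have "e = l \<or> e = r" using e by auto
      then show ?thesis using M(5) unfolding m'(2,3) by (intro exI[of _ i]) auto
    next
      case False
      then obtain e' where "n \<le> e' \<and> e' < i \<and> (fld 19 m e' = e \<or> fld 20 m e' = e)"
        using F8 \<open>e < i\<close> by blast
      then show ?thesis unfolding m'(2,3) by (intro exI[of _ e']) auto
    qed
  next
    fix e assume e: "e < i + 1"
    show "table m' e = {(x, f). (x, f) \<in> reach s (?X e) \<and> x \<le> c}"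
    proof (cases "e = i")
      case True
      have "table m1 i = {(x, f). (x, f) \<in> reach s (Node k (X l) (X r)) \<and> x \<le> c}"
        unfolding tab reach_Node[OF dl]
      proof (rule set_eqI, rule iffI)
        fix q assume "q \<in> {(x + y, h) | x y f g h. x + y \<le> c \<and> (x, f) \<in> table m l \<and> (y, g) \<in> table m r \<and>
          (f, g, h) \<in> set (flag_combos k)}"
        then show "q \<in> {(x, f). (x, f) \<in> {(x + y, h) | x y f g h. (x, f) \<in> reach s (X l) \<and>
            (y, g) \<in> reach s (X r) \<and> (f, g, h) \<in> set (flag_combos k)} \<and> x \<le> c}"
          using F9[OF li(1)] F9[OF li(2)] by blast
      next
        fix q assume "q \<in> {(x, f). (x, f) \<in> {(x + y, h) | x y f g h. (x, f) \<in> reach s (X l) \<and>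
            (y, g) \<in> reach s (X r) \<and> (f, g, h) \<in> set (flag_combos k)} \<and> x \<le> c}"
        then obtain x y f g h where q: "q = (x + y, h)" "x + y \<le> c" "(x, f) \<in> reach s (X l)"
            "(y, g) \<in> reach s (X r)" "(f, g, h) \<in> set (flag_combos k)" by blast
        then have "(x, f) \<in> table m l" "(y, g) \<in> table m r"
          using F9[OF li(1)] F9[OF li(2)] by simp_all
        then show "q \<in> {(x + y, h) | x y f g h. x + y \<le> c \<and> (x, f) \<in> table m l \<and> (y, g) \<in> table m r \<and>
          (f, g, h) \<in> set (flag_combos k)}" using q by blast
      qed
      then show ?thesis using True tm by simp
    next
      case False
      then show ?thesis using e same_outside_table[OF so, of e] F9[of e] tm by simp
    qed
  next
    fix e assume "i + 1 \<le> e \<and> e < 2 * n"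
    then show "table m' e = {}" using same_outside_table[OF so, of e] F10[of e] tm by simp
  qed
qed

text \<open>\<open>M\<close>, \<open>D\<close>, \<open>X\<close> and the lists are ghost data tied
  to the memory. \<open>weak\<close> is the constraint of the input digraph, kept equivalent to that
  of the current multigraph.\<close>

definition main_state :: "(nat set \<Rightarrow> bool) \<Rightarrow> nat set \<Rightarrow> nat set \<Rightarrow> (nat \<Rightarrow> nat list) \<Rightarrow> (nat \<Rightarrow> nat list) \<Rightarrow>
    nat list \<Rightarrow> (nat \<Rightarrow> sptree) \<Rightarrow> state \<Rightarrow> bool" where
  "main_state weak M D inl outl st X \<sigma> \<longleftrightarrow>
    graph_state n (fld 12 (mem \<sigma>)) (fld 13 (mem \<sigma>)) M D (reg \<sigma> ''v'') inl outl st (reg \<sigma> ''id'')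
      (fld 15 (mem \<sigma>)) (fld 16 (mem \<sigma>)) (fld 17 (mem \<sigma>)) (fld 18 (mem \<sigma>)) \<and>
    (\<forall>w. lst (fld 10 (mem \<sigma>)) (fld 8 (mem \<sigma>) w) (inl w)) \<and>
    (\<forall>w. lst (fld 10 (mem \<sigma>)) (fld 9 (mem \<sigma>) w) (outl w)) \<and>
    lst (fld 11 (mem \<sigma>)) (reg \<sigma> ''top'') st \<and>
    forest X M (reg \<sigma> ''id'') (mem \<sigma>) \<and>
    (\<forall>A. weak A \<longleftrightarrow> constraint X (fld 12 (mem \<sigma>)) (fld 13 (mem \<sigma>)) M (n + 1) A)"

definition main_inv :: "(nat set \<Rightarrow> bool) \<Rightarrow> nat \<Rightarrow> state \<Rightarrow> bool" where
  "main_inv weak k \<sigma> \<longleftrightarrow> (\<exists>M D inl outl st X. main_state weak M D inl outl st X \<sigma> \<and>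
    k = graph_state.rest_work n (fld 12 (mem \<sigma>)) (fld 13 (mem \<sigma>)) M D (reg \<sigma> ''v'') inl outl)"

definition merge_time :: nat where
  "merge_time = (c + 2) * ((c + 2) * merge_cost + 30) + 10"

lemma inp_nonempty [simp]: "inp \<noteq> []"
  using length_inp_pos(1) by blast

lemma le_W: "x < NI \<Longrightarrow> x + 1 \<le> W" "x < NI \<Longrightarrow> Suc x \<le> W" "x < NI \<Longrightarrow> x \<le> W"
  using small_le_W[of "x + 1"] by auto

section \<open>The steps of the main loop as programs\<close>

lemma runs_merge_new:
  assumes regs: "reg \<tau> ''l'' = l" "reg \<tau> ''r'' = r" "reg \<tau> ''id'' = i" "reg \<tau> ''v'' = v" "reg \<tau> ''p'' = p"
    and lr: "l < i" "r < i" "i < 2 * n" and v: "v \<le> n + 1" and empty: "table (mem \<tau>) i = {}"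
    and post: "\<And>\<tau>' m2. reg \<tau>' ''v'' = v \<Longrightarrow> reg \<tau>' ''top'' = reg \<tau> ''top'' \<Longrightarrow> reg \<tau>' ''id'' = i + 1 \<Longrightarrow>
      same_outside i (mem \<tau>) m2 \<Longrightarrow> choice_ok k l r i m2 \<Longrightarrow>
      table m2 i = {(x + y, h) | x y f g h. x + y \<le> c \<and> (x, f) \<in> table (mem \<tau>) l \<and> (y, g) \<in> table (mem \<tau>) r \<and>
        (f, g, h) \<in> set (flag_combos k)} \<Longrightarrow>
      mem \<tau>' = upd 8 v (i + 1) (upd 10 i (fld 8 (mem \<tau>) v) (upd 13 i v (upd 12 i p (upd 20 i r (upd 19 i l m2))))) \<Longrightarrow>
      Q \<tau>'"
  shows "runs (Seq (merge_tables k) new_edge) \<tau> (merge_time + 100) Q"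
proof (rule runs_Seq_post[OF runs_merge_tables[OF regs(1-3) refl lr empty], where ?T2.0 = 100])
  fix \<rho> :: state
  assume r: "(\<exists>x y. reg \<rho> = (reg \<tau>)(''x'' := x, ''y'' := y)) \<and> same_outside i (mem \<tau>) (mem \<rho>) \<and> choice_ok k l r i (mem \<rho>) \<and>
    table (mem \<rho>) i = {(x + y, h) | x y f g h. x + y \<le> c \<and> (x, f) \<in> table (mem \<tau>) l \<and> (y, g) \<in> table (mem \<tau>) r \<and>
      (f, g, h) \<in> set (flag_combos k)}"
  then obtain x y where xy: "reg \<rho> = (reg \<tau>)(''x'' := x, ''y'' := y)" by blast
  have N: "i < NI" "v < NI" using lr v n_less_NI by auto
  have "fld 8 (mem \<rho>) = fld 8 (mem \<tau>)" using r unfolding same_outside_def by auto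
  moreover have "Q (\<rho>\<lparr>mem := upd 8 v (i + 1) (upd 10 i (fld 8 (mem \<tau>) v)
      (upd 13 i v (upd 12 i p (upd 20 i r (upd 19 i l (mem \<rho>)))))),
      reg := (reg \<tau>)(''x'' := x, ''y'' := y, ''id'' := i + 1)\<rparr>)"
    by (rule post[of _ "mem \<rho>"]) (use r regs in simp_all)
  ultimately have "wp new_edge Q \<rho>"
    using N le_W(1)[OF N(1)]
    by (simp add: new_edge_def xy regs fld_upd)
  then show "runs new_edge \<rho> 100 Q"
    by (rule runs_wp) (simp add: new_edge_def)
qed (simp add: merge_time_def)

text \<open>The end of both kinds of reduction: \<open>m1\<close> is the memory after the
  preparation, \<open>m2\<close> the memory after merging the tables.\<close>

lemma reduce_state:
  assumes ms: "main_state weak M D inl outl st X \<sigma>" and inv: "inl (reg \<sigma> ''v'') = e # xs"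
    and id: "reg \<sigma> ''id'' = i" "i < 2 * n" and v: "reg \<sigma> ''v'' = v"
    and lr: "l \<in> M" "e \<in> M" "l \<noteq> e"
    and m1: "\<And>f. f < 8 \<Longrightarrow> fld f m1 = fld f (mem \<sigma>)"
      "fld 8 m1 = (fld 8 (mem \<sigma>))(v := fld 10 (mem \<sigma>) e)"
      "\<And>f. f \<in> {9, 10, 11, 12, 13, 16, 18, 19, 20} \<Longrightarrow> fld f m1 = fld f (mem \<sigma>)"
    and so: "same_outside i m1 m2" and ch: "choice_ok k l e i m2"
    and tab: "table m2 i = {(x + y, h) | x y f g h. x + y \<le> c \<and> (x, f) \<in> table m1 l \<and> (y, g) \<in> table m1 e \<and>
        (f, g, h) \<in> set (flag_combos k)}"
    and mem: "mem \<tau> = upd 8 v (i + 1) (upd 10 i (fld 8 m1 v) (upd 13 i v (upd 12 i p (upd 20 i e (upd 19 i l m2)))))"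
    and regs: "reg \<tau> ''v'' = v" "reg \<tau> ''top'' = reg \<sigma> ''top''" "reg \<tau> ''id'' = i + 1"
    and gs: "graph_state n ((fld 12 (mem \<sigma>))(i := p)) ((fld 13 (mem \<sigma>))(i := v)) (insert i (M - {l, e})) D v
      (inl(v := i # xs)) outl st (i + 1) (fld 15 m1) (fld 16 (mem \<sigma>)) (fld 17 m1) (fld 18 (mem \<sigma>))"
    and work: "graph_state.rest_work n ((fld 12 (mem \<sigma>))(i := p)) ((fld 13 (mem \<sigma>))(i := v)) (insert i (M - {l, e})) D v
      (inl(v := i # xs)) outl < w"
    and con: "\<And>A. constraint (X(i := Node k (X l) (X e))) ((fld 12 (mem \<sigma>))(i := p)) ((fld 13 (mem \<sigma>))(i := v))
      (insert i (M - {l, e})) (n + 1) A \<longleftrightarrow> constraint X (fld 12 (mem \<sigma>)) (fld 13 (mem \<sigma>)) M (n + 1) A"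
  shows "\<exists>w'<w. main_inv weak w' \<tau>"
proof -
  have g: "graph_state n (fld 12 (mem \<sigma>)) (fld 13 (mem \<sigma>)) M D v inl outl st i
      (fld 15 (mem \<sigma>)) (fld 16 (mem \<sigma>)) (fld 17 (mem \<sigma>)) (fld 18 (mem \<sigma>))"
    and inl: "\<And>w. lst (fld 10 (mem \<sigma>)) (fld 8 (mem \<sigma>) w) (inl w)"
    and outl: "\<And>w. lst (fld 10 (mem \<sigma>)) (fld 9 (mem \<sigma>) w) (outl w)"
    and st: "lst (fld 11 (mem \<sigma>)) (reg \<sigma> ''top'') st"
    and F: "forest X M i (mem \<sigma>)"
    and wk: "\<And>A. weak A \<longleftrightarrow> constraint X (fld 12 (mem \<sigma>)) (fld 13 (mem \<sigma>)) M (n + 1) A"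
    using ms unfolding main_state_def id v by blast+
  interpret graph_state n "fld 12 (mem \<sigma>)" "fld 13 (mem \<sigma>)" M D v inl outl st i
      "fld 15 (mem \<sigma>)" "fld 16 (mem \<sigma>)" "fld 17 (mem \<sigma>)" "fld 18 (mem \<sigma>)" by (rule g)
  have m2: "fld f m2 = fld f m1" if "8 \<le> f" "f < 22" for f
    using so that unfolding same_outside_def by (auto simp: fun_eq_iff)
  have flds: "fld 12 (mem \<tau>) = (fld 12 (mem \<sigma>))(i := p)" "fld 13 (mem \<tau>) = (fld 13 (mem \<sigma>))(i := v)"
    "fld 8 (mem \<tau>) = (fld 8 (mem \<sigma>))(v := i + 1)" "fld 9 (mem \<tau>) = fld 9 (mem \<sigma>)"
    "fld 10 (mem \<tau>) = (fld 10 (mem \<sigma>))(i := fld 10 (mem \<sigma>) e)" "fld 11 (mem \<tau>) = fld 11 (mem \<sigma>)"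
    "fld 15 (mem \<tau>) = fld 15 m1" "fld 16 (mem \<tau>) = fld 16 (mem \<sigma>)" "fld 17 (mem \<tau>) = fld 17 m1"
    "fld 18 (mem \<tau>) = fld 18 (mem \<sigma>)" "fld 19 (mem \<tau>) = (fld 19 (mem \<sigma>))(i := l)"
    "fld 20 (mem \<tau>) = (fld 20 (mem \<sigma>))(i := e)"
    unfolding mem by (simp_all add: fld_upd m2 m1)
  have low: "fld f (mem \<tau>) = fld f m2" if "f < 8" for f
    unfolding mem using that by (simp add: fld_upd)
  have "table m1 = table (mem \<sigma>)" using m1(1) by (intro table_cong) simp
  \<comment> \<open>\<open>forest_step\<close> compares the tables with the memory before the step,
    from which \<open>m2\<close> also differs in list and bookkeeping fields. \<open>mm\<close>
    takes the table fields, those below 8, from \<open>m2\<close> and all others from the old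
    memory.\<close>
  define mm where "mm = (\<lambda>a. if a mod 22 < 8 then m2 a else mem \<sigma> a)"
  have mm: "fld f mm = (if f < 8 then fld f m2 else fld f (mem \<sigma>))" if "f < 22" for f
    using that unfolding mm_def fld_def by (auto simp: fun_eq_iff)
  have so2: "same_outside i (mem \<sigma>) mm"
    unfolding same_outside_def
  proof (intro allI impI)
    fix f j assume f: "f < (22::nat)" "8 \<le> f \<or> j < i * (c + 1) \<or> i * (c + 1) + c < j"
    show "fld f mm j = fld f (mem \<sigma>) j"
    proof (cases "f < 8")
      case True
      then have "fld f m2 j = fld f m1 j" using so f unfolding same_outside_def by auto
      then show ?thesis using True f mm m1(1) by simp
    qed (use f mm in simp)
  qed
  have tm: "table mm = table m2" by (rule table_cong) (simp add: mm)
  have cm: "choice_ok k l e i mm" using ch choice_ok_cong[of mm m2] mm by simp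
  have F': "forest (X(i := Node k (X l) (X e))) (insert i (M - {l, e})) (i + 1) (mem \<tau>)"
  proof (rule forest_step[OF F _ lr i_ge id(2) so2])
    show "M \<subseteq> {..<i}" using M_less by auto
    show "fld f (mem \<tau>) = fld f mm" if "f < 8" for f using low[OF that] mm that by simp
    show "table mm i = {(x + y, h) | x y f g h. x + y \<le> c \<and> (x, f) \<in> table (mem \<sigma>) l \<and> (y, g) \<in> table (mem \<sigma>) e \<and>
        (f, g, h) \<in> set (flag_combos k)}"
      unfolding tm tab \<open>table m1 = table (mem \<sigma>)\<close> ..
  qed (use flds cm in auto)
  have i_out: "i \<notin> set (inl w)" "i \<notin> set (outl w)" for w
    using in_list out_list i_notin by blast+
  have inl': "lst (fld 10 (mem \<tau>)) (fld 8 (mem \<tau>) w) ((inl(v := i # xs)) w)" for w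
    using inl[of w] inl[of v] i_out[of w] i_out[of v] inv unfolding flds v by auto
  have outl': "lst (fld 10 (mem \<tau>)) (fld 9 (mem \<tau>) w) (outl w)" for w
    using outl[of w] i_out[of w] unfolding flds by simp
  have "main_state weak (insert i (M - {l, e})) D (inl(v := i # xs)) outl st (X(i := Node k (X l) (X e))) \<tau>"
    unfolding main_state_def regs using gs inl' outl' st F' wk con unfolding flds by blast
  then show ?thesis
    unfolding main_inv_def using work unfolding regs flds[symmetric] by blast
qed

lemma runs_handle_edge:
  assumes ms: "main_state weak M D inl outl st X \<sigma>" and inv: "inl (reg \<sigma> ''v'') = e # xs"
    and id: "reg \<sigma> ''id'' + 1 < 2 * n"
    and w: "w = graph_state.rest_work n (fld 12 (mem \<sigma>)) (fld 13 (mem \<sigma>)) M D (reg \<sigma> ''v'') inl outl"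
  shows "runs (Seq pop_edge handle_edge) \<sigma> (merge_time + 500) (\<lambda>\<tau>. \<exists>w'<w. main_inv weak w' \<tau>)"
proof -
  define v where "v = reg \<sigma> ''v''"
  define i where "i = reg \<sigma> ''id''"
  define m where "m = mem \<sigma>"
  define u where "u = fld 12 m e"
  have g: "graph_state n (fld 12 m) (fld 13 m) M D v inl outl st i (fld 15 m) (fld 16 m) (fld 17 m) (fld 18 m)"
    and inl: "\<And>w. lst (fld 10 m) (fld 8 m w) (inl w)"
    and outl: "\<And>w. lst (fld 10 m) (fld 9 m w) (outl w)"
    and st: "lst (fld 11 m) (reg \<sigma> ''top'') st"
    and F: "forest X M i m"
    and wk: "\<And>A. weak A \<longleftrightarrow> constraint X (fld 12 m) (fld 13 m) M (n + 1) A"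
    using ms unfolding main_state_def i_def v_def m_def by blast+
  interpret graph_state n "fld 12 m" "fld 13 m" M D v inl outl st i "fld 15 m" "fld 16 m" "fld 17 m" "fld 18 m"
    by (rule g)
  have inv': "inl v = e # xs" using inv by (simp add: v_def)
  note e = pop_in[OF inv']
  have ei: "e < i" using M_less e(1) by blast
  have i2: "i < 2 * n" using id i_def by simp
  have NI2: "2 * n \<le> NI" "n + 1 < NI" using n_less_NI by auto
  have N: "v < NI" "e < NI" "u < NI" "i < NI"
    using v_le nodes_le[OF e(1)] ei i2 NI2 by (auto simp: u_def)
  have f8: "fld 8 m v = e + 1" using inl[of v] inv' by simp
  define m0 where "m0 = upd 8 v (fld 10 m e) m"
  define a where "a = fld 17 m u"
  define \<sigma>0 where "\<sigma>0 = \<sigma>\<lparr>mem := m0, reg := (reg \<sigma>)(''e'' := e, ''u'' := u, ''a'' := a)\<rparr>"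
  \<comment> \<open>A conjunction evaluates both operands, so the head of \<open>a - 1\<close> is
    looked up in any case. This is legal: stale entries of \<open>acc\<close> are still numbers
    below \<open>i\<close>, and for \<open>a = 0\<close> truncated subtraction gives record
    0.\<close>
  have a_less: "a - 1 < NI"
  proof (cases "a = 0")
    case False
    then have "a - 1 < i" using acc_old[of u "a - 1"] by (simp add: a_def)
    then show ?thesis using N by simp
  qed (use le_less_trans[OF le0 N(1)] in simp)
  have regs0: "reg \<sigma>0 ''v'' = v" "reg \<sigma>0 ''e'' = e" "reg \<sigma>0 ''u'' = u" "reg \<sigma>0 ''a'' = a" "reg \<sigma>0 ''id'' = i"
    "reg \<sigma>0 ''top'' = reg \<sigma> ''top''"
    by (simp_all add: \<sigma>0_def v_def i_def)
  have mem0: "mem \<sigma>0 = m0" by (simp add: \<sigma>0_def)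
  have fld0: "fld f m0 = (if f = 8 then (fld 8 m)(v := fld 10 m e) else fld f m)" if "f < 22" for f
    unfolding m0_def using that by (simp add: fld_upd)
  have tab0: "table m' i = {}" if "\<And>f. f < 8 \<Longrightarrow> fld f m' = fld f m" for m'
  proof -
    have "table m' = table m" using that by (intro table_cong) simp
    then show ?thesis using F i2 unfolding forest_def by simp
  qed
  let ?Q = "\<lambda>\<tau>. \<exists>w'<w. main_inv weak w' \<tau>"
  have w': "w = rest_work" unfolding w m_def v_def ..
  have "runs handle_edge \<sigma>0 (merge_time + 400) ?Q"
    unfolding handle_edge_def
  proof (rule runs_If[where T = "merge_time + 370"])
    show "safe_test \<sigma>0 (And (Less (Const 0) ra) (Equal (Fld 13 (Minus ra (Const 1))) rv))"
      using a_less by (simp add: regs0)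
  next
    assume h: "holds inp \<sigma>0 (And (Less (Const 0) ra) (Equal (Fld 13 (Minus ra (Const 1))) rv))"
    define l where "l = a - 1"
    have acc: "fld 17 m (fld 12 m e) = l + 1" "fld 13 m l = v"
      using h by (auto simp: regs0 mem0 fld0 a_def u_def l_def)
    note stp = step_parallel[OF inv' acc]
    have li: "l < i" using M_less stp(3) by blast
    define m1 where "m1 = upd 17 u 0 (upd 15 u (fld 15 m u - 1) m0)"
    define \<sigma>1 where "\<sigma>1 = \<sigma>0\<lparr>mem := m1, reg := (reg \<sigma>0)(''l'' := l, ''r'' := e, ''p'' := u)\<rparr>"
    have fld1: "fld f m1 = (if f = 15 then (fld 15 m)(u := fld 15 m u - 1) else if f = 17 then (fld 17 m)(u := 0)
      else if f = 8 then (fld 8 m)(v := fld 10 m e) else fld f m)" if "f < 22" for f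
      unfolding m1_def using that by (simp add: fld_upd fld0)
    have mem1: "mem \<sigma>1 = m1" by (simp add: \<sigma>1_def)
    have "runs (Seq (merge_tables False) new_edge) \<sigma>1 (merge_time + 100) ?Q"
    proof (rule runs_merge_new[where l = l and r = e and i = i and v = v and p = u])
      show "reg \<sigma>1 ''l'' = l" "reg \<sigma>1 ''r'' = e" "reg \<sigma>1 ''id'' = i" "reg \<sigma>1 ''v'' = v" "reg \<sigma>1 ''p'' = u"
        by (simp_all add: \<sigma>1_def regs0)
      show "table (mem \<sigma>1) i = {}" unfolding mem1 by (rule tab0) (simp add: fld1)
    next
      fix \<tau> :: state and m2
      assume r: "reg \<tau> ''v'' = v" "reg \<tau> ''top'' = reg \<sigma>1 ''top''" "reg \<tau> ''id'' = i + 1"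
        "same_outside i (mem \<sigma>1) m2" "choice_ok False l e i m2"
        "table m2 i = {(x + y, h) | x y f g h. x + y \<le> c \<and> (x, f) \<in> table (mem \<sigma>1) l \<and> (y, g) \<in> table (mem \<sigma>1) e \<and>
          (f, g, h) \<in> set (flag_combos False)}"
        "mem \<tau> = upd 8 v (i + 1) (upd 10 i (fld 8 (mem \<sigma>1) v) (upd 13 i v (upd 12 i u (upd 20 i e (upd 19 i l m2)))))"
      have top: "reg \<tau> ''top'' = reg \<sigma> ''top''" unfolding r(2) by (simp add: \<sigma>1_def regs0)
      show "?Q \<tau>"
      proof (rule reduce_state[OF ms inv i_def[symmetric] i2 v_def[symmetric] stp(3) e(1) stp(5) _ _ _ r(4-6)[unfolded mem1]
            r(7)[unfolded mem1] r(1) top r(3), folded m_def])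
        show "fld f m1 = fld f m" if "f < 8" for f using that by (simp add: fld1)
        show "fld 8 m1 = (fld 8 m)(v := fld 10 m e)" by (simp add: fld1)
        show "fld f m1 = fld f m" if "f \<in> {9, 10, 11, 12, 13, 16, 18, 19, 20}" for f using that by (auto simp: fld1)
        show "graph_state n ((fld 12 m)(i := u)) ((fld 13 m)(i := v)) (insert i (M - {l, e})) D v
          (inl(v := i # xs)) outl st (i + 1) (fld 15 m1) (fld 16 m) (fld 17 m1) (fld 18 m)"
          using stp(1) by (simp add: fld1 u_def del: fun_upd_apply)
        show "graph_state.rest_work n ((fld 12 m)(i := u)) ((fld 13 m)(i := v)) (insert i (M - {l, e})) D v
          (inl(v := i # xs)) outl < w"
          using stp(2) unfolding w' u_def .
        show "constraint (X(i := Node False (X l) (X e))) ((fld 12 m)(i := u)) ((fld 13 m)(i := v))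
            (insert i (M - {l, e})) (n + 1) A \<longleftrightarrow> constraint X (fld 12 m) (fld 13 m) M (n + 1) A" for A
          using constraint_parallel[OF stp(3) e(1) stp(5), of "fld 12 m" "fld 13 m" i X "n + 1" A] stp(4) acc(2) e(2) i_notin
          by (simp add: u_def del: fun_upd_apply)
      qed
    qed (use li ei i2 v_le in auto)
    then have "wp parallel_prep (\<lambda>\<tau>. runs (Seq (merge_tables False) new_edge) \<tau> (merge_time + 100) ?Q) \<sigma>0"
      using N by (simp add: parallel_prep_def regs0 mem0 \<sigma>1_def m1_def l_def fld0)
    then show "runs (Seq parallel_prep (Seq (merge_tables False) new_edge)) \<sigma>0 (merge_time + 370) ?Q"
      by (rule runs_Seq_wp) (simp add: parallel_prep_def)
  next
    assume "\<not> holds inp \<sigma>0 (And (Less (Const 0) ra) (Equal (Fld 13 (Minus ra (Const 1))) rv))"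
    then have na: "\<not> (0 < fld 17 m (fld 12 m e) \<and> fld 13 m (fld 17 m (fld 12 m e) - 1) = v)"
      by (auto simp: regs0 mem0 fld0 a_def u_def)
    show "runs (program.If (And (Equal (Fld 15 ru) (Const 1)) (test.Not (Equal ru (Plus inN (Const 1)))))
       (Seq series_prep (Seq (merge_tables True) new_edge)) settle_edge) \<sigma>0 (merge_time + 370) ?Q"
    proof (rule runs_If[where T = "merge_time + 340"])
      show "safe_test \<sigma>0 (And (Equal (Fld 15 ru) (Const 1)) (test.Not (Equal ru (Plus inN (Const 1)))))"
        using N le_W[OF NI2(2)] le_W[of n] NI2 by (simp add: regs0)
    next
      assume h: "holds inp \<sigma>0 (And (Equal (Fld 15 ru) (Const 1)) (test.Not (Equal ru (Plus inN (Const 1)))))"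
      have od1: "fld 15 m (fld 12 m e) = 1" "fld 12 m e \<noteq> n + 1"
        using h by (auto simp: regs0 mem0 fld0 u_def)
      define l where "l = fld 18 m u - 1"
      have pe: "fld 18 m (fld 12 m e) = l + 1"
        using pe_pred[OF e(1,3) od1(2)] by (metis add_diff_cancel_right' l_def u_def)
      note stp = step_series[OF inv' od1 pe]
      have li: "l < i" using M_less stp(3) by blast
      define p where "p = fld 12 m l"
      define \<sigma>1 where "\<sigma>1 = \<sigma>0\<lparr>reg := (reg \<sigma>0)(''l'' := l, ''r'' := e, ''p'' := p)\<rparr>"
      have mem1: "mem \<sigma>1 = m0" by (simp add: \<sigma>1_def mem0)
      have "runs (Seq (merge_tables True) new_edge) \<sigma>1 (merge_time + 100) ?Q"
      proof (rule runs_merge_new[where l = l and r = e and i = i and v = v and p = p])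
        show "reg \<sigma>1 ''l'' = l" "reg \<sigma>1 ''r'' = e" "reg \<sigma>1 ''id'' = i" "reg \<sigma>1 ''v'' = v" "reg \<sigma>1 ''p'' = p"
          by (simp_all add: \<sigma>1_def regs0)
        show "table (mem \<sigma>1) i = {}" unfolding mem1 by (rule tab0) (simp add: fld0)
      next
        fix \<tau> :: state and m2
        assume r: "reg \<tau> ''v'' = v" "reg \<tau> ''top'' = reg \<sigma>1 ''top''" "reg \<tau> ''id'' = i + 1"
          "same_outside i (mem \<sigma>1) m2" "choice_ok True l e i m2"
          "table m2 i = {(x + y, h) | x y f g h. x + y \<le> c \<and> (x, f) \<in> table (mem \<sigma>1) l \<and> (y, g) \<in> table (mem \<sigma>1) e \<and>
            (f, g, h) \<in> set (flag_combos True)}"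
          "mem \<tau> = upd 8 v (i + 1) (upd 10 i (fld 8 (mem \<sigma>1) v) (upd 13 i v (upd 12 i p (upd 20 i e (upd 19 i l m2)))))"
        have top: "reg \<tau> ''top'' = reg \<sigma> ''top''" unfolding r(2) by (simp add: \<sigma>1_def regs0)
        show "?Q \<tau>"
        proof (rule reduce_state[OF ms inv i_def[symmetric] i2 v_def[symmetric] stp(3) e(1) stp(5) _ _ _ r(4-6)[unfolded mem1]
              r(7)[unfolded mem1] r(1) top r(3), folded m_def])
          show "fld f m0 = fld f m" if "f < 8" for f using that by (simp add: fld0)
          show "fld 8 m0 = (fld 8 m)(v := fld 10 m e)" by (simp add: fld0)
          show "fld f m0 = fld f m" if "f \<in> {9, 10, 11, 12, 13, 16, 18, 19, 20}" for f using that by (auto simp: fld0)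
          show "graph_state n ((fld 12 m)(i := p)) ((fld 13 m)(i := v)) (insert i (M - {l, e})) D v
            (inl(v := i # xs)) outl st (i + 1) (fld 15 m0) (fld 16 m) (fld 17 m0) (fld 18 m)"
            using stp(1) by (simp add: fld0 p_def del: fun_upd_apply)
          show "graph_state.rest_work n ((fld 12 m)(i := p)) ((fld 13 m)(i := v)) (insert i (M - {l, e})) D v
            (inl(v := i # xs)) outl < w"
            using stp(2) unfolding w' p_def .
          have "v \<noteq> fld 12 m e" using e(4) by simp
          show "constraint (X(i := Node True (X l) (X e))) ((fld 12 m)(i := p)) ((fld 13 m)(i := v))
              (insert i (M - {l, e})) (n + 1) A \<longleftrightarrow> constraint X (fld 12 m) (fld 13 m) M (n + 1) A" for A
            using constraint_series[OF stp(3) e(1) stp(4) refl stp(8) _ od1(2) i_notin stp(6,7), of X A] e(2,4)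
            by (simp add: p_def del: fun_upd_apply)
        qed
      qed (use li ei i2 v_le in auto)
      then have "wp series_prep (\<lambda>\<tau>. runs (Seq (merge_tables True) new_edge) \<tau> (merge_time + 100) ?Q) \<sigma>0"
        using N less_trans[OF li N(4)] pe[folded u_def]
        by (simp add: series_prep_def regs0 mem0 \<sigma>1_def p_def fld0)
      then show "runs (Seq series_prep (Seq (merge_tables True) new_edge)) \<sigma>0 (merge_time + 340) ?Q"
        by (rule runs_Seq_wp) (simp add: series_prep_def)
    next
      assume h: "\<not> holds inp \<sigma>0 (And (Equal (Fld 15 ru) (Const 1)) (test.Not (Equal ru (Plus inN (Const 1)))))"
      then have no: "\<not> (fld 15 m (fld 12 m e) = 1 \<and> fld 12 m e \<noteq> n + 1)"
        by (auto simp: regs0 mem0 fld0 u_def)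
      note stp = step_settle[OF inv' na no]
      define m1 where "m1 = upd 18 v (e + 1) (upd 17 u (e + 1) m0)"
      have fld1: "fld f m1 = (if f = 17 then (fld 17 m)(u := e + 1) else if f = 18 then (fld 18 m)(v := e + 1)
        else if f = 8 then (fld 8 m)(v := fld 10 m e) else fld f m)" if "f < 22" for f
        unfolding m1_def using that by (simp add: fld_upd fld0)
      have "main_state weak M D (inl(v := xs)) outl st X (\<sigma>0\<lparr>mem := m1\<rparr>)"
        unfolding main_state_def
      proof (intro conjI allI)
        show "graph_state n (fld 12 (mem (\<sigma>0\<lparr>mem := m1\<rparr>))) (fld 13 (mem (\<sigma>0\<lparr>mem := m1\<rparr>))) M D
          (reg (\<sigma>0\<lparr>mem := m1\<rparr>) ''v'') (inl(v := xs)) outl st (reg (\<sigma>0\<lparr>mem := m1\<rparr>) ''id'')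
          (fld 15 (mem (\<sigma>0\<lparr>mem := m1\<rparr>))) (fld 16 (mem (\<sigma>0\<lparr>mem := m1\<rparr>))) (fld 17 (mem (\<sigma>0\<lparr>mem := m1\<rparr>)))
          (fld 18 (mem (\<sigma>0\<lparr>mem := m1\<rparr>)))"
          using stp(1) by (simp add: fld1 regs0 u_def del: fun_upd_apply)
        show "lst (fld 10 (mem (\<sigma>0\<lparr>mem := m1\<rparr>))) (fld 8 (mem (\<sigma>0\<lparr>mem := m1\<rparr>)) w) ((inl(v := xs)) w)" for w
          using inl[of w] inl[of v] inv' by (simp add: fld1)
        show "lst (fld 10 (mem (\<sigma>0\<lparr>mem := m1\<rparr>))) (fld 9 (mem (\<sigma>0\<lparr>mem := m1\<rparr>)) w) (outl w)" for w
          using outl[of w] by (simp add: fld1)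
        show "lst (fld 11 (mem (\<sigma>0\<lparr>mem := m1\<rparr>))) (reg (\<sigma>0\<lparr>mem := m1\<rparr>) ''top'') st"
          using st by (simp add: fld1 regs0)
        show "forest X M (reg (\<sigma>0\<lparr>mem := m1\<rparr>) ''id'') (mem (\<sigma>0\<lparr>mem := m1\<rparr>))"
          using forest_cong[OF F, of m1] by (simp add: fld1 regs0)
        show "weak A \<longleftrightarrow> constraint X (fld 12 (mem (\<sigma>0\<lparr>mem := m1\<rparr>))) (fld 13 (mem (\<sigma>0\<lparr>mem := m1\<rparr>))) M (n + 1) A" for A
          using wk[of A] by (simp add: fld1)
      qed
      moreover have "graph_state.rest_work n (fld 12 (mem (\<sigma>0\<lparr>mem := m1\<rparr>))) (fld 13 (mem (\<sigma>0\<lparr>mem := m1\<rparr>)))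
          M D (reg (\<sigma>0\<lparr>mem := m1\<rparr>) ''v'') (inl(v := xs)) outl < w"
        using stp(2) unfolding w' by (simp add: fld1 regs0)
      ultimately have "?Q (\<sigma>0\<lparr>mem := m1\<rparr>)"
        unfolding main_inv_def by blast
      then have "wp settle_edge ?Q \<sigma>0"
        using N le_W(1)[OF N(2)] by (simp add: settle_edge_def regs0 mem0 m1_def)
      then show "runs settle_edge \<sigma>0 (merge_time + 340) ?Q"
        by (rule runs_wp) (simp add: settle_edge_def)
    qed simp
  qed simp
  then have "wp pop_edge (\<lambda>\<tau>. runs handle_edge \<tau> (merge_time + 400) ?Q) \<sigma>"
    using N f8
    by (simp add: pop_edge_def \<sigma>0_def m0_def u_def a_def v_def[symmetric] m_def[symmetric])
  then show ?thesis
    by (rule runs_Seq_wp) (simp add: pop_edge_def)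
qed

lemma main_state_D:
  assumes "main_state weak M D inl outl st X \<sigma>"
  shows "graph_state n (fld 12 (mem \<sigma>)) (fld 13 (mem \<sigma>)) M D (reg \<sigma> ''v'') inl outl st (reg \<sigma> ''id'')
      (fld 15 (mem \<sigma>)) (fld 16 (mem \<sigma>)) (fld 17 (mem \<sigma>)) (fld 18 (mem \<sigma>))"
    and "lst (fld 10 (mem \<sigma>)) (fld 8 (mem \<sigma>) w) (inl w)"
    and "lst (fld 10 (mem \<sigma>)) (fld 9 (mem \<sigma>) w) (outl w)"
    and "lst (fld 11 (mem \<sigma>)) (reg \<sigma> ''top'') st"
    and "forest X M (reg \<sigma> ''id'') (mem \<sigma>)"
    and "weak A \<longleftrightarrow> constraint X (fld 12 (mem \<sigma>)) (fld 13 (mem \<sigma>)) M (n + 1) A"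
  using assms unfolding main_state_def by blast+

lemma runs_distribute_edge:
  assumes ms: "main_state weak M D inl outl st X \<sigma>" and iv: "inl (reg \<sigma> ''v'') = []"
    and ov: "outl (reg \<sigma> ''v'') = e # xs"
    and w: "w = graph_state.rest_work n (fld 12 (mem \<sigma>)) (fld 13 (mem \<sigma>)) M D (reg \<sigma> ''v'') inl outl"
  shows "runs distribute_edge \<sigma> (merge_time + 500) (\<lambda>\<tau>. \<exists>w'<w. main_inv weak w' \<tau>)"
proof -
  define v where "v = reg \<sigma> ''v''"
  define i where "i = reg \<sigma> ''id''"
  define m where "m = mem \<sigma>"
  define d where "d = fld 13 m e"
  note msD = main_state_D[OF ms, folded v_def i_def m_def]
  interpret graph_state n "fld 12 m" "fld 13 m" M D v inl outl st i "fld 15 m" "fld 16 m" "fld 17 m" "fld 18 m"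
    by (rule msD(1))
  have iv': "inl v = []" and ov': "outl v = e # xs" using iv ov by (simp_all add: v_def)
  note e = pop_out[OF ov']
  note stp = step_distribute[OF iv' ov', folded d_def]
  have ei: "e < i" using M_less e(1) by blast
  have "i \<le> 2 * n" using card_M by simp
  then have N: "v < NI" "e < NI" "d < NI"
    using v_le nodes_le[OF e(1)] ei n_less_NI by (auto simp: d_def)
  have f9: "fld 9 m v = e + 1" using msD(3)[of v] ov' by simp
  have dv: "d \<noteq> v" using e(3) by (auto simp: d_def)
  define m1 where "m1 = upd 16 d (fld 16 m d - 1) (upd 8 d (e + 1) (upd 10 e (fld 8 m d) (upd 9 v (fld 10 m e) m)))"
  have fld1: "fld f m1 = (if f = 16 then (fld 16 m)(d := fld 16 m d - 1) else if f = 8 then (fld 8 m)(d := e + 1)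
    else if f = 10 then (fld 10 m)(e := fld 8 m d) else if f = 9 then (fld 9 m)(v := fld 10 m e) else fld f m)"
    if "f < 22" for f
    unfolding m1_def using that by (simp add: fld_upd)
  let ?st = "if fld 16 m d = 1 then d # st else st"
  have e_out: "e \<notin> set (inl a)" "a \<noteq> v \<Longrightarrow> e \<notin> set (outl a)" for a
    using e(5) out_list[of e a] e(2) by auto
  have inl1: "lst ((fld 10 m)(e := fld 8 m d)) (((fld 8 m)(d := e + 1)) a) ((inl(d := e # inl d)) a)" for a
    using msD(2)[of a] msD(2)[of d] e_out(1)[of a] e_out(1)[of d] by simp
  have outl1: "lst ((fld 10 m)(e := fld 8 m d)) (((fld 9 m)(v := fld 10 m e)) a) ((outl(v := xs)) a)" for a
    using msD(3)[of a] msD(3)[of v] ov' e(4) e_out(2)[of a] by (cases "a = v") auto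
  have d_st: "d \<notin> set st" unfolding stack using e(1,2) ov' by (auto simp: d_def)
  have state: "\<exists>w'<w. main_inv weak w' \<tau>" if t: "reg \<tau> ''v'' = v" "reg \<tau> ''id'' = i" "lst (fld 11 (mem \<tau>)) (reg \<tau> ''top'') ?st"
    "\<And>f. f < 22 \<Longrightarrow> f \<noteq> 11 \<Longrightarrow> fld f (mem \<tau>) = fld f m1" for \<tau> :: state
  proof -
    have "main_state weak M D (inl(d := e # inl d)) (outl(v := xs)) ?st X \<tau>"
      unfolding main_state_def t(1,2)
    proof (intro conjI allI)
      show "graph_state n (fld 12 (mem \<tau>)) (fld 13 (mem \<tau>)) M D v (inl(d := e # inl d)) (outl(v := xs)) ?st i
          (fld 15 (mem \<tau>)) (fld 16 (mem \<tau>)) (fld 17 (mem \<tau>)) (fld 18 (mem \<tau>))"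
        using stp(1) by (simp add: t(4) fld1 del: fun_upd_apply)
      show "lst (fld 10 (mem \<tau>)) (fld 8 (mem \<tau>) w) ((inl(d := e # inl d)) w)" for w
        using inl1[of w] by (simp add: t(4) fld1 del: fun_upd_apply)
      show "lst (fld 10 (mem \<tau>)) (fld 9 (mem \<tau>) w) ((outl(v := xs)) w)" for w
        using outl1[of w] by (simp add: t(4) fld1 del: fun_upd_apply)
      show "lst (fld 11 (mem \<tau>)) (reg \<tau> ''top'') ?st" by (rule t(3))
      show "forest X M i (mem \<tau>)" by (rule forest_cong[OF msD(5)]) (simp_all add: t(4) fld1)
      show "weak A \<longleftrightarrow> constraint X (fld 12 (mem \<tau>)) (fld 13 (mem \<tau>)) M (n + 1) A" for A
        using msD(6)[of A] by (simp add: t(4) fld1)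
    qed
    moreover have "graph_state.rest_work n (fld 12 (mem \<tau>)) (fld 13 (mem \<tau>)) M D (reg \<tau> ''v'')
        (inl(d := e # inl d)) (outl(v := xs)) < w"
      using stp(2) unfolding w v_def[symmetric] m_def[symmetric] t(1) by (simp add: t(4) fld1)
    ultimately show ?thesis unfolding main_inv_def by blast
  qed
  define \<sigma>1 where "\<sigma>1 = \<sigma>\<lparr>reg := (reg \<sigma>)(''e'' := e, ''w'' := d), mem := m1\<rparr>"
  have r1: "reg \<sigma>1 ''v'' = v" "reg \<sigma>1 ''id'' = i" "reg \<sigma>1 ''w'' = d" "reg \<sigma>1 ''top'' = reg \<sigma> ''top''" "mem \<sigma>1 = m1"
    by (simp_all add: \<sigma>1_def v_def i_def)
  have pd: "fld 16 m1 d = 0 \<longleftrightarrow> fld 16 m d = 1" using e(6) by (auto simp: fld1 d_def)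
  let ?R = "\<lambda>\<tau>. \<exists>w'<w. main_inv weak w' \<tau>"
  have "wp (program.If (Equal (Fld 16 rw) (Const 0))
      (Seq (SetFld 11 rw rtop) (Assign ''top'' (Plus rw (Const 1)))) Skip) ?R \<sigma>1"
  proof (cases "fld 16 m d = 1")
    case True
    let ?\<tau> = "\<sigma>1\<lparr>mem := upd 11 d (reg \<sigma> ''top'') m1, reg := (reg \<sigma>1)(''top'' := d + 1)\<rparr>"
    have "?R ?\<tau>"
    proof (rule state)
      show "lst (fld 11 (mem ?\<tau>)) (reg ?\<tau> ''top'') ?st"
        using True msD(4) d_st by (simp add: fld1)
    qed (simp_all add: r1 fld_upd)
    then show ?thesis using True pd N le_W(1)[OF N(3)] by (simp add: r1)
  next
    case False
    have "?R \<sigma>1"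
      by (rule state) (use False msD(4) in \<open>simp_all add: r1 fld1\<close>)
    then show ?thesis using False pd N by (simp add: r1)
  qed
  then have "wp distribute_edge ?R \<sigma>"
    using N f9 le_W(1)[OF N(2)] dv
    by (simp add: distribute_edge_def \<sigma>1_def m1_def d_def v_def[symmetric] m_def[symmetric])
  then show ?thesis by (rule runs_wp) (simp add: distribute_edge_def)
qed

lemma runs_next_node:
  assumes ms: "main_state weak M D inl outl st X \<sigma>" and iv: "inl (reg \<sigma> ''v'') = []"
    and ov: "outl (reg \<sigma> ''v'') = []" and id: "reg \<sigma> ''id'' + 1 < 2 * n"
    and w: "w = graph_state.rest_work n (fld 12 (mem \<sigma>)) (fld 13 (mem \<sigma>)) M D (reg \<sigma> ''v'') inl outl"
  shows "runs next_node \<sigma> (merge_time + 500) (\<lambda>\<tau>. \<exists>w'<w. main_inv weak w' \<tau>)"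
proof -
  define v where "v = reg \<sigma> ''v''"
  define i where "i = reg \<sigma> ''id''"
  define m where "m = mem \<sigma>"
  note msD = main_state_D[OF ms, folded v_def i_def m_def]
  interpret graph_state n "fld 12 m" "fld 13 m" M D v inl outl st i "fld 15 m" "fld 16 m" "fld 17 m" "fld 18 m"
    by (rule msD(1))
  have iv': "inl v = []" and ov': "outl v = []" using iv ov by (simp_all add: v_def)
  \<comment> \<open>The loop test means that at least two edges are left, since edges and used
    numbers add up to \<open>2 * n\<close>; then \<open>stuck\<close> excludes an empty
    stack.\<close>
  have "st \<noteq> []"
  proof
    assume "st = []"
    then have "card M = 1" using stuck[OF iv' ov'] by simp
    then show False using card_M id i_def by simp
  qed
  then obtain d ds where st: "st = d # ds" by (cases st) auto
  note stp = step_next[OF iv' ov' st]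
  have "d \<le> n + 1" using stp(1) by (rule graph_state.v_le)
  then have N: "d < NI" using n_less_NI by simp
  have top: "reg \<sigma> ''top'' = d + 1" "lst (fld 11 m) (fld 11 m d) ds" using msD(4) st by auto
  let ?\<tau> = "\<sigma>\<lparr>reg := (reg \<sigma>)(''v'' := d, ''top'' := fld 11 m d)\<rparr>"
  have "main_state weak M (insert v D) inl outl ds X ?\<tau>"
    unfolding main_state_def using stp(1) msD top(2) by (simp add: m_def i_def)
  moreover have "graph_state.rest_work n (fld 12 (mem ?\<tau>)) (fld 13 (mem ?\<tau>)) M (insert v D) (reg ?\<tau> ''v'') inl outl < w"
    using stp(2) unfolding w by (simp add: m_def v_def)
  ultimately have "\<exists>w'<w. main_inv weak w' ?\<tau>" unfolding main_inv_def by blast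
  then have "wp next_node (\<lambda>\<tau>. \<exists>w'<w. main_inv weak w' \<tau>) \<sigma>"
    using N top(1) by (simp add: next_node_def m_def)
  then show ?thesis by (rule runs_wp) (simp add: next_node_def)
qed

lemma runs_main_body:
  assumes "main_inv weak w \<sigma>" and id: "reg \<sigma> ''id'' + 1 < 2 * n"
  shows "runs main_body \<sigma> (merge_time + 600) (\<lambda>\<tau>. \<exists>w'<w. main_inv weak w' \<tau>)"
proof -
  obtain M D inl outl st X where ms: "main_state weak M D inl outl st X \<sigma>"
    and w: "w = graph_state.rest_work n (fld 12 (mem \<sigma>)) (fld 13 (mem \<sigma>)) M D (reg \<sigma> ''v'') inl outl"
    using assms(1) unfolding main_inv_def by blast
  have "reg \<sigma> ''v'' \<le> n + 1" using main_state_D(1)[OF ms] by (rule graph_state.v_le)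
  then have N: "reg \<sigma> ''v'' < NI" using n_less_NI by simp
  note l8 = lst_pos[OF main_state_D(2)[OF ms, of "reg \<sigma> ''v''"]]
  note l9 = lst_pos[OF main_state_D(3)[OF ms, of "reg \<sigma> ''v''"]]
  let ?v = "reg \<sigma> ''v''"
  show ?thesis
    unfolding main_body_def
  proof (rule runs_If[where T = "merge_time + 550"])
    assume "holds inp \<sigma> (Less (Const 0) (Fld 8 rv))"
    then have "inl ?v \<noteq> []" using l8 by simp
    then obtain e xs where "inl ?v = e # xs" by (cases "inl ?v") auto
    from runs_handle_edge[OF ms this id w]
    show "runs (Seq pop_edge handle_edge) \<sigma> (merge_time + 550) (\<lambda>\<tau>. \<exists>w'<w. main_inv weak w' \<tau>)"
      by (rule runs_mono) auto
  next
    assume "\<not> holds inp \<sigma> (Less (Const 0) (Fld 8 rv))"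
    then have iv: "inl ?v = []" using l8 by simp
    show "runs (program.If (Less (Const 0) (Fld 9 rv)) distribute_edge next_node) \<sigma> (merge_time + 550)
        (\<lambda>\<tau>. \<exists>w'<w. main_inv weak w' \<tau>)"
    proof (rule runs_If[where T = "merge_time + 500"])
      assume "holds inp \<sigma> (Less (Const 0) (Fld 9 rv))"
      then have "outl ?v \<noteq> []" using l9 by simp
      then obtain e xs where "outl ?v = e # xs" by (cases "outl ?v") auto
      from runs_distribute_edge[OF ms iv this w]
      show "runs distribute_edge \<sigma> (merge_time + 500) (\<lambda>\<tau>. \<exists>w'<w. main_inv weak w' \<tau>)" .
    next
      assume "\<not> holds inp \<sigma> (Less (Const 0) (Fld 9 rv))"
      then have "outl ?v = []" using l9 by simp
      from runs_next_node[OF ms iv this id w]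
      show "runs next_node \<sigma> (merge_time + 500) (\<lambda>\<tau>. \<exists>w'<w. main_inv weak w' \<tau>)" .
    qed (use N in simp_all)
  qed (use N in simp_all)
qed

text \<open>\<open>2 * n - 2\<close> is the largest number in use at the end and thus the root of
  the whole tree; for a single item it is the item itself.\<close>

definition reduced :: "(nat set \<Rightarrow> bool) \<Rightarrow> state \<Rightarrow> bool" where
  "reduced weak \<sigma> \<longleftrightarrow> (\<exists>X. forest X {2 * n - 2} (2 * n - 1) (mem \<sigma>) \<and>
     (\<forall>A. weak A \<longleftrightarrow> valid (X (2 * n - 2)) A))"

lemma runs_main_loop:
  assumes "main_inv weak w \<sigma>"
  shows "runs main_loop \<sigma> ((w + 1) * (merge_time + 700)) (reduced weak)"
  unfolding main_loop_def
proof (rule runs_While_indexed[where I = "main_inv weak" and T = "merge_time + 600"])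
  show "main_inv weak w \<sigma>" by (rule assms)
next
  fix k and \<tau> :: state
  assume k: "main_inv weak k \<tau>"
  then obtain M D inl outl st X where ms: "main_state weak M D inl outl st X \<tau>"
    unfolding main_inv_def by blast
  interpret graph_state n "fld 12 (mem \<tau>)" "fld 13 (mem \<tau>)" M D "reg \<tau> ''v''" inl outl st "reg \<tau> ''id''"
      "fld 15 (mem \<tau>)" "fld 16 (mem \<tau>)" "fld 17 (mem \<tau>)" "fld 18 (mem \<tau>)"
    by (rule main_state_D(1)[OF ms])
  have le: "reg \<tau> ''id'' \<le> 2 * n" using card_M by simp
  have "2 * n + 1 \<le> 2 * n + n + n" using n_pos by simp
  then have "2 * n + 1 \<le> NI" using n_less_NI(1) by (rule order_trans)
  then have W: "2 * n + 1 \<le> W" by (intro small_le_W) simp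
  show "safe_test \<tau> (Less (Plus rid (Const 1)) (Times (Const 2) inN))"
    using le W by simp
  assume "\<not> holds inp \<tau> (Less (Plus rid (Const 1)) (Times (Const 2) inN))"
  then have "2 * n \<le> reg \<tau> ''id'' + 1" by simp
  moreover have "card M \<noteq> 0" using finite_M ttsp_terminals[OF sp] by auto
  ultimately have cM: "card M = 1" and id: "reg \<tau> ''id'' = 2 * n - 1" using card_M by linarith+
  then obtain r where M: "M = {r}" by (auto simp: card_1_singleton_iff)
  have F: "forest X {r} (2 * n - 1) (mem \<tau>)" using main_state_D(5)[OF ms] M id by simp
  \<comment> \<open>Consumed edges have a parent with a larger number, so the largest number in use
    is not consumed.\<close>
  have r: "r = 2 * n - 2"
  proof (rule ccontr)
    assume "r \<noteq> 2 * n - 2"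
    have lt: "2 * n - 2 < 2 * n - 1" using n_pos by simp
    from \<open>r \<noteq> 2 * n - 2\<close> obtain e' where e': "n \<le> e'" "e' < 2 * n - 1" "fld 19 (mem \<tau>) e' = 2 * n - 2 \<or> fld 20 (mem \<tau>) e' = 2 * n - 2"
      using forestD(8)[OF F, rule_format, of "2 * n - 2"] lt by auto
    then show False using forestD(5)[OF F, rule_format, of e'] by auto
  qed
  have "weak A \<longleftrightarrow> valid (X r) A" for A
  proof -
    have "fld 12 (mem \<tau>) r = n + 1" using ttsp_terminals[OF sp] M by auto
    moreover have "weak A \<longleftrightarrow> constraint X (fld 12 (mem \<tau>)) (fld 13 (mem \<tau>)) {r} (n + 1) A"
      using main_state_D(6)[OF ms, of A] M by simp
    ultimately show ?thesis by (simp add: constraint_def)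
  qed
  then show "reduced weak \<tau>" unfolding reduced_def using F r by blast
next
  fix k and \<tau> :: state
  assume "main_inv weak k \<tau>" "holds inp \<tau> (Less (Plus rid (Const 1)) (Times (Const 2) inN))"
  then show "runs main_body \<tau> (merge_time + 600) (\<lambda>\<tau>'. \<exists>k'<k. main_inv weak k' \<tau>')"
    by (intro runs_main_body) simp_all
next
  show "(w + 1) * (1 + test_cost (Less (Plus rid (Const 1)) (Times (Const 2) inN)) + (merge_time + 600))
      \<le> (w + 1) * (merge_time + 700)"
    by (intro mult_le_mono) auto
qed

end

section \<open>Reading the input\<close>

abbreviation "ri \<equiv> Reg ''i''"

text \<open>The head of the item \<open>u\<close> is named after its largest successor, which in a minimal
  series-parallel digraph depends only on the set of successors.\<close>

definition arc_body :: program where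
  "arc_body = Seq (Assign ''u'' (Input (Plus (Plus (Const 3) inN) (Times (Const 2) ri))))
     (Seq (Assign ''w'' (Input (Plus (Plus (Plus (Const 3) inN) (Times (Const 2) ri)) (Const 1))))
     (Seq (program.If (Less (Fld 13 ru) (Plus rw (Const 1))) (SetFld 13 ru (Plus rw (Const 1))) Skip)
     (Seq (SetFld 14 rw (Plus ru (Const 1))) (Assign ''i'' (Plus ri (Const 1))))))"

definition arc_loop :: program where
  "arc_loop = While (Less ri inM) arc_body"

definition size_of :: "expr \<Rightarrow> expr" where
  "size_of e = Input (Plus (Const 3) e)"

definition item_body :: program where
  "item_body = Seq (program.If (Equal (Fld 14 re) (Const 0)) (Assign ''u'' (Plus inN (Const 1)))
       (Assign ''u'' (Fld 13 (Minus (Fld 14 re) (Const 1)))))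
     (Seq (SetFld 12 re ru) (Seq (SetFld 10 re (Fld 9 ru)) (Seq (SetFld 9 ru (Plus re (Const 1)))
     (Seq (SetFld 15 ru (Plus (Fld 15 ru) (Const 1))) (Seq (Assign ''w'' (Fld 13 re))
     (Seq (SetFld 16 rw (Plus (Fld 16 rw) (Const 1))) (Seq (SetFld 0 (row re (Const 0)) (Const 1))
     (Seq (program.If (Less (size_of re) (Plus inC (Const 1))) (SetFld 3 (row re (size_of re)) (Const 1)) Skip)
       (Assign ''e'' (Plus re (Const 1)))))))))))"

definition item_loop :: program where
  "item_loop = While (Less re inN) item_body"

definition start :: program where
  "start = Seq (Assign ''v'' (Plus inN (Const 1))) (Seq (Assign ''id'' inN) (Assign ''top'' (Const 0)))"

context ssgw_ram
begin

text \<open>Bound and attainment together make field 13 of \<open>u\<close> its largest successor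
  plus one, or 0 if there is none; this avoids a maximum of a possibly empty set. Field 14 need only
  be some predecessor plus one.\<close>

definition arcs_read :: "nat \<Rightarrow> (nat \<Rightarrow> nat) \<Rightarrow> bool" where
  "arcs_read k m \<longleftrightarrow> (\<forall>f<22. f \<noteq> 13 \<longrightarrow> f \<noteq> 14 \<longrightarrow> fld f m = (\<lambda>_. 0)) \<and>
    (\<forall>(u, w)\<in>set (take k es). w + 1 \<le> fld 13 m u \<and> fld 14 m w \<noteq> 0) \<and>
    (\<forall>u w. fld 13 m u = w + 1 \<longrightarrow> (u, w) \<in> set (take k es)) \<and>
    (\<forall>u w. fld 14 m w = u + 1 \<longrightarrow> (u, w) \<in> set (take k es))"

lemma runs_arc_loop:
  "runs arc_loop initial_state ((length es + 1) * 200) (\<lambda>\<tau>. arcs_read (length es) (mem \<tau>) \<and> reg \<tau> ''e'' = 0)"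
  unfolding arc_loop_def
proof (rule runs_While[where I = "\<lambda>\<tau>. reg \<tau> ''i'' \<le> length es \<and> arcs_read (reg \<tau> ''i'') (mem \<tau>) \<and> reg \<tau> ''e'' = 0"
      and \<mu> = "\<lambda>\<tau>. length es - reg \<tau> ''i''" and T = 150])
  show "reg initial_state ''i'' \<le> length es \<and> arcs_read (reg initial_state ''i'') (mem initial_state) \<and>
      reg initial_state ''e'' = 0"
    by (simp add: initial_state_def arcs_read_def fld_def fun_eq_iff)
next
  fix \<sigma> :: state
  assume "reg \<sigma> ''i'' \<le> length es \<and> arcs_read (reg \<sigma> ''i'') (mem \<sigma>) \<and> reg \<sigma> ''e'' = 0"
  then show "safe_test \<sigma> (Less ri inM)" by simp
next
  fix \<sigma> :: state
  assume I: "reg \<sigma> ''i'' \<le> length es \<and> arcs_read (reg \<sigma> ''i'') (mem \<sigma>) \<and> reg \<sigma> ''e'' = 0"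
    and h: "holds inp \<sigma> (Less ri inM)"
  define i where "i = reg \<sigma> ''i''"
  define m where "m = mem \<sigma>"
  have i: "i < length es" using h by (simp add: i_def)
  obtain u w where uw: "es ! i = (u, w)" by (cases "es ! i") auto
  then have "(u, w) \<in> set es" using i nth_mem by metis
  then have lt: "u < n" "w < n" using arcs_less by auto
  have N: "u < NI" "w < NI" using lt n_less_NI(2) by simp_all
  have nth: "inp ! (3 + n + 2 * i) = u" "inp ! (3 + n + 2 * i + 1) = w"
    using inp_arc[OF i] uw by simp_all
  have len: "3 + n + 2 * i + 1 < length inp" using i by (simp add: length_inp)
  have le: "3 + n + 2 * i + 1 \<le> W" using len W_big by simp
  have R: "arcs_read i m" using I by (simp add: i_def m_def)
  have tk: "set (take (i + 1) es) = insert (u, w) (set (take i es))"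
    using i uw by (simp add: take_Suc_conv_app_nth)
  have step: "arcs_read (i + 1) (upd 14 w (u + 1) m')"
    if "m' = (if fld 13 m u < w + 1 then upd 13 u (w + 1) m else m)" for m'
  proof -
    have f13: "fld 13 m' = (if fld 13 m u < w + 1 then (fld 13 m)(u := w + 1) else fld 13 m)"
      and f14: "fld 14 m' = fld 14 m" and rest: "\<And>f. f < 22 \<Longrightarrow> f \<noteq> 13 \<Longrightarrow> fld f m' = fld f m"
      using that by (simp_all add: fld_upd)
    have A: "fld f m = (\<lambda>_. 0)" if "f < 22" "f \<noteq> 13" "f \<noteq> 14" for f
      using R that unfolding arcs_read_def by blast
    have B: "b + 1 \<le> fld 13 m a \<and> fld 14 m b \<noteq> 0" if "(a, b) \<in> set (take i es)" for a b
      using R that unfolding arcs_read_def by blast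
    have C: "(a, b) \<in> set (take i es)" if "fld 13 m a = b + 1" for a b
      using R that unfolding arcs_read_def by blast
    have D: "(a, b) \<in> set (take i es)" if "fld 14 m b = a + 1" for a b
      using R that unfolding arcs_read_def by blast
    show ?thesis
      unfolding arcs_read_def tk
    proof (intro conjI allI impI ballI)
      fix f :: nat assume "f < 22" "f \<noteq> 13" "f \<noteq> 14"
      then show "fld f (upd 14 w (u + 1) m') = (\<lambda>_. 0)" using A rest by (simp add: fld_upd)
    next
      fix p assume p: "p \<in> insert (u, w) (set (take i es))"
      show "case p of (a, b) \<Rightarrow> b + 1 \<le> fld 13 (upd 14 w (u + 1) m') a \<and> fld 14 (upd 14 w (u + 1) m') b \<noteq> 0"
        using p B f13 f14 by (cases p) force
    next
      fix a b assume "fld 13 (upd 14 w (u + 1) m') a = b + 1"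
      then show "(a, b) \<in> insert (u, w) (set (take i es))"
        using C[of a b] f13 by (cases "a = u"; cases "fld 13 m u < w + 1") auto
    next
      fix a b assume "fld 14 (upd 14 w (u + 1) m') b = a + 1"
      then show "(a, b) \<in> insert (u, w) (set (take i es))"
        using D[of b a] f14 by (cases "b = w") auto
    qed
  qed
  have "wp arc_body (\<lambda>\<tau>. (reg \<tau> ''i'' \<le> length es \<and> arcs_read (reg \<tau> ''i'') (mem \<tau>) \<and> reg \<tau> ''e'' = 0) \<and>
      length es - reg \<tau> ''i'' < length es - reg \<sigma> ''i'') \<sigma>"
    using i N le len nth I step[OF refl] le_W(1)[OF N(1)] le_W(1)[OF N(2)]
    by (cases "fld 13 m u < w + 1") (simp_all add: arc_body_def i_def[symmetric] m_def[symmetric])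
  then show "runs arc_body \<sigma> 150 (\<lambda>\<tau>. (reg \<tau> ''i'' \<le> length es \<and> arcs_read (reg \<tau> ''i'') (mem \<tau>) \<and> reg \<tau> ''e'' = 0) \<and>
      length es - reg \<tau> ''i'' < length es - reg \<sigma> ''i'')"
    by (rule runs_wp) (simp add: arc_body_def)
next
  fix \<sigma> :: state
  assume "reg \<sigma> ''i'' \<le> length es \<and> arcs_read (reg \<sigma> ''i'') (mem \<sigma>) \<and> reg \<sigma> ''e'' = 0" "\<not> holds inp \<sigma> (Less ri inM)"
  then have "reg \<sigma> ''i'' = length es" by simp
  then show "arcs_read (length es) (mem \<sigma>) \<and> reg \<sigma> ''e'' = 0"
    using \<open>reg \<sigma> ''i'' \<le> length es \<and> arcs_read (reg \<sigma> ''i'') (mem \<sigma>) \<and> reg \<sigma> ''e'' = 0\<close> by simp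
next
  show "(length es - reg initial_state ''i'' + 1) * (1 + test_cost (Less ri inM) + 150) \<le> (length es + 1) * 200"
    by (intro mult_le_mono) (auto simp: initial_state_def)
qed

text \<open>Heads are 0 for the sink and otherwise a largest successor plus one, hence at most
  \<open>n\<close>; this leaves \<open>n + 1\<close> as the name of the source.\<close>

definition item_org :: "(nat \<Rightarrow> nat) \<Rightarrow> (nat \<Rightarrow> nat) \<Rightarrow> nat \<Rightarrow> nat" where
  "item_org d pr e = (if pr e = 0 then n + 1 else d (pr e - 1))"

text \<open>Reversed, because the items are pushed onto the lists in ascending order.\<close>

definition out_items :: "(nat \<Rightarrow> nat) \<Rightarrow> nat \<Rightarrow> nat \<Rightarrow> nat list" where
  "out_items org k x = rev (filter (\<lambda>e. org e = x) [0..<k])"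

definition items_read :: "(nat \<Rightarrow> nat) \<Rightarrow> (nat \<Rightarrow> nat) \<Rightarrow> nat \<Rightarrow> (nat \<Rightarrow> nat) \<Rightarrow> bool" where
  "items_read d pr k m \<longleftrightarrow> fld 13 m = d \<and> fld 14 m = pr \<and>
    (\<forall>f\<in>{8, 11, 17, 18, 19, 20}. fld f m = (\<lambda>_. 0)) \<and>
    (\<forall>e<k. fld 12 m e = item_org d pr e) \<and>
    (\<forall>x. lst (fld 10 m) (fld 9 m x) (out_items (item_org d pr) k x)) \<and>
    (\<forall>x. fld 15 m x = card {e. e < k \<and> item_org d pr e = x}) \<and>
    (\<forall>x. fld 16 m x = card {e. e < k \<and> d e = x}) \<and>
    (\<forall>e<k. table m e = {(x, f). (x, f) \<in> reach s (Leaf e) \<and> x \<le> c}) \<and>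
    (\<forall>e\<ge>k. table m e = {})"

lemma arcs_read_items:
  assumes "arcs_read (length es) m"
  shows "items_read (fld 13 m) (fld 14 m) 0 m"
    and "fld 13 m u \<le> n" and "fld 14 m u \<le> n"
    and "u < n \<Longrightarrow> w < n \<Longrightarrow> (u, w) \<in> set es \<Longrightarrow> w + 1 \<le> fld 13 m u \<and> fld 14 m w \<noteq> 0"
    and "fld 13 m u = w + 1 \<Longrightarrow> (u, w) \<in> set es"
    and "fld 14 m w = u + 1 \<Longrightarrow> (u, w) \<in> set es"
proof -
  have A: "fld f m = (\<lambda>_. 0)" if "f < 22" "f \<noteq> 13" "f \<noteq> 14" for f
    using assms that unfolding arcs_read_def by blast
  show B: "fld 13 m u = w + 1 \<Longrightarrow> (u, w) \<in> set es" for u w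
    using assms unfolding arcs_read_def by simp
  show C: "fld 14 m w = u + 1 \<Longrightarrow> (u, w) \<in> set es" for u w
    using assms unfolding arcs_read_def by simp
  show "fld 13 m u \<le> n"
    using B[of u "fld 13 m u - 1"] arcs_less[of u "fld 13 m u - 1"] by (cases "fld 13 m u = 0") auto
  show "fld 14 m u \<le> n"
    using C[of u "fld 14 m u - 1"] arcs_less[of "fld 14 m u - 1" u] by (cases "fld 14 m u = 0") auto
  show "u < n \<Longrightarrow> w < n \<Longrightarrow> (u, w) \<in> set es \<Longrightarrow> w + 1 \<le> fld 13 m u \<and> fld 14 m w \<noteq> 0"
    using assms unfolding arcs_read_def by auto
  have "table m e = {}" for e using A by (auto simp: table_def)
  then show "items_read (fld 13 m) (fld 14 m) 0 m"
    using A by (simp add: items_read_def out_items_def)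
qed

lemma card_less_Suc: "card {e. e < Suc k \<and> P e} = card {e. e < k \<and> P e} + (if P k then 1 else 0)"
proof -
  have "{e. e < Suc k \<and> P e} = (if P k then insert k {e. e < k \<and> P e} else {e. e < k \<and> P e})"
    by (auto simp: less_Suc_eq)
  then show ?thesis by simp
qed

lemma runs_item_loop:
  assumes "arcs_read (length es) m" "mem \<sigma> = m" "reg \<sigma> ''e'' = 0" and sizes: "\<And>e. e < n \<Longrightarrow> 0 < s e"
  shows "runs item_loop \<sigma> ((n + 1) * 300) (\<lambda>\<tau>. items_read (fld 13 m) (fld 14 m) n (mem \<tau>))"
proof -
  define d where "d = fld 13 m"
  define pr where "pr = fld 14 m"
  note rd = arcs_read_items[OF assms(1), folded d_def pr_def]
  let ?o = "item_org d pr"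
  have o_le: "?o e \<le> n + 1" for e unfolding item_org_def using rd(2)[of "pr e - 1"] by auto
  have NI1: "n + 1 < NI" by (rule n_less_NI(2))
  have body: "wp item_body (\<lambda>\<tau>. reg \<tau> ''e'' = Suc k \<and> items_read d pr (Suc k) (mem \<tau>)) \<sigma>"
    if k: "reg \<sigma> ''e'' = k" "k < n" and R: "items_read d pr k (mem \<sigma>)" for \<sigma> :: state and k
  proof -
    define m where "m = mem \<sigma>"
    let ?u = "?o k" and ?w = "d k"
    have N: "k < NI" "?u < NI" "?w < NI" "pr k < NI" "pr k - 1 < NI" "k < 2 * n"
      using NI1 k o_le[of k] rd(2)[of k] rd(3)[of k] by simp_all
    define m1 where "m1 = upd 0 (k * (c + 1)) 1 (upd 16 ?w (fld 16 m ?w + 1) (upd 15 ?u (fld 15 m ?u + 1)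
      (upd 9 ?u (k + 1) (upd 10 k (fld 9 m ?u) (upd 12 k ?u m)))))"
    define m2 where "m2 = (if s k < c + 1 then upd 3 (k * (c + 1) + s k) 1 m1 else m1)"
    have fld2: "fld f m2 = (if f = 3 \<and> s k \<le> c then (fld 3 m)(k * (c + 1) + s k := 1) else
      if f = 0 then (fld 0 m)(k * (c + 1) := 1) else if f = 16 then (fld 16 m)(?w := fld 16 m ?w + 1) else
      if f = 15 then (fld 15 m)(?u := fld 15 m ?u + 1) else if f = 9 then (fld 9 m)(?u := k + 1) else
      if f = 10 then (fld 10 m)(k := fld 9 m ?u) else if f = 12 then (fld 12 m)(k := ?u) else fld f m)"
      if "f < 22" for f
      unfolding m2_def m1_def using that by (simp add: fld_upd)
    have R13: "fld 13 m = d" "fld 14 m = pr"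
      and Rz: "\<And>f. f \<in> {8, 11, 17, 18, 19, 20} \<Longrightarrow> fld f m = (\<lambda>_. 0)"
      and R12: "\<And>e. e < k \<Longrightarrow> fld 12 m e = ?o e"
      and Rl: "\<And>x. lst (fld 10 m) (fld 9 m x) (out_items ?o k x)"
      and R15: "\<And>x. fld 15 m x = card {e. e < k \<and> ?o e = x}"
      and R16: "\<And>x. fld 16 m x = card {e. e < k \<and> d e = x}"
      and Rt: "\<And>e. e < k \<Longrightarrow> table m e = {(x, f). (x, f) \<in> reach s (Leaf e) \<and> x \<le> c}"
      and Rt0: "\<And>e. k \<le> e \<Longrightarrow> table m e = {}"
      using R unfolding items_read_def m_def by blast+
    have card_le: "card {e. e < k \<and> P e} + 1 \<le> W" for P
    proof -
      have "card {e. e < k \<and> P e} \<le> card {..<k}" by (intro card_mono) auto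
      then have "card {e. e < k \<and> P e} + 1 \<le> n" using k by simp
      also have "n \<le> W" using le_W(3)[OF NI1] by simp
      finally show ?thesis .
    qed
    have out: "out_items ?o (Suc k) x = (if ?o k = x then k # out_items ?o k x else out_items ?o k x)" for x
      by (simp add: out_items_def)
    have k_out: "k \<notin> set (out_items ?o k x)" for x by (simp add: out_items_def)
    \<comment> \<open>Reading an item also changes bookkeeping fields, so
      \<open>same_outside\<close> is proved for a mixture of the new table fields and the old other
      fields.\<close>
    have so: "same_outside k m m3" if "m3 = (\<lambda>a. if a mod 22 < 8 then m2 a else m a)" for m3
      unfolding same_outside_def
    proof (intro allI impI)
      fix f j assume f: "f < (22::nat)" "8 \<le> f \<or> j < k * (c + 1) \<or> k * (c + 1) + c < j"
      have "fld f m3 = (if f < 8 then fld f m2 else fld f m)"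
        unfolding that fld_def using f by (auto simp: fun_eq_iff)
      then show "fld f m3 j = fld f m j" using f fld2[of f] by auto
    qed
    have t2: "table m2 e = table m e" if "e \<noteq> k" for e
    proof -
      have "table (\<lambda>a. if a mod 22 < 8 then m2 a else m a) = table m2"
        by (rule table_cong) (auto simp: fld_def fun_eq_iff)
      then show ?thesis using same_outside_table[OF so[OF refl] that] by simp
    qed
    have zero: "fld f m (k * (c + 1) + x) = 0" if "f < 4" "x \<le> c" for f x
      using Rt0[of k] that unfolding table_def by auto
    have tk: "table m2 k = {(x, f). (x, f) \<in> reach s (Leaf k) \<and> x \<le> c}"
    proof (rule set_eqI)
      fix p :: "nat \<times> nat"
      obtain x f where p: "p = (x, f)" by (cases p)
      have "p \<in> table m2 k \<longleftrightarrow> x \<le> c \<and> f < 4 \<and> (f = 0 \<and> x = 0 \<or> f = 3 \<and> x = s k)"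
      proof (cases "x \<le> c \<and> f < 4")
        case True
        then have z: "fld f m (k * (c + 1) + x) = 0" using zero by blast
        consider "f = 0" | "f = 3" | "f \<noteq> 0" "f \<noteq> 3" by blast
        then have "fld f m2 (k * (c + 1) + x) \<noteq> 0 \<longleftrightarrow> f = 0 \<and> x = 0 \<or> f = 3 \<and> x = s k"
        proof cases
          case 1
          then show ?thesis using z fld2[of 0] by simp
        next
          case 2
          then show ?thesis using z fld2[of 3] True sizes[OF k(2)] by simp
        next
          case 3
          then have "fld f m2 = fld f m" using fld2[of f] True by simp
          then show ?thesis using 3 z by simp
        qed
        then show ?thesis using True by (simp add: p table_def)
      qed (auto simp: p table_def)
      then show "p \<in> table m2 k \<longleftrightarrow> p \<in> {(x, f). (x, f) \<in> reach s (Leaf k) \<and> x \<le> c}"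
        unfolding p reach_Leaf by auto
    qed
    have "items_read d pr (Suc k) m2"
      unfolding items_read_def
    proof (intro conjI allI impI ballI)
      show "fld 13 m2 = d" "fld 14 m2 = pr" using R13 by (simp_all add: fld2)
      show "fld f m2 = (\<lambda>_. 0)" if "f \<in> {8, 11, 17, 18, 19, 20}" for f
        using Rz[OF that] that by (auto simp: fld2)
      show "fld 12 m2 e = ?o e" if "e < Suc k" for e using that R12[of e] by (auto simp: fld2 less_Suc_eq)
      show "lst (fld 10 m2) (fld 9 m2 x) (out_items ?o (Suc k) x)" for x
        using Rl[of x] k_out[of x] unfolding out by (auto simp: fld2)
      show "fld 15 m2 x = card {e. e < Suc k \<and> ?o e = x}" for x
        unfolding card_less_Suc using R15[of x] by (auto simp: fld2)
      show "fld 16 m2 x = card {e. e < Suc k \<and> d e = x}" for x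
        unfolding card_less_Suc using R16[of x] by (auto simp: fld2)
      show "table m2 e = {(x, f). (x, f) \<in> reach s (Leaf e) \<and> x \<le> c}" if "e < Suc k" for e
        using that tk t2[of e] Rt[of e] by (cases "e = k") auto
      show "table m2 e = {}" if "Suc k \<le> e" for e using that t2[of e] Rt0[of e] by simp
    qed
    moreover have "inp ! (3 + k) = s k" using k by (intro inp_size)
    moreover have "3 + k < length inp" using k by (simp add: length_inp)
    moreover have "3 + k \<le> W" using k W_big by (simp add: length_inp)
    moreover have "fits f (k * (c + 1) + x)" if "f < 22" "x \<le> c" for f x
      using row_less[OF N(6) that(2)] that(1) by (rule fitsI)
    from this[of 0 0] this[of 3 "s k"] have "fits 0 (k * (c + 1))" "s k \<le> c \<Longrightarrow> fits 3 (k * (c + 1) + s k)" by simp_all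
    moreover have "c + 1 \<le> W" "n + 1 \<le> W" using c_less_NI NI1 le_W by auto
    moreover have "fld 15 m ?u + 1 \<le> W" "fld 16 m ?w + 1 \<le> W" unfolding R15 R16 by (rule card_le)+
    moreover have "d (pr k - Suc 0) = ?u" if "pr k \<noteq> 0" using that by (simp add: item_org_def)
    moreover have "n + 1 = ?u" if "pr k = 0" using that by (simp add: item_org_def)
    ultimately show ?thesis
      using N k le_W(1)[OF N(1)]
      by (cases "pr k = 0"; cases "s k \<le> c")
        (simp_all add: item_body_def size_of_def m_def[symmetric] R13 m2_def m1_def fld_upd less_Suc_eq_le)
  qed
  have "runs item_loop \<sigma> ((n + 1) * 300) (\<lambda>\<tau>. items_read d pr n (mem \<tau>))"
    unfolding item_loop_def
  proof (rule runs_While[where I = "\<lambda>\<tau>. reg \<tau> ''e'' \<le> n \<and> items_read d pr (reg \<tau> ''e'') (mem \<tau>)"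
        and \<mu> = "\<lambda>\<tau>. n - reg \<tau> ''e''" and T = 250])
    show "reg \<sigma> ''e'' \<le> n \<and> items_read d pr (reg \<sigma> ''e'') (mem \<sigma>)" using assms rd(1) by simp
  next
    fix \<tau> :: state
    assume "reg \<tau> ''e'' \<le> n \<and> items_read d pr (reg \<tau> ''e'') (mem \<tau>)"
    then show "safe_test \<tau> (Less re inN)" by simp
  next
    fix \<tau> :: state
    assume I: "reg \<tau> ''e'' \<le> n \<and> items_read d pr (reg \<tau> ''e'') (mem \<tau>)" and "holds inp \<tau> (Less re inN)"
    then have "reg \<tau> ''e'' < n" by simp
    from wp_mono[OF body[OF refl this conjunct2[OF I]]] this
    have "wp item_body (\<lambda>\<tau>'. (reg \<tau>' ''e'' \<le> n \<and> items_read d pr (reg \<tau>' ''e'') (mem \<tau>')) \<and>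
        n - reg \<tau>' ''e'' < n - reg \<tau> ''e'') \<tau>" by simp
    then show "runs item_body \<tau> 250 (\<lambda>\<tau>'. (reg \<tau>' ''e'' \<le> n \<and> items_read d pr (reg \<tau>' ''e'') (mem \<tau>')) \<and>
        n - reg \<tau>' ''e'' < n - reg \<tau> ''e'')"
      by (rule runs_wp) (simp add: item_body_def size_of_def row_def)
  next
    fix \<tau> :: state
    assume I: "reg \<tau> ''e'' \<le> n \<and> items_read d pr (reg \<tau> ''e'') (mem \<tau>)" and "\<not> holds inp \<tau> (Less re inN)"
    then have "reg \<tau> ''e'' = n" by simp
    then show "items_read d pr n (mem \<tau>)" using I by simp
  next
    show "(n - reg \<sigma> ''e'' + 1) * (1 + test_cost (Less re inN) + 250) \<le> (n + 1) * 300"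
      by (intro mult_le_mono) auto
  qed
  then show ?thesis unfolding d_def pr_def .
qed

text \<open>Items with a common successor have the same successors and so the same largest one;
  therefore any predecessor can supply the tail of an item. Conversely, equal nonzero heads mean a
  common successor, and \<open>msp_biclique\<close> transfers the arc.\<close>

lemma items_line_rep:
  assumes G: "minimal_series_parallel G" "pverts G = {..<n}" "parcs G = set es"
    and rd: "arcs_read (length es) m"
  shows "line_rep G (item_org (fld 13 m) (fld 14 m)) (fld 13 m) (n + 1) 0"
proof -
  define d where "d = fld 13 m"
  define pr where "pr = fld 14 m"
  note r = arcs_read_items[OF rd, folded d_def pr_def]
  have arc: "(u, w) \<in> set es \<Longrightarrow> w + 1 \<le> d u \<and> pr w \<noteq> 0" for u w
    using r(4)[of u w] arcs_less[of u w] by blast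
  have bi: "(u, v) \<in> set es \<Longrightarrow> (u', v) \<in> set es \<Longrightarrow> (u, w) \<in> set es \<Longrightarrow> (u', w) \<in> set es" for u v u' w
    using msp_biclique[OF G(1)] unfolding G(3) .
  have same: "d u = d p" if "(u, v) \<in> set es" "(p, v) \<in> set es" for u v p
  proof -
    have *: "d a \<le> d b" if "(a, v) \<in> set es" "(b, v) \<in> set es" for a b
    proof -
      have "d a = (d a - 1) + 1" using arc[OF that(1)] by simp
      then have "(a, d a - 1) \<in> set es" by (rule r(5))
      then have "(b, d a - 1) \<in> set es" using bi[OF that] by blast
      then show ?thesis using arc by fastforce
    qed
    show ?thesis using *[of u p] *[of p u] that by simp
  qed
  have org: "pr v \<noteq> 0 \<Longrightarrow> (pr v - 1, v) \<in> set es \<and> item_org d pr v = d (pr v - 1)" for v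
    using r(6)[of v "pr v - 1"] by (simp add: item_org_def)
  have arcs: "(u, v) \<in> set es \<longleftrightarrow> d u = item_org d pr v" for u v
  proof
    assume uv: "(u, v) \<in> set es"
    then have p: "pr v \<noteq> 0" using arc by blast
    then show "d u = item_org d pr v" using same[OF uv, of "pr v - 1"] org[OF p] by simp
  next
    assume eq: "d u = item_org d pr v"
    have p: "pr v \<noteq> 0"
    proof
      assume "pr v = 0"
      then show False using eq r(2)[of u] by (simp add: item_org_def)
    qed
    have pv: "(pr v - 1, v) \<in> set es" "d u = d (pr v - 1)" using org[OF p] eq by auto
    then have "0 < d u" using arc[OF pv(1)] by simp
    then have "d u = (d u - 1) + 1" by simp
    then have "(u, d u - 1) \<in> set es" "(pr v - 1, d u - 1) \<in> set es"
      using r(5)[of u "d u - 1"] r(5)[of "pr v - 1" "d u - 1"] pv(2) by simp_all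
    then show "(u, v) \<in> set es" using bi pv(1) by blast
  qed
  have src: "item_org d pr v = n + 1 \<longleftrightarrow> v \<in> sources G" if "v < n" for v
  proof -
    have "item_org d pr v = n + 1 \<longleftrightarrow> pr v = 0"
      using r(2)[of "pr v - 1"] by (auto simp: item_org_def)
    also have "\<dots> \<longleftrightarrow> (\<forall>u. (u, v) \<notin> set es)" using org[of v] arc by blast
    finally show ?thesis using that G by (simp add: sources_def)
  qed
  have snk: "d v = 0 \<longleftrightarrow> v \<in> sinks G" if "v < n" for v
  proof -
    have "d v = 0 \<longleftrightarrow> (\<forall>w. (v, w) \<notin> set es)"
      using r(5)[of v "d v - 1"] arc[of v] by (cases "d v") fastforce+
    then show ?thesis using that G by (simp add: sinks_def)
  qed
  show ?thesis
    unfolding line_rep_def G d_def[symmetric] pr_def[symmetric] using arcs src snk by simp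
qed

text \<open>The source is current and no node finished, so the items with their out-lists are the
  whole multigraph. The bound adds up \<open>n\<close> edges, at most \<open>n\<close> to settle, at
  most \<open>n\<close> to distribute, and \<open>n + 1\<close> nodes besides the source.\<close>

lemma start_main_inv:
  assumes G: "minimal_series_parallel G" "pverts G = {..<n}" "parcs G = set es"
    and rd: "arcs_read (length es) m" and it: "items_read (fld 13 m) (fld 14 m) n (mem \<sigma>)"
    and regs: "reg \<sigma> ''v'' = n + 1" "reg \<sigma> ''id'' = n" "reg \<sigma> ''top'' = 0"
  shows "\<exists>w\<le>4 * n + 1. main_inv (weak_digraph_constraint G) w \<sigma>"
proof -
  define d where "d = fld 13 m"
  define pr where "pr = fld 14 m"
  define m' where "m' = mem \<sigma>"
  let ?o = "item_org d pr" and ?org = "fld 12 m'" and ?M = "{..<n}"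
  note r = arcs_read_items[OF rd, folded d_def pr_def]
  have o_le: "?o e \<le> n + 1" for e unfolding item_org_def using r(2)[of "pr e - 1"] by auto
  have R13: "fld 13 m' = d" "fld 14 m' = pr"
    and Rz: "\<And>f. f \<in> {8, 11, 17, 18, 19, 20} \<Longrightarrow> fld f m' = (\<lambda>_. 0)"
    and R12: "\<And>e. e < n \<Longrightarrow> ?org e = ?o e"
    and Rl: "\<And>x. lst (fld 10 m') (fld 9 m' x) (out_items ?o n x)"
    and R15: "\<And>x. fld 15 m' x = card {e. e < n \<and> ?o e = x}"
    and R16: "\<And>x. fld 16 m' x = card {e. e < n \<and> d e = x}"
    and Rt: "\<And>e. e < n \<Longrightarrow> table m' e = {(x, f). (x, f) \<in> reach s (Leaf e) \<and> x \<le> c}"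
    and Rt0: "\<And>e. n \<le> e \<Longrightarrow> table m' e = {}"
    using it[folded d_def pr_def] unfolding items_read_def m'_def by blast+
  have out: "set (out_items ?o n x) = {e \<in> ?M. ?org e = x}" for x
    using R12 by (auto simp: out_items_def)
  have lr: "line_rep G ?o d (n + 1) 0" using items_line_rep[OF G rd] unfolding d_def pr_def .
  have tt: "ttsp ?org d ?M (n + 1) 0"
    by (rule ttsp_cong[OF msp_ttsp[OF G(1) lr, unfolded G(2)]]) (use R12 in simp)
  have d_le: "d e \<le> n" for e by (rule r(2))
  have dn: "d e \<noteq> n + 1" for e using d_le[of e] by simp
  have gs: "graph_state n ?org d ?M {} (n + 1) (\<lambda>_. []) (out_items ?o n) [] n (fld 15 m') (fld 16 m')
      (\<lambda>_. 0) (\<lambda>_. 0)"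
  proof
    show "ttsp ?org d ?M (n + 1) 0" by (rule tt)
    show "?org e \<le> n + 1 \<and> d e \<le> n + 1" if "e \<in> ?M" for e using that R12[of e] o_le[of e] d_le[of e] by simp
    show "set (out_items ?o n x) = {e \<in> ?M. ?org e = x}" for x by (rule out)
    show "set (out_items ?o n (n + 1)) \<subseteq> {e \<in> ?M. ?org e = n + 1}" using out by simp
    show "distinct (out_items ?o n x)" for x by (simp add: out_items_def)
    show "set [] = {e \<in> ?M. d e = w \<and> ?org e \<in> insert (n + 1) {} \<and> e \<notin> set (out_items ?o n (?org e))}" for w
      using out by auto
    show "fld 16 m' w = card {e \<in> ?M. d e = w \<and> (?org e \<notin> insert (n + 1) {} \<or> e \<in> set (out_items ?o n (?org e)))}" for w
    proof -
      have "{e \<in> ?M. d e = w \<and> (?org e \<notin> insert (n + 1) {} \<or> e \<in> set (out_items ?o n (?org e)))} = {e. e < n \<and> d e = w}"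
        unfolding out by auto
      then show ?thesis using R16[of w] by simp
    qed
    show "fld 15 m' (?org e) = card {e' \<in> ?M. ?org e' = ?org e}" if "e \<in> ?M" for e
    proof -
      have "{e' \<in> ?M. ?org e' = ?org e} = {e'. e' < n \<and> ?o e' = ?org e}" using R12 by auto
      then show ?thesis using R15 by simp
    qed
    show "set [] = {w. w \<notin> insert (n + 1) {} \<and> (\<exists>e\<in>?M. d e = w) \<and>
      (\<forall>e\<in>?M. d e = w \<longrightarrow> ?org e \<in> insert (n + 1) {} \<and> e \<notin> set (out_items ?o n (?org e)))}"
      unfolding out by auto
  qed (use dn in auto)
  have F: "forest Leaf ?M n m'"
    unfolding forest_def using Rt Rt0 by auto
  have ms: "main_state (weak_digraph_constraint G) ?M {} (\<lambda>_. []) (out_items ?o n) [] Leaf \<sigma>"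
    unfolding main_state_def regs m'_def[symmetric] R13
  proof (intro conjI allI)
    show "graph_state n ?org d ?M {} (n + 1) (\<lambda>_. []) (out_items ?o n) [] n (fld 15 m') (fld 16 m')
      (fld 17 m') (fld 18 m')" using gs Rz[of 17] Rz[of 18] by simp
    show "lst (fld 10 m') (fld 8 m' w) []" for w using Rz[of 8] by simp
    show "lst (fld 10 m') (fld 9 m' w) (out_items ?o n w)" for w by (rule Rl)
    show "weak_digraph_constraint G A \<longleftrightarrow> constraint Leaf ?org d ?M (n + 1) A" for A
    proof -
      have "constraint Leaf ?org d ?M (n + 1) A \<longleftrightarrow> constraint Leaf ?o d ?M (n + 1) A"
        unfolding constraint_def using R12 by auto
      then show ?thesis using weak_constraint_line_rep[OF G(1) lr] G(2) by simp
    qed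
  qed (use F in simp_all)
  have "graph_state.rest_work n ?org d ?M {} (n + 1) (\<lambda>_. []) (out_items ?o n) \<le> 4 * n + 1"
  proof -
    have "card {e \<in> ?M. P e} \<le> n" for P using card_mono[of ?M "{e \<in> ?M. P e}"] by auto
    note c = this[of "\<lambda>e. d e \<notin> insert (n + 1) {} \<or> e \<in> set []"]
      this[of "\<lambda>e. ?org e \<notin> insert (n + 1) {} \<or> e \<in> set (out_items ?o n (?org e))"]
    have "{..n + 1} - insert (n + 1) {} = {..n}" by auto
    then have "card ({..n + 1} - insert (n + 1) {}) = n + 1" by simp
    then show ?thesis unfolding graph_state.rest_work_def[OF gs] using c by simp
  qed
  then show ?thesis
    unfolding main_inv_def using ms regs(1) R13 m'_def by (metis (no_types, lifting))
qed

end

section \<open>Extracting a solution\<close>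

abbreviation "rq \<equiv> Reg ''q''"
abbreviation "rj \<equiv> Reg ''j''"
abbreviation "rroot \<equiv> Minus (Times (Const 2) inN) (Const 2)"

definition best_step :: "nat \<Rightarrow> program" where
  "best_step f = program.If (Less (Const 0) (Fld f (row rroot rx)))
     (Assign ''q'' (Plus (Times rx (Const 22)) (Const f))) Skip"

text \<open>\<open>q\<close> is overwritten by every entry found while \<open>x\<close> ascends, so
  it ends as the code of an entry of largest size.\<close>

definition best_loop :: program where
  "best_loop = While (Less rx (Plus inC (Const 1)))
     (Seq (seqs (map best_step [0, 1, 2, 3])) (Assign ''x'' (Plus rx (Const 1))))"

definition best_entry :: program where
  "best_entry = Seq (Assign ''q'' (Const 0)) (Seq (Assign ''x'' (Const 0))
     (Seq best_loop (SetFld 21 rroot rq)))"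

text \<open>\<open>a\<close> is the address of the entry chosen for \<open>e\<close>, the start of
  the table plus the code in field 21. This cell holds the choice for the left child plus one, and
  the cell four further on the choice for the right child.\<close>

definition back_body :: program where
  "back_body = Seq (Assign ''e'' (Minus re (Const 1)))
     (Seq (Assign ''a'' (Plus (Times (row re (Const 0)) (Const 22)) (Fld 21 re)))
     (Seq (SetFld 21 (Fld 19 re) (Minus (Mem ra) (Const 1)))
       (SetFld 21 (Fld 20 re) (Mem (Plus ra (Const 4))))))"

definition back_loop :: program where
  "back_loop = Seq (Assign ''e'' (Minus (Times (Const 2) inN) (Const 1)))
     (While (Less inN re) back_body)"

text \<open>The answer is written over the records. This destroys no choice that is still to be
  read: field 21 of record \<open>j\<close> has address \<open>22 * j + 21\<close>, and only the
  cells below \<open>j\<close> have been overwritten when it is read.\<close>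

definition output_loop :: program where
  "output_loop = While (Less rj inN)
     (Seq (program.If (Less (Const 0) (Fld 21 rj)) (Store rj (Const 1)) (Store rj (Const 0)))
       (Assign ''j'' (Plus rj (Const 1))))"

definition solver :: program where
  "solver = Seq arc_loop (Seq item_loop (Seq start (Seq main_loop (Seq best_entry
     (Seq (Assign ''j'' (Const 0)) (Seq back_loop output_loop))))))"

lemma firsts_nonempty: "firsts t \<noteq> {}"
  by (induction t) auto

lemma code_inject: "x * 22 + f = y * 22 + g \<Longrightarrow> f < 4 \<Longrightarrow> g < 4 \<Longrightarrow> x = y \<and> f = (g::nat)"
proof -
  assume eq: "x * 22 + f = y * 22 + g" and "f < 4" "g < 4"
  then have "(x * 22 + f) div 22 = x" "(y * 22 + g) div 22 = y" by simp_all
  then show ?thesis using eq by simp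
qed

context ssgw_ram
begin

abbreviation "last_edge \<equiv> 2 * n - 2"

lemma eval_rroot [simp]: "eval inp \<sigma> rroot = last_edge" by simp

lemma root_less: "last_edge < 2 * n" "last_edge < NI" "2 * n \<le> W"
proof -
  show "last_edge < 2 * n" using n_pos by simp
  then show "last_edge < NI" using n_less_NI(1) by simp
  show "2 * n \<le> W" using n_less_NI(1) by (intro small_le_W) simp
qed

text \<open>The initial code 0 stands for the entry \<open>(0, 0)\<close> of the empty subset, so
  \<open>q\<close> is the code of an attained entry from the start.\<close>

lemma runs_best_entry:
  assumes m: "mem \<sigma> = m" and zero: "(0, 0) \<in> table m last_edge"
  shows "runs best_entry \<sigma> ((c + 2) * 300 + 50) (\<lambda>\<tau>. \<exists>x f. (x, f) \<in> table m last_edge \<and>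
    (\<forall>(y, g)\<in>table m last_edge. y \<le> x) \<and> mem \<tau> = upd 21 last_edge (x * 22 + f) m)"
proof -
  let ?J = "\<lambda>X q. \<exists>x f. q = x * 22 + f \<and> (x, f) \<in> table m last_edge \<and> (\<forall>(y, g)\<in>table m last_edge. y < X \<longrightarrow> y \<le> x)"
  have cN: "c + 1 \<le> W" using c_less_NI le_W(3) by simp
  have fit: "fits f (last_edge * (c + 1) + x)" if "x \<le> c" "f < 22" for x f
    using row_less[OF root_less(1) that(1)] that(2) by (rule fitsI)
  have big: "x * 22 + f \<le> W" if "x \<le> c" "f < 4" for x f
    using fitsI[of x f] c_less_NI that unfolding fits_def by simp
  have big': "x * 22 \<le> W" if "x \<le> c" for x using big[OF that, of 0] by simp
  have tab: "(x, f) \<in> table m last_edge \<longleftrightarrow> 0 < fld f m (last_edge * (c + 1) + x)" if "f < 4" "x \<le> c" for x f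
    using that by (simp add: table_def)
  have step: "wp (seqs (map best_step fs)) (\<lambda>\<tau>. mem \<tau> = m \<and> reg \<tau> ''x'' = X \<and>
      ((\<exists>f\<in>set fs. (X, f) \<in> table m last_edge) \<and> (\<exists>f. (X, f) \<in> table m last_edge \<and> reg \<tau> ''q'' = X * 22 + f) \<or>
       \<not> (\<exists>f\<in>set fs. (X, f) \<in> table m last_edge) \<and> reg \<tau> ''q'' = reg \<sigma> ''q'')) \<sigma>"
    if "mem \<sigma> = m" "reg \<sigma> ''x'' = X" "X \<le> c" "set fs \<subseteq> {..<4}" for fs X and \<sigma> :: state
    using that
  proof (induction fs arbitrary: \<sigma>)
    case Nil
    then show ?case by simp
  next
    case (Cons f fs)
    have f: "f < 4" "set fs \<subseteq> {..<4}" using Cons.prems by auto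
    have W: "f \<le> W" by (rule order_trans[OF _ W_100]) (use f(1) in simp)
    show ?case
    proof (cases "(X, f) \<in> table m last_edge")
      case True
      let ?\<tau> = "\<sigma>\<lparr>reg := (reg \<sigma>)(''q'' := X * 22 + f)\<rparr>"
      have "wp (seqs (map best_step fs)) (\<lambda>\<tau>. mem \<tau> = m \<and> reg \<tau> ''x'' = X \<and>
        ((\<exists>f\<in>set fs. (X, f) \<in> table m last_edge) \<and> (\<exists>f. (X, f) \<in> table m last_edge \<and> reg \<tau> ''q'' = X * 22 + f) \<or>
        \<not> (\<exists>f\<in>set fs. (X, f) \<in> table m last_edge) \<and> reg \<tau> ''q'' = reg ?\<tau> ''q'')) ?\<tau>"
        by (rule Cons.IH) (use Cons.prems f in auto)
      then have "wp (seqs (map best_step fs)) (\<lambda>\<tau>. mem \<tau> = m \<and> reg \<tau> ''x'' = X \<and>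
        ((\<exists>f\<in>set (f # fs). (X, f) \<in> table m last_edge) \<and> (\<exists>f. (X, f) \<in> table m last_edge \<and> reg \<tau> ''q'' = X * 22 + f) \<or>
        \<not> (\<exists>f\<in>set (f # fs). (X, f) \<in> table m last_edge) \<and> reg \<tau> ''q'' = reg \<sigma> ''q'')) ?\<tau>"
        by (rule wp_mono) (use True in auto)
      then show ?thesis
        using True tab[OF f(1) Cons.prems(3)] fit[OF Cons.prems(3), of f] f W Cons.prems root_less
          big[OF Cons.prems(3) f(1)] big'[OF Cons.prems(3)]
        by (simp add: best_step_def[of f])
    next
      case False
      have "wp (seqs (map best_step fs)) (\<lambda>\<tau>. mem \<tau> = m \<and> reg \<tau> ''x'' = X \<and>
        ((\<exists>f\<in>set fs. (X, f) \<in> table m last_edge) \<and> (\<exists>f. (X, f) \<in> table m last_edge \<and> reg \<tau> ''q'' = X * 22 + f) \<or>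
        \<not> (\<exists>f\<in>set fs. (X, f) \<in> table m last_edge) \<and> reg \<tau> ''q'' = reg \<sigma> ''q'')) \<sigma>"
        by (rule Cons.IH) (use Cons.prems f in auto)
      then show ?thesis
        using False tab[OF f(1) Cons.prems(3)] fit[OF Cons.prems(3), of f] f Cons.prems root_less
        by (simp add: best_step_def[of f])
    qed
  qed
  have loop: "runs best_loop \<sigma>' ((c + 2) * 300) (\<lambda>\<tau>. mem \<tau> = m \<and> ?J (c + 1) (reg \<tau> ''q''))"
    if "mem \<sigma>' = m" "reg \<sigma>' ''x'' = 0" "reg \<sigma>' ''q'' = 0" for \<sigma>' :: state
    unfolding best_loop_def
  proof (rule runs_While[where I = "\<lambda>\<tau>. mem \<tau> = m \<and> reg \<tau> ''x'' \<le> c + 1 \<and> ?J (reg \<tau> ''x'') (reg \<tau> ''q'')"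
        and \<mu> = "\<lambda>\<tau>. c + 1 - reg \<tau> ''x''" and T = 250])
    show "mem \<sigma>' = m \<and> reg \<sigma>' ''x'' \<le> c + 1 \<and> ?J (reg \<sigma>' ''x'') (reg \<sigma>' ''q'')"
      using that zero by auto
  next
    fix \<tau> :: state
    show "safe_test \<tau> (Less rx (Plus inC (Const 1)))" using cN by simp
  next
    fix \<tau> :: state
    assume I: "mem \<tau> = m \<and> reg \<tau> ''x'' \<le> c + 1 \<and> ?J (reg \<tau> ''x'') (reg \<tau> ''q'')"
      and "holds inp \<tau> (Less rx (Plus inC (Const 1)))"
    then have X: "reg \<tau> ''x'' \<le> c" by simp
    define X where "X = reg \<tau> ''x''"
    have "wp (seqs (map best_step [0, 1, 2, 3])) (wp (Assign ''x'' (Plus rx (Const 1)))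
      (\<lambda>\<tau>'. (mem \<tau>' = m \<and> reg \<tau>' ''x'' \<le> c + 1 \<and> ?J (reg \<tau>' ''x'') (reg \<tau>' ''q'')) \<and>
        c + 1 - reg \<tau>' ''x'' < c + 1 - reg \<tau> ''x'')) \<tau>"
    proof (rule wp_mono[OF step[of \<tau> X "[0, 1, 2, 3]"]])
      fix \<rho> :: state
      assume r: "mem \<rho> = m \<and> reg \<rho> ''x'' = X \<and>
      ((\<exists>f\<in>set [0, 1, 2, 3]. (X, f) \<in> table m last_edge) \<and> (\<exists>f. (X, f) \<in> table m last_edge \<and> reg \<rho> ''q'' = X * 22 + f) \<or>
       \<not> (\<exists>f\<in>set [0, 1, 2, 3]. (X, f) \<in> table m last_edge) \<and> reg \<rho> ''q'' = reg \<tau> ''q'')"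
      have all: "f \<in> set [0, 1, 2, 3]" if "(X, f) \<in> table m last_edge" for f
        using that by (auto simp: table_def)
      have "?J (X + 1) (reg \<rho> ''q'')"
      proof (cases "\<exists>f. (X, f) \<in> table m last_edge")
        case True
        then obtain f where "(X, f) \<in> table m last_edge" "reg \<rho> ''q'' = X * 22 + f" using r all by blast
        then show ?thesis by (intro exI[of _ X] exI[of _ f]) auto
      next
        case False
        then have q: "reg \<rho> ''q'' = reg \<tau> ''q''" using r by blast
        obtain x f where xf: "reg \<tau> ''q'' = x * 22 + f" "(x, f) \<in> table m last_edge"
          "\<forall>(y, g)\<in>table m last_edge. y < X \<longrightarrow> y \<le> x" using I X_def by blast
        have "\<forall>(y, g)\<in>table m last_edge. y < X + 1 \<longrightarrow> y \<le> x"
          using xf(3) False by (auto simp: less_Suc_eq)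
        then show ?thesis using q xf(1,2) by - (rule exI[of _ x], rule exI[of _ f], simp)
      qed
      then show "wp (Assign ''x'' (Plus rx (Const 1)))
        (\<lambda>\<tau>'. (mem \<tau>' = m \<and> reg \<tau>' ''x'' \<le> c + 1 \<and> ?J (reg \<tau>' ''x'') (reg \<tau>' ''q'')) \<and>
          c + 1 - reg \<tau>' ''x'' < c + 1 - reg \<tau> ''x'') \<rho>"
        using r X cN by (simp add: X_def)
    qed (use I X X_def in auto)
    then have "wp (Seq (seqs (map best_step [0, 1, 2, 3])) (Assign ''x'' (Plus rx (Const 1))))
      (\<lambda>\<tau>'. (mem \<tau>' = m \<and> reg \<tau>' ''x'' \<le> c + 1 \<and> ?J (reg \<tau>' ''x'') (reg \<tau>' ''q'')) \<and>
        c + 1 - reg \<tau>' ''x'' < c + 1 - reg \<tau> ''x'') \<tau>" by (subst wp.simps(4))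
    then show "runs (Seq (seqs (map best_step [0, 1, 2, 3])) (Assign ''x'' (Plus rx (Const 1)))) \<tau> 250
      (\<lambda>\<tau>'. (mem \<tau>' = m \<and> reg \<tau>' ''x'' \<le> c + 1 \<and> ?J (reg \<tau>' ''x'') (reg \<tau>' ''q'')) \<and>
        c + 1 - reg \<tau>' ''x'' < c + 1 - reg \<tau> ''x'')"
      by (rule runs_wp) (simp add: best_step_def row_def)
  next
    fix \<tau> :: state
    assume I: "mem \<tau> = m \<and> reg \<tau> ''x'' \<le> c + 1 \<and> ?J (reg \<tau> ''x'') (reg \<tau> ''q'')"
      and "\<not> holds inp \<tau> (Less rx (Plus inC (Const 1)))"
    then have "reg \<tau> ''x'' = c + 1" by simp
    then show "mem \<tau> = m \<and> ?J (c + 1) (reg \<tau> ''q'')" using I by simp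
  next
    show "(c + 1 - reg \<sigma>' ''x'' + 1) * (1 + test_cost (Less rx (Plus inC (Const 1))) + 250) \<le> (c + 2) * 300"
      by (intro mult_le_mono) auto
  qed
  let ?Q = "\<lambda>\<tau>. \<exists>x f. (x, f) \<in> table m last_edge \<and> (\<forall>(y, g)\<in>table m last_edge. y \<le> x) \<and> mem \<tau> = upd 21 last_edge (x * 22 + f) m"
  have tail: "runs (Seq best_loop (SetFld 21 rroot rq)) \<sigma>' ((c + 2) * 300 + 20) ?Q"
    if "mem \<sigma>' = m" "reg \<sigma>' ''x'' = 0" "reg \<sigma>' ''q'' = 0" for \<sigma>' :: state
  proof (rule runs_Seq_post[OF loop[OF that], where ?T2.0 = 20])
    fix \<rho> :: state
    assume r: "mem \<rho> = m \<and> ?J (c + 1) (reg \<rho> ''q'')"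
    then obtain x f where xf: "reg \<rho> ''q'' = x * 22 + f" "(x, f) \<in> table m last_edge"
      "\<forall>(y, g)\<in>table m last_edge. y < c + 1 \<longrightarrow> y \<le> x" by blast
    have "\<forall>(y, g)\<in>table m last_edge. y \<le> x" using xf(3) by (auto simp: table_def less_Suc_eq_le)
    then have "?Q (\<rho>\<lparr>mem := upd 21 last_edge (reg \<rho> ''q'') (mem \<rho>)\<rparr>)" using r xf by auto
    then have "wp (SetFld 21 rroot rq) ?Q \<rho>"
      using root_less by simp
    then show "runs (SetFld 21 rroot rq) \<rho> 20 ?Q" by (rule runs_wp) simp
  qed simp
  have "wp (Assign ''q'' (Const 0)) (wp (Assign ''x'' (Const 0))
      (\<lambda>\<tau>. runs (Seq best_loop (SetFld 21 rroot rq)) \<tau> ((c + 2) * 300 + 20) ?Q)) \<sigma>"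
    using tail m by simp
  then have "wp (Assign ''q'' (Const 0)) (\<lambda>\<tau>. runs (Seq (Assign ''x'' (Const 0)) (Seq best_loop (SetFld 21 rroot rq))) \<tau>
      ((c + 2) * 300 + 30) ?Q) \<sigma>"
    by (rule wp_mono) (rule runs_Seq_wp, auto)
  then show ?thesis unfolding best_entry_def by (rule runs_Seq_wp) simp
qed

text \<open>\<open>sl\<close> is the content of field 21: the code of an edge splits into those of
  its children as in an admissible combination of table entries.\<close>

definition linked :: "(nat \<Rightarrow> sptree) \<Rightarrow> (nat \<Rightarrow> nat) \<Rightarrow> (nat \<Rightarrow> nat) \<Rightarrow> nat \<Rightarrow> bool" where
  "linked X m sl e \<longleftrightarrow> (\<exists>k x f y g h. X e = Node k (X (fld 19 m e)) (X (fld 20 m e)) \<and>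
     (f, g, h) \<in> set (flag_combos k) \<and> sl e = (x + y) * 22 + h \<and>
     sl (fld 19 m e) = x * 22 + f \<and> (x, f) \<in> table m (fld 19 m e) \<and>
     sl (fld 20 m e) = y * 22 + g \<and> (y, g) \<in> table m (fld 20 m e))"

definition good :: "(nat \<Rightarrow> nat) \<Rightarrow> (nat \<Rightarrow> nat) \<Rightarrow> nat \<Rightarrow> bool" where
  "good m sl e \<longleftrightarrow> (\<exists>x f. sl e = x * 22 + f \<and> (x, f) \<in> table m e)"

lemma linked_good: "linked X m sl e \<Longrightarrow> good m sl (fld 19 m e) \<and> good m sl (fld 20 m e)"
  unfolding linked_def good_def by blast

lemma runs_back_loop:
  assumes F: "forest X {last_edge} (2 * n - 1) m" and m': "mem \<sigma> = upd 21 last_edge q m"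
    and q: "q = x * 22 + f" "(x, f) \<in> table m last_edge" and j: "reg \<sigma> ''j'' = 0"
  shows "runs back_loop \<sigma> ((n + 1) * 200) (\<lambda>\<tau>. reg \<tau> ''j'' = 0 \<and> fld 21 (mem \<tau>) last_edge = q \<and>
    (\<forall>e. n \<le> e \<and> e < 2 * n - 1 \<longrightarrow> linked X m (fld 21 (mem \<tau>)) e))"
proof -
  define I where "I \<tau> \<longleftrightarrow> reg \<tau> ''j'' = 0 \<and> n \<le> reg \<tau> ''e'' \<and> reg \<tau> ''e'' \<le> 2 * n - 1 \<and>
    (\<forall>f<22. f \<noteq> 21 \<longrightarrow> fld f (mem \<tau>) = fld f m) \<and> fld 21 (mem \<tau>) last_edge = q \<and>
    (\<forall>e. reg \<tau> ''e'' \<le> e \<and> e < 2 * n - 1 \<longrightarrow> linked X m (fld 21 (mem \<tau>)) e)" for \<tau> :: state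
  let ?T = "\<lambda>\<tau>. reg \<tau> ''j'' = 0 \<and> fld 21 (mem \<tau>) last_edge = q \<and>
    (\<forall>e. n \<le> e \<and> e < 2 * n - 1 \<longrightarrow> linked X m (fld 21 (mem \<tau>)) e)"
  let ?L = "fld 19 m" and ?R = "fld 20 m"
  note child = forestD(5)[OF F, rule_format]
  have body: "wp back_body (\<lambda>\<tau>'. I \<tau>' \<and> reg \<tau>' ''e'' < reg \<tau> ''e'') \<tau>"
    if t: "I \<tau>" "n < reg \<tau> ''e''" for \<tau>
  proof -
    define e where "e = reg \<tau> ''e'' - 1"
    define sl where "sl = fld 21 (mem \<tau>)"
    have e: "n \<le> e" "e < 2 * n - 1" "reg \<tau> ''e'' = e + 1" using t by (auto simp: e_def I_def)
    have same: "fld f (mem \<tau>) = fld f m" if "f < 22" "f \<noteq> 21" for f using t that unfolding I_def by blast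
    have up: "linked X m sl e'" if "e < e'" "e' < 2 * n - 1" for e'
      using t that e unfolding I_def sl_def by simp
    have slr: "sl last_edge = q" using t unfolding I_def sl_def by blast
    have ch: "?L e < e" "?R e < e" "?L e \<noteq> ?R e" "?L e \<noteq> last_edge" "?R e \<noteq> last_edge"
      using child[of e] e by auto
    \<comment> \<open>The root has the code of the best entry; any other edge is the child of an
      edge with a larger number, which the descending pass has already treated.\<close>
    have gd: "good m sl e"
    proof (cases "e = last_edge")
      case True
      then show ?thesis using slr q unfolding good_def by blast
    next
      case False
      then obtain p where p: "n \<le> p" "p < 2 * n - 1" "?L p = e \<or> ?R p = e"
        using forestD(8)[OF F, rule_format, of e] e by auto
      then have "e < p" using child[of p] by auto
      then show ?thesis using linked_good[OF up[of p]] p by auto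
    qed
    then obtain z h where zh: "sl e = z * 22 + h" "(z, h) \<in> table m e" unfolding good_def by blast
    obtain k where k: "X e = Node k (X (?L e)) (X (?R e))" "choice_ok k (?L e) (?R e) e m"
      using forestD(6)[OF F, rule_format, of e] e by blast
    obtain x f y g where xy: "(f, g, h) \<in> set (flag_combos k)" "z = x + y" "(x, f) \<in> table m (?L e)"
      "(y, g) \<in> table m (?R e)" "fld h m (e * (c + 1) + z) = 1 + (x * 22 + f)"
      "fld (4 + h) m (e * (c + 1) + z) = y * 22 + g"
      using k(2) zh(2) unfolding choice_ok_def by blast
    have zc: "z \<le> c" "h < 4" using zh(2) by (auto simp: table_def)
    define a where "a = (e * (c + 1) + z) * 22 + h"
    have idx: "e * (c + 1) + z < NI" "e < 2 * n" using row_less[of e z] zc e by auto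
    have e0: "e * (c + 1) < NI" using idx by simp
    have a1: "mem \<tau> a = x * 22 + f + 1"
    proof -
      have "fld h (mem \<tau>) (e * (c + 1) + z) = x * 22 + f + 1" using xy(5) same[of h] zc by simp
      then show ?thesis unfolding fld_def a_def .
    qed
    have fit: "a < S" "a + 4 < S" "a \<le> W" "a + 4 \<le> W" "e * (c + 1) * 22 \<le> W" "e * (c + 1) \<le> W"
      using fitsI[OF idx(1), of h] fitsI[OF idx(1), of "h + 4"] fitsI[OF e0, of 0] zc
        le_W(3)[OF e0] unfolding fits_def a_def by auto
    have a_eq: "e * (c + 1) * 22 + sl e = a" unfolding a_def zh(1) by (simp add: algebra_simps)
    have N: "e < NI" "?L e < NI" "?R e < NI"
      using ch idx(2) n_less_NI(1) by linarith+
    define m1 where "m1 = upd 21 (?L e) (x * 22 + f) (mem \<tau>)"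
    have m1a: "m1 (a + 4) = y * 22 + g"
    proof -
      have "fld (4 + h) m1 = fld (4 + h) (mem \<tau>)" unfolding m1_def using zc by simp
      then have "fld (4 + h) m1 (e * (c + 1) + z) = y * 22 + g" using xy(6) same[of "4 + h"] zc by simp
      then show ?thesis unfolding fld_def a_def by (simp add: ac_simps)
    qed
    have m1_20: "fld 20 m1 = fld 20 m" using same[of 20] unfolding m1_def by simp
    define sl' where "sl' = sl(?L e := x * 22 + f, ?R e := y * 22 + g)"
    have sl'_e: "sl' e' = sl e'" if "e \<le> e'" for e' using that ch unfolding sl'_def by auto
    have lk_e: "linked X m sl' e"
      unfolding linked_def
    proof (intro exI conjI)
      show "X e = Node k (X (?L e)) (X (?R e))" by (rule k(1))
      show "(f, g, h) \<in> set (flag_combos k)" by (rule xy(1))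
      show "sl' e = (x + y) * 22 + h" using sl'_e[of e] zh(1) xy(2) by simp
      show "sl' (?L e) = x * 22 + f" "sl' (?R e) = y * 22 + g" using ch(3) by (simp_all add: sl'_def)
    qed (rule xy(3), rule xy(4))
    \<comment> \<open>No two edges share a child, so writing the codes of the children of
      \<open>e\<close> keeps the links of the edges above intact.\<close>
    have lk: "linked X m sl' e'" if "e \<le> e'" "e' < 2 * n - 1" for e'
    proof (cases "e' = e")
      case False
      then have "{?L e, ?R e} \<inter> {?L e', ?R e'} = {}"
        using forestD(7)[OF F, rule_format, of e e'] that e by simp
      then have "sl' (?L e') = sl (?L e')" "sl' (?R e') = sl (?R e')" unfolding sl'_def by auto
      then show ?thesis using up[of e'] False that sl'_e[OF that(1)] unfolding linked_def by simp
    qed (use lk_e in simp)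
    let ?\<tau> = "\<tau>\<lparr>reg := (reg \<tau>)(''e'' := e, ''a'' := a), mem := upd 21 (?R e) (y * 22 + g) m1\<rparr>"
    have "fld 21 (mem ?\<tau>) = sl'" unfolding sl'_def sl_def m1_def by simp
    moreover have "fld f (mem ?\<tau>) = fld f m" if "f < 22" "f \<noteq> 21" for f
      using same[OF that] that unfolding m1_def by simp
    moreover have "sl' last_edge = q" using ch slr unfolding sl'_def by simp
    ultimately have "I ?\<tau> \<and> reg ?\<tau> ''e'' < reg \<tau> ''e''"
      using t e lk unfolding I_def by simp
    then show ?thesis
      using N fit a1 m1a m1_20 a_eq e idx(2) le_W(3)[OF e0]
      by (simp add: back_body_def same sl_def[symmetric] m1_def[symmetric] del: distrib_right_numeral)
  qed
  have "runs (While (Less inN re) back_body) \<tau> ((n + 1) * 150) ?T"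
    if "I \<tau>" "reg \<tau> ''e'' = 2 * n - 1" for \<tau>
  proof (rule runs_While[where I = I and \<mu> = "\<lambda>\<tau>. reg \<tau> ''e'' - n" and T = 100])
    show "I \<tau>" by (rule that)
    show "safe_test \<tau>' (Less inN re)" for \<tau>' by simp
  next
    fix \<rho> assume r: "I \<rho>" "holds inp \<rho> (Less inN re)"
    then have e: "n < reg \<rho> ''e''" by simp
    have "wp back_body (\<lambda>\<tau>'. I \<tau>' \<and> reg \<tau>' ''e'' - n < reg \<rho> ''e'' - n) \<rho>"
      by (rule wp_mono[OF body[OF r(1) e]]) (use e in \<open>auto simp: I_def\<close>)
    then show "runs back_body \<rho> 100 (\<lambda>\<tau>'. I \<tau>' \<and> reg \<tau>' ''e'' - n < reg \<rho> ''e'' - n)"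
      by (rule runs_wp) (simp add: back_body_def row_def)
  next
    fix \<rho> assume r: "I \<rho>" "\<not> holds inp \<rho> (Less inN re)"
    then have "reg \<rho> ''e'' = n" by (simp add: I_def)
    then show "?T \<rho>" using r unfolding I_def by simp
  next
    show "(reg \<tau> ''e'' - n + 1) * (1 + test_cost (Less inN re) + 100) \<le> (n + 1) * 150"
      using that by (intro mult_le_mono) auto
  qed
  moreover have "I (\<sigma>\<lparr>reg := (reg \<sigma>)(''e'' := 2 * n - 1)\<rparr>)"
    using n_pos j m' by (auto simp: I_def fld_upd)
  ultimately have "wp (Assign ''e'' (Minus (Times (Const 2) inN) (Const 1)))
      (\<lambda>\<tau>. runs (While (Less inN re) back_body) \<tau> ((n + 1) * 150) ?T) \<sigma>"
    using root_less by simp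
  then show ?thesis unfolding back_loop_def by (rule runs_Seq_wp) simp
qed

text \<open>The code of an item is 0 or that of \<open>(s e, 3)\<close>, so being nonzero tells
  whether the item is chosen. Going up from the items, the codes that had been handed down turn out
  to be size and flag of the subset really chosen.\<close>

lemma linked_solution:
  assumes F: "forest X {last_edge} (2 * n - 1) m" and sizes: "\<And>e. e < n \<Longrightarrow> 0 < s e"
    and lk: "\<And>e. n \<le> e \<Longrightarrow> e < 2 * n - 1 \<Longrightarrow> linked X m sl e"
    and rt: "good m sl last_edge"
    and A: "A = {v. v < n \<and> sl v \<noteq> 0}" and e: "e < 2 * n - 1"
  shows "valid (X e) A \<and> sl e = sum s (A \<inter> leaves (X e)) * 22 + tree_flag (X e) A"
  using e
proof (induction e rule: less_induct)
  case (less e)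
  show ?case
  proof (cases "e < n")
    case True
    then have X: "X e = Leaf e" using forestD(4)[OF F] by blast
    have "good m sl e"
    proof (cases "e = last_edge")
      case False
      then obtain p where p: "n \<le> p" "p < 2 * n - 1" "fld 19 m p = e \<or> fld 20 m p = e"
        using forestD(8)[OF F, rule_format, of e] less.prems by auto
      then show ?thesis using linked_good[OF lk[of p]] by auto
    qed (use rt in simp)
    then obtain x f where xf: "sl e = x * 22 + f" "(x, f) \<in> table m e" unfolding good_def by blast
    have "(x, f) = (0, 0) \<or> (x, f) = (s e, 3)"
      using xf(2) forestD(9)[OF F, rule_format, OF less.prems] unfolding X reach_Leaf by auto
    then show ?thesis
    proof
      assume "(x, f) = (0, 0)"
      then have "sl e = 0" "e \<notin> A" using xf A by auto
      then show ?thesis by (simp add: X tree_flag_def flag_def)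
    next
      assume "(x, f) = (s e, 3)"
      then have "sl e = s e * 22 + 3" "e \<in> A" using xf A True by auto
      moreover from this have "A \<inter> {e} = {e}" by auto
      ultimately show ?thesis by (simp add: X tree_flag_def flag_def)
    qed
  next
    case False
    let ?L = "fld 19 m e" and ?R = "fld 20 m e"
    obtain k x f y g h where l: "X e = Node k (X ?L) (X ?R)" "(f, g, h) \<in> set (flag_combos k)"
      "sl e = (x + y) * 22 + h" "sl ?L = x * 22 + f" "(x, f) \<in> table m ?L"
      "sl ?R = y * 22 + g" "(y, g) \<in> table m ?R"
      using lk[of e] False less.prems unfolding linked_def by auto
    have lt: "?L < e" "?R < e" using forestD(5)[OF F, rule_format, of e] False less.prems by auto
    have fg: "f < 4" "g < 4" using flag_combos_less[OF l(2)] by auto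
    have IH: "valid (X ?L) A" "sl ?L = sum s (A \<inter> leaves (X ?L)) * 22 + tree_flag (X ?L) A"
      "valid (X ?R) A" "sl ?R = sum s (A \<inter> leaves (X ?R)) * 22 + tree_flag (X ?R) A"
      using less.IH[OF lt(1)] less.IH[OF lt(2)] lt less.prems by auto
    have tf: "tree_flag t A < 4" for t by (simp add: tree_flag_def flag_less)
    have 1: "x = sum s (A \<inter> leaves (X ?L))" "f = tree_flag (X ?L) A"
      using code_inject[of x f "sum s (A \<inter> leaves (X ?L))"] IH(2) l(4) fg tf by auto
    have 2: "y = sum s (A \<inter> leaves (X ?R))" "g = tree_flag (X ?R) A"
      using code_inject[of y g "sum s (A \<inter> leaves (X ?R))"] IH(4) l(6) fg tf by auto
    have "leaves (X ?L) \<inter> leaves (X ?R) = {}"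
      using forestD(3)[OF F, rule_format, OF less.prems] unfolding l(1) by simp
    then have "sum s (A \<inter> leaves (X e)) = x + y"
      unfolding l(1) leaves.simps Int_Un_distrib 1 2
      by (intro sum.union_disjoint) (auto simp: finite_leaves)
    then show ?thesis
      using tree_flag_Node[OF l(2) 1(2)[symmetric] 2(2)[symmetric] IH(1,3)] l(1,3) by simp
  qed
qed

lemma runs_output_loop:
  assumes "reg \<sigma> ''j'' = 0" "fld 21 (mem \<sigma>) = sl"
  shows "runs output_loop \<sigma> ((n + 1) * 100) (\<lambda>\<tau>. output_set n \<tau> = {v. v < n \<and> sl v \<noteq> 0})"
proof -
  define I where "I \<tau> \<longleftrightarrow> reg \<tau> ''j'' \<le> n \<and> (\<forall>i<reg \<tau> ''j''. mem \<tau> i = of_bool (sl i \<noteq> 0)) \<and>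
    (\<forall>a\<ge>reg \<tau> ''j''. mem \<tau> a = mem \<sigma> a)" for \<tau> :: state
  show ?thesis
    unfolding output_loop_def
  proof (rule runs_While[where I = I and \<mu> = "\<lambda>\<tau>. n - reg \<tau> ''j''" and T = 50])
    show "I \<sigma>" using assms by (simp add: I_def)
    show "safe_test \<tau> (Less rj inN)" for \<tau> by simp
  next
    fix \<tau> assume t: "I \<tau>" "holds inp \<tau> (Less rj inN)"
    define j where "j = reg \<tau> ''j''"
    have j: "j < n" using t by (simp add: j_def)
    have N: "j < NI" using j n_less_NI by simp
    have jS: "j < S" using N S_big by simp
    have "fld 21 (mem \<tau>) j = sl j" using t assms(2) unfolding I_def fld_def j_def by auto
    moreover have "I (\<tau>\<lparr>mem := (mem \<tau>)(j := of_bool (sl j \<noteq> 0)), reg := (reg \<tau>)(''j'' := j + 1)\<rparr>)"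
      using t j unfolding I_def by (auto simp: j_def less_Suc_eq)
    ultimately have "wp (Seq (program.If (Less (Const 0) (Fld 21 rj)) (Store rj (Const 1)) (Store rj (Const 0)))
       (Assign ''j'' (Plus rj (Const 1)))) (\<lambda>\<tau>'. I \<tau>' \<and> n - reg \<tau>' ''j'' < n - reg \<tau> ''j'') \<tau>"
      using N jS j le_W(1)[OF N] by (cases "sl j = 0") (simp_all add: j_def[symmetric])
    then show "runs (Seq (program.If (Less (Const 0) (Fld 21 rj)) (Store rj (Const 1)) (Store rj (Const 0)))
       (Assign ''j'' (Plus rj (Const 1)))) \<tau> 50 (\<lambda>\<tau>'. I \<tau>' \<and> n - reg \<tau>' ''j'' < n - reg \<tau> ''j'')"
      by (rule runs_wp) simp
  next
    fix \<tau> assume t: "I \<tau>" "\<not> holds inp \<tau> (Less rj inN)"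
    then have "reg \<tau> ''j'' = n" by (simp add: I_def)
    then show "output_set n \<tau> = {v. v < n \<and> sl v \<noteq> 0}"
      using t unfolding I_def output_set_def by (auto simp: of_bool_def split: if_splits)
  next
    show "(n - reg \<sigma> ''j'' + 1) * (1 + test_cost (Less rj inN) + 50) \<le> (n + 1) * 100"
      by (intro mult_le_mono) auto
  qed
qed

definition solver_time :: nat where
  "solver_time = (length es + 1) * 200 + (n + 1) * 300 + 20 + (4 * n + 2) * (merge_time + 700) +
     ((c + 2) * 300 + 50) + 10 + (n + 1) * 200 + (n + 1) * 100"

lemma runs_solver:
  assumes G: "minimal_series_parallel G" "pverts G = {..<n}" "parcs G = set es"
    and sizes: "\<And>e. e < n \<Longrightarrow> 0 < s e"
  shows "runs solver initial_state solver_time (\<lambda>\<tau>. ssgw_solution G s c (output_set n \<tau>))"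
proof -
  let ?weak = "weak_digraph_constraint G"
  let ?Q = "\<lambda>\<tau>. ssgw_solution G s c (output_set n \<tau>)"
  let ?T7 = "(n + 1) * 100" and ?T6 = "(n + 1) * 200" and ?T4 = "(c + 2) * 300 + 50"
    and ?T3 = "(4 * n + 2) * (merge_time + 700)"
  have final: "?Q \<tau>" if F: "forest X {last_edge} (2 * n - 1) m" and wk: "\<And>A. ?weak A \<longleftrightarrow> valid (X last_edge) A"
    and x: "(x, f) \<in> table m last_edge" "\<forall>(y, g)\<in>table m last_edge. y \<le> x"
    and sl: "sl last_edge = x * 22 + f" "\<forall>e. n \<le> e \<and> e < 2 * n - 1 \<longrightarrow> linked X m sl e"
    and out: "output_set n \<tau> = {v. v < n \<and> sl v \<noteq> 0}" for X m x f sl \<tau>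
  proof -
    define A where "A = output_set n \<tau>"
    have rt: "last_edge < 2 * n - 1" using n_pos by simp
    have lv: "leaves (X last_edge) = {..<n}" using forestD(2)[OF F] by simp
    have tab: "table m last_edge = {(x, f). (x, f) \<in> reach s (X last_edge) \<and> x \<le> c}"
      using forestD(9)[OF F, rule_format, OF rt] .
    have "good m sl last_edge" unfolding good_def using sl(1) x(1) by blast
    then have sol: "valid (X last_edge) A" "sl last_edge = sum s (A \<inter> {..<n}) * 22 + tree_flag (X last_edge) A"
      using linked_solution[OF F sizes, of sl A last_edge] sl(2) out rt lv unfolding A_def by auto
    have sub: "A \<subseteq> {..<n}" unfolding A_def out by auto
    then have "sum s (A \<inter> {..<n}) = sum s A" by (simp add: Int_absorb2)
    then have "x = sum s A"
      using code_inject[of x f "sum s A" "tree_flag (X last_edge) A"] sl(1) sol(2) x(1)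
      by (simp add: table_def tree_flag_def flag_less)
    moreover have "x \<le> c" using x(1) by (simp add: table_def)
    ultimately have feas: "ssgw_feasible G s c A" and xA: "x = sum s A"
      unfolding ssgw_feasible_def using sub G(2) wk sol(1) by auto
    \<comment> \<open>Every feasible subset appears with its size in the exact table of the root,
      where the largest size was taken.\<close>
    have "sum s B \<le> x" if B: "ssgw_feasible G s c B" for B
    proof -
      have "B \<inter> leaves (X last_edge) = B" "sum s B \<le> c" "valid (X last_edge) B"
        using B G(2) wk lv unfolding ssgw_feasible_def by auto
      then have "(sum s B, tree_flag (X last_edge) B) \<in> table m last_edge"
        unfolding tab reach_def by (auto intro!: exI[of _ B])
      then show ?thesis using x(2) by blast
    qed
    then show ?thesis unfolding ssgw_solution_def is_arg_max_def A_def[symmetric] using feas xA by (auto simp: not_less)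
  qed
  have "runs (Seq arc_loop (Seq item_loop (Seq start (Seq main_loop (Seq best_entry
     (Seq (Assign ''j'' (Const 0)) (Seq back_loop output_loop))))))) initial_state
     ((length es + 1) * 200 + ((n + 1) * 300 + (20 + (?T3 + (?T4 + (10 + (?T6 + ?T7))))))) ?Q"
  proof (rule runs_Seq_post[OF runs_arc_loop _ order_refl])
    fix \<sigma>1 :: state
    assume 1: "arcs_read (length es) (mem \<sigma>1) \<and> reg \<sigma>1 ''e'' = 0"
    define m1 where "m1 = mem \<sigma>1"
    have rd: "arcs_read (length es) m1" using 1 by (simp add: m1_def)
    show "runs (Seq item_loop (Seq start (Seq main_loop (Seq best_entry
     (Seq (Assign ''j'' (Const 0)) (Seq back_loop output_loop)))))) \<sigma>1
     ((n + 1) * 300 + (20 + (?T3 + (?T4 + (10 + (?T6 + ?T7)))))) ?Q"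
    proof (rule runs_Seq_post[OF runs_item_loop[OF rd m1_def[symmetric] conjunct2[OF 1] sizes] _ order_refl])
      fix \<sigma>2 :: state
      assume 2: "items_read (fld 13 m1) (fld 14 m1) n (mem \<sigma>2)"
      have 3: "runs (Seq main_loop (Seq best_entry
         (Seq (Assign ''j'' (Const 0)) (Seq back_loop output_loop)))) \<sigma>3 (?T3 + (?T4 + (10 + (?T6 + ?T7)))) ?Q"
        if \<sigma>3: "mem \<sigma>3 = mem \<sigma>2" "reg \<sigma>3 ''v'' = n + 1" "reg \<sigma>3 ''id'' = n" "reg \<sigma>3 ''top'' = 0" for \<sigma>3 :: state
      proof -
        obtain w where w: "w \<le> 4 * n + 1" "main_inv ?weak w \<sigma>3"
          using start_main_inv[OF G rd _ \<sigma>3(2-4)] 2 \<sigma>3(1) by auto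
        have "(w + 1) * (merge_time + 700) \<le> ?T3" using w(1) by (intro mult_le_mono1) simp
        from runs_mono[OF runs_main_loop[OF w(2)] this] have ml: "runs main_loop \<sigma>3 ?T3 (reduced ?weak)" by blast
        show ?thesis
        proof (rule runs_Seq_post[OF ml _ order_refl])
          fix \<sigma>4 :: state
          assume "reduced ?weak \<sigma>4"
          then obtain X where F: "forest X {last_edge} (2 * n - 1) (mem \<sigma>4)"
            and wk: "\<And>A. ?weak A \<longleftrightarrow> valid (X last_edge) A" unfolding reduced_def by blast
          define m where "m = mem \<sigma>4"
          have rt: "last_edge < 2 * n - 1" using n_pos by simp
          have "(0, 0) \<in> reach s (X last_edge)"
            unfolding reach_def using valid_empty lasts_nonempty firsts_nonempty
            by (intro CollectI exI[of _ "{}"]) (simp add: tree_flag_def flag_def)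
          then have zero: "(0, 0) \<in> table m last_edge"
            using forestD(9)[OF F, rule_format, OF rt] by (simp add: m_def)
          show "runs (Seq best_entry (Seq (Assign ''j'' (Const 0)) (Seq back_loop output_loop))) \<sigma>4
              (?T4 + (10 + (?T6 + ?T7))) ?Q"
          proof (rule runs_Seq_post[OF runs_best_entry[OF m_def[symmetric] zero] _ order_refl])
            fix \<sigma>5 :: state
            assume "\<exists>x f. (x, f) \<in> table m last_edge \<and> (\<forall>(y, g)\<in>table m last_edge. y \<le> x) \<and>
              mem \<sigma>5 = upd 21 last_edge (x * 22 + f) m"
            then obtain x f where x: "(x, f) \<in> table m last_edge" "\<forall>(y, g)\<in>table m last_edge. y \<le> x"
              "mem \<sigma>5 = upd 21 last_edge (x * 22 + f) m" by blast
            let ?\<sigma>6 = "\<sigma>5\<lparr>reg := (reg \<sigma>5)(''j'' := 0)\<rparr>"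
            have "runs (Seq back_loop output_loop) ?\<sigma>6 (?T6 + ?T7) ?Q"
            proof (rule runs_Seq_post[OF runs_back_loop[OF F[folded m_def] _ refl x(1)] _ order_refl])
              show "mem ?\<sigma>6 = upd 21 last_edge (x * 22 + f) m" using x(3) by simp
              show "reg ?\<sigma>6 ''j'' = 0" by simp
              fix \<sigma>7 :: state
              assume 7: "reg \<sigma>7 ''j'' = 0 \<and> fld 21 (mem \<sigma>7) last_edge = x * 22 + f \<and>
                (\<forall>e. n \<le> e \<and> e < 2 * n - 1 \<longrightarrow> linked X m (fld 21 (mem \<sigma>7)) e)"
              show "runs output_loop \<sigma>7 ?T7 ?Q"
                by (rule runs_mono[OF runs_output_loop[OF conjunct1[OF 7] refl] order_refl])
                  (rule final[OF F[folded m_def] wk x(1,2)], use 7 in auto)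
            qed
            then have "wp (Assign ''j'' (Const 0)) (\<lambda>\<tau>. runs (Seq back_loop output_loop) \<tau> (?T6 + ?T7) ?Q) \<sigma>5"
              by simp
            then show "runs (Seq (Assign ''j'' (Const 0)) (Seq back_loop output_loop)) \<sigma>5 (10 + (?T6 + ?T7)) ?Q"
              by (rule runs_Seq_wp) simp
          qed
        qed
      qed
      have "n + 1 \<le> W" using n_less_NI(2) le_W(3) by simp
      then have "wp start (\<lambda>\<tau>. runs (Seq main_loop (Seq best_entry
         (Seq (Assign ''j'' (Const 0)) (Seq back_loop output_loop)))) \<tau> (?T3 + (?T4 + (10 + (?T6 + ?T7)))) ?Q) \<sigma>2"
        using 3 by (simp add: start_def)
      then show "runs (Seq start (Seq main_loop (Seq best_entry
         (Seq (Assign ''j'' (Const 0)) (Seq back_loop output_loop))))) \<sigma>2 (20 + (?T3 + (?T4 + (10 + (?T6 + ?T7))))) ?Q"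
        by (rule runs_Seq_wp) (simp add: start_def)
    qed
  qed
  then show ?thesis unfolding solver_def solver_time_def by (simp only: add.assoc)
qed

end

section \<open>Bounds for word length, time and space\<close>

lemma word_limit_large:
  assumes "{n, m, c} \<subseteq> set inp" "length inp = 3 + n + 2 * m" "0 < n"
  shows "100 * (2 * n * (c + 1) + length inp + 1) \<le> word_limit 8 inp"
    and "x \<in> set inp \<Longrightarrow> x \<le> word_limit 8 inp"
proof -
  define B where "B = Max (set inp) + 2"
  have le: "y + 2 \<le> B" if "y \<in> set inp" for y using that by (simp add: B_def)
  have B: "n + 2 \<le> B" "m + 2 \<le> B" "c + 2 \<le> B" using assms(1) le by auto
  show "x \<le> word_limit 8 inp" if "x \<in> set inp"
  proof -
    have "x \<le> B" using le[OF that] by simp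
    also have "B \<le> B ^ 8" by (rule self_le_power) (simp_all add: B_def)
    finally show ?thesis by (simp add: word_limit_def B_def)
  qed
  show "100 * (2 * n * (c + 1) + length inp + 1) \<le> word_limit 8 inp"
  proof -
    have B3: "3 \<le> B" using B(1) assms(3) by simp
    have "n * (c + 1) \<le> B * B" using B by (intro mult_le_mono) auto
    moreover have "3 * B \<le> B * B" using B3 by (rule mult_le_mono1)
    moreover have "2 * n * (c + 1) = 2 * (n * (c + 1))" by simp
    moreover have "length inp + 1 \<le> 3 * B" using B assms(2) by simp
    ultimately have "2 * n * (c + 1) + (length inp + 1) \<le> 3 * (B * B)" by presburger
    then have "100 * (2 * n * (c + 1) + length inp + 1) \<le> 300 * (B * B)" by simp
    \<comment> \<open>An item exists, so \<open>B \<ge> 3\<close>, and the constant becomes a power: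
      \<open>300 \<le> 3 ^ 6 \<le> B ^ 6\<close>. With the quadratic number of records this gives
      the exponent 8.\<close>
    also have "\<dots> \<le> 3 ^ 6 * (B * B)" by simp
    also have "\<dots> \<le> B ^ 6 * (B * B)" using B3 by (intro mult_le_mono1 power_mono) auto
    also have "\<dots> = B ^ 8" by (simp add: power_numeral_reduce)
    finally show ?thesis by (simp add: word_limit_def B_def)
  qed
qed

text \<open>The time is governed by linearly many merges of order \<open>c ^ 2\<close>. As
  \<open>n\<close> and \<open>c\<close> are positive, \<open>Z\<close> absorbs
  \<open>n * c ^ 2\<close>, the terms in \<open>n\<close> or \<open>c\<close> alone and the
  constants.\<close>

lemma (in ssgw_ram) solver_time_le:
  "solver_time \<le> (6 * (9 * merge_cost + 100) + 10000) * (n * c ^ 4 + length es)"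
proof -
  define K where "K = 9 * merge_cost + 100"
  define Z where "Z = n * c ^ 4"
  have c1: "1 \<le> c" using c_pos by simp
  have "c ^ 2 \<le> c ^ 4" using c1 by (intro power_increasing) simp_all
  moreover have "1 \<le> c ^ 4" using c1 by (rule one_le_power)
  moreover have "c \<le> c ^ 4" using c1 by (rule self_le_power) simp
  ultimately have Z: "n * c ^ 2 \<le> Z" "n * 1 \<le> Z" "1 * c \<le> Z" "1 * 1 \<le> Z"
    unfolding Z_def using n_pos by (intro mult_le_mono; simp)+
  \<comment> \<open>Applied to both factors of \<open>merge_time\<close>, this yields the 9 before
    \<open>merge_cost\<close>; the 100 in \<open>K\<close> collects the 90 from
    \<open>3 * 30\<close> and the final 10.\<close>
  have c3: "c + 2 \<le> 3 * c" using c_pos by simp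
  have "merge_time \<le> (3 * c) * ((3 * c) * merge_cost + 30) + 10"
    unfolding merge_time_def using c3 by (intro add_mono mult_le_mono) auto
  also have "\<dots> = 9 * merge_cost * c ^ 2 + 90 * c + 10" by (simp add: power2_eq_square algebra_simps)
  also have "\<dots> \<le> 9 * merge_cost * c ^ 2 + 90 * c ^ 2 + 10 * c ^ 2"
    using c_pos by (intro add_mono) (auto simp: power2_eq_square)
  also have "\<dots> = K * c ^ 2" by (simp add: K_def algebra_simps)
  finally have mt: "merge_time \<le> K * c ^ 2" .
  have "(4 * n + 2) * (merge_time + 700) \<le> (6 * n) * (K * c ^ 2 + 700)"
    using mt n_pos by (intro mult_le_mono) auto
  also have "\<dots> = 6 * K * (n * c ^ 2) + 4200 * n" by (simp add: algebra_simps)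
  also have "\<dots> \<le> 6 * K * Z + 4200 * Z" using Z(1,2) by (intro add_mono mult_le_mono2) auto
  finally have main: "(4 * n + 2) * (merge_time + 700) \<le> 6 * K * Z + 4200 * Z" .
  have "solver_time \<le> (200 * length es + 200 * Z) + (300 * Z + 300 * Z) + 20 * Z + (6 * K * Z + 4200 * Z) +
      (300 * Z + 600 * Z + 50 * Z) + 10 * Z + (200 * Z + 200 * Z) + (100 * Z + 100 * Z)"
    unfolding solver_time_def using main Z(2-4) by (intro add_mono) auto
  also have "\<dots> \<le> 6 * K * Z + 10000 * Z + 10000 * length es" by simp
  also have "\<dots> \<le> (6 * K + 10000) * (Z + length es)" by (simp add: algebra_simps)
  finally show ?thesis unfolding K_def Z_def .
qed

theorem theorem7:
  shows "\<exists>(P :: program) (k :: nat) (C\<^sub>T :: nat) (C\<^sub>S :: nat).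
    \<forall>(G :: nat pair_pre_digraph) (s :: nat \<Rightarrow> nat) (c :: nat) (n :: nat) (m :: nat).
      ssgw_instance G s c \<and> minimal_series_parallel G \<and>
      pverts G = {..<n} \<and> card (parcs G) = m \<longrightarrow>
      solves_ssgw_within k P G s c (C\<^sub>T * (n * c ^ 4 + m)) (C\<^sub>S * (n * c ^ 2))"
proof (intro exI allI impI)
  fix G :: "nat pair_pre_digraph" and s :: "nat \<Rightarrow> nat" and c n m :: nat
  assume inst: "ssgw_instance G s c \<and> minimal_series_parallel G \<and> pverts G = {..<n} \<and> card (parcs G) = m"
  then have G: "minimal_series_parallel G" "pverts G = {..<n}" and cp: "0 < c"
    and sizes: "\<And>e. e < n \<Longrightarrow> 0 < s e"
    by (auto simp: ssgw_instance_def)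
  have np: "0 < n" using msp_basic[OF G(1)] G(2) by (auto simp: sources_def intro: Nat.gr0I)
  \<comment> \<open>The witnesses are chosen independently of the instance;
    \<open>merge_cost\<close> is a constant of the program text.\<close>
  show "solves_ssgw_within 8 solver G s c ((6 * (9 * ssgw_ram.merge_cost + 100) + 10000) * (n * c ^ 4 + m))
      (88 * (n * c ^ 2))"
    unfolding solves_ssgw_within_def Let_def
  proof (intro allI impI)
    fix es assume es: "distinct es \<and> set es = parcs G"
    have m: "length es = m" using es inst distinct_card by metis
    let ?inp = "encode n s c es"
    have len: "length ?inp = 3 + n + 2 * length es"
    proof -
      have "length (concat (map (\<lambda>(u, v). [u, v]) es)) = 2 * length es" by (induction es) auto
      then show ?thesis by (simp add: encode_def)
    qed
    have sub: "{n, length es, c} \<subseteq> set ?inp" by (simp add: encode_def)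
    interpret ssgw_ram "word_limit 8 ?inp" "88 * (n * c ^ 2)" n c s es
    proof
      show "100 * (2 * n * (c + 1) + length ?inp + 1) \<le> word_limit 8 ?inp"
        by (rule word_limit_large(1)[OF sub len np])
      show "x \<le> word_limit 8 ?inp" if "x \<in> set ?inp" for x by (rule word_limit_large(2)[OF sub len np that])
      \<comment> \<open>The 88 arises here: \<open>2 * n * (c + 1)\<close> records of 22 cells, and
        \<open>c + 1 \<le> 2 * c ^ 2\<close> for positive \<open>c\<close>.\<close>
      have "c \<le> c ^ 2" by (rule self_le_power) (use cp in auto)
      moreover have "1 \<le> c ^ 2" by (rule one_le_power) (use cp in simp)
      ultimately have "c + 1 \<le> c ^ 2 + c ^ 2" by (rule add_mono)
      then have "c + 1 \<le> 2 * c ^ 2" by simp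
      then have "44 * n * (c + 1) \<le> 44 * n * (2 * c ^ 2)" by (rule mult_le_mono2)
      then show "22 * (2 * n * (c + 1)) \<le> 88 * (n * c ^ 2)" by simp
      show "u < n \<and> v < n" if "(u, v) \<in> set es" for u v
        using that es msp_basic[OF G(1)] G(2) by auto
    qed (use np cp in auto)
    have "bounded initial_state" by (simp add: bounded_def initial_state_def)
    then obtain t \<tau> where run: "exec (word_limit 8 ?inp) (88 * (n * c ^ 2)) ?inp solver initial_state t \<tau>"
      "t \<le> solver_time" "ssgw_solution G s c (output_set n \<tau>)"
      using runs_solver[OF G _ sizes] es unfolding runs_def by auto
    have cn: "card (pverts G) = n" using G(2) by simp
    have "t \<le> (6 * (9 * merge_cost + 100) + 10000) * (n * c ^ 4 + m)"
      using run(2) solver_time_le unfolding m by (rule order_trans)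
    then show "\<exists>t \<tau>. exec (word_limit 8 (encode (card (pverts G)) s c es)) (88 * (n * c ^ 2))
        (encode (card (pverts G)) s c es) solver initial_state t \<tau> \<and>
        t \<le> (6 * (9 * ssgw_ram.merge_cost + 100) + 10000) * (n * c ^ 4 + m) \<and>
        ssgw_solution G s c (output_set (card (pverts G)) \<tau>)"
      unfolding cn using run(1,3) by blast
  qed
qed

end
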